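(* Let $d:=p\cdot n$ satisfy $\log^3 n\ll d\ll n$. Let $i=i(n)\in\mathbb{N}$ be the largest integer $i$ such that $d^i/n\le 3\log n$, and let $c=c(n)=d^i/n$. Then asymptotically almost surely $G\in\mathcal{G}(n,p)$ satisfies the following. (i) If $c\to A\in\mathbb{R}_+$, then $\zeta(G)\le(1+o(1))\left(\log d+2\log\log n\right)\frac{e^A}{1-e^{-A}}$. (ii) If $c\to\infty$ and $c-(\log d-\log\log d)\to-\infty$, then $\zeta(G)\le(1+o(1))\left(\log d+2\log\log n\right)e^c$. (iii) If $c-(\log d-\log\log d)\to B\in\mathbb{R}$, then \[ \zeta(G)\le(1+o(1))\left(\log d+2\log\log n\right)\frac{e^c}{e^B+1}\sim\left(\log d+2\log\log n\right)\frac{n}{d^{i-1}(1+e^{-B})}. \] (iv) If $c-(\log d-\log\log d)\to\infty$ and $c\le 3\log n$, then $\zeta(G)\le(1+o(1))\left(\log d+2\log\log n\right)\frac{n}{d^{i-1}}$.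
   Context: $\mathcal{G}(n,p)$ is the binomial random graph on vertex set $[n]$ where each pair is an edge independently with probability $p=p(n)$. A property holds asymptotically almost surely (a.a.s.) if its probability tends to $1$ as $n\to\infty$. Notation: $f\ll g$ means $f/g\to 0$; $f\sim g$ means $f=(1+o(1))g$; $\mathbb{R}_+$ denotes the positive reals; $\log$ is the natural logarithm. Localization game with $k$ sensors on a connected graph $G$: in round $1$ the cops choose a set $S_1\subseteq V(G)$ with $|S_1|=k$, then the (invisible) robber chooses a vertex $v_1$; in each round $t\ge 2$ the cops choose a new set $S_t$ of size $k$ (based on all previous information), then the robber moves to a vertex $v_t$ at distance at most $1$ from $v_{t-1}$. After each round the cops learn the vector of graph distances from the robber's current vertex to the vertices of $S_t$. The cops win in round $t$ if every two walks $(w_1,\dots,w_t)$, $(x_1,\dots,x_t)$ (consecutive vertices equal or adjacent) which produce the same sequence of distance vectors with respect to $(S_1,\dots,S_t)$ satisfy $w_t=x_t$. The localization number $\zeta(G)$ is the least $k$ such that the cops can win in finite time against every robber strategy. *)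

theory Defs
  imports "HOL-Probability.Probability" "HOL-Library.Landau_Symbols" "HOL-Library.Extended_Nat"
begin

section \<open>The localization game\<close>

text \<open>
  A finite simple graph is given by its finite vertex set V and its set E of edges, each edge
  being a two-element subset of V.
  The distance is the least length of a walk, and infinity between different components; on
  connected graphs, for which the game is intended, it is the usual graph distance.
\<close>

definition graph_dist :: "'a set set \<Rightarrow> 'a \<Rightarrow> 'a \<Rightarrow> enat" where
  "graph_dist E u v = (INF m \<in> {m::nat. ((\<lambda>x y. {x, y} \<in> E) ^^ m) u v}. enat m)"

definition dist_vector :: "'a set set \<Rightarrow> 'a set \<Rightarrow> 'a \<Rightarrow> ('a \<Rightarrow> enat)" where
  "dist_vector E S v = restrict (\<lambda>s. graph_dist E s v) S"

text \<open>
  Rounds are numbered from 1: the robber is at w 1, ..., w t in the first t rounds, and the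
  value w 0 is irrelevant.
\<close>

definition lazy_walk :: "'a set \<Rightarrow> 'a set set \<Rightarrow> nat \<Rightarrow> (nat \<Rightarrow> 'a) \<Rightarrow> bool" where
  "lazy_walk V E t w \<longleftrightarrow>
     (\<forall>j\<in>{1..t}. w j \<in> V) \<and>
     (\<forall>j\<in>{1..<t}. w (Suc j) = w j \<or> {w j, w (Suc j)} \<in> E)"

text \<open>
  A strategy of the cops maps the list of distance vectors learned so far to the next set of
  sensors. The earlier sensor sets are determined by this list and the strategy, so they need not
  be arguments.
\<close>

type_synonym 'a cop_strategy = "('a \<Rightarrow> enat) list \<Rightarrow> 'a set"

primrec observations :: "'a set set \<Rightarrow> 'a cop_strategy \<Rightarrow> (nat \<Rightarrow> 'a) \<Rightarrow> nat \<Rightarrow> ('a \<Rightarrow> enat) list"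
where
  "observations E \<sigma> v 0 = []"
| "observations E \<sigma> v (Suc t) =
     observations E \<sigma> v t @ [dist_vector E (\<sigma> (observations E \<sigma> v t)) (v (Suc t))]"

definition sensors :: "'a set set \<Rightarrow> 'a cop_strategy \<Rightarrow> (nat \<Rightarrow> 'a) \<Rightarrow> nat \<Rightarrow> 'a set" where
  "sensors E \<sigma> v t = \<sigma> (observations E \<sigma> v (t - 1))"

text \<open>
  The cops win in round t if any two walks that produce the sequence of distance vectors that
  was actually observed (that is, the one produced by the robber's walk v) have the same end.
\<close>

definition cops_win_in_round ::
    "'a set \<Rightarrow> 'a set set \<Rightarrow> 'a cop_strategy \<Rightarrow> (nat \<Rightarrow> 'a) \<Rightarrow> nat \<Rightarrow> bool" where
  "cops_win_in_round V E \<sigma> v t \<longleftrightarrow>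
     (\<forall>w x. lazy_walk V E t w \<longrightarrow> lazy_walk V E t x \<longrightarrow>
        (\<forall>j\<in>{1..t}. dist_vector E (sensors E \<sigma> v j) (w j) = dist_vector E (sensors E \<sigma> v j) (v j)) \<longrightarrow>
        (\<forall>j\<in>{1..t}. dist_vector E (sensors E \<sigma> v j) (x j) = dist_vector E (sensors E \<sigma> v j) (v j)) \<longrightarrow>
        w t = x t)"

text \<open>
  Against a fixed strategy of the cops, the robber's strategies amount to the choice of an
  infinite walk.
\<close>

definition cops_can_win :: "'a set \<Rightarrow> 'a set set \<Rightarrow> nat \<Rightarrow> bool" where
  "cops_can_win V E k \<longleftrightarrow>
     (\<exists>\<sigma>. (\<forall>h. \<sigma> h \<subseteq> V \<and> card (\<sigma> h) = k) \<and>
          (\<forall>v. (\<forall>t. lazy_walk V E t v) \<longrightarrow> (\<exists>t\<ge>1. cops_win_in_round V E \<sigma> v t)))"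

text \<open>
  The minimum exists for finite V, since the cops win in the first round with V as the set of
  sensors.
\<close>

definition localization_number :: "'a set \<Rightarrow> 'a set set \<Rightarrow> nat" where
  "localization_number V E = (LEAST k. cops_can_win V E k)"


section \<open>The binomial random graph\<close>

definition vertex_pairs :: "nat \<Rightarrow> nat set set" where
  "vertex_pairs n = {e. e \<subseteq> {1..n} \<and> card e = 2}"

definition binomial_random_graph :: "nat \<Rightarrow> real \<Rightarrow> nat set set pmf" where
  "binomial_random_graph n q =
     map_pmf (\<lambda>f. {e \<in> vertex_pairs n. f e})
       (Pi_pmf (vertex_pairs n) False (\<lambda>_. bernoulli_pmf q))"

definition aas :: "(nat \<Rightarrow> real) \<Rightarrow> (nat \<Rightarrow> nat set set \<Rightarrow> bool) \<Rightarrow> bool" where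
  "aas p P \<longleftrightarrow>
     (\<lambda>n. measure_pmf.prob (binomial_random_graph n (p n)) {E. P n E}) \<longlonglongrightarrow> 1"

text \<open>
  Asymptotically almost surely X is at most (1 + o(1)) f, where the o(1) is a deterministic
  function of n.
\<close>

definition aas_at_most ::
    "(nat \<Rightarrow> real) \<Rightarrow> (nat \<Rightarrow> nat set set \<Rightarrow> real) \<Rightarrow> (nat \<Rightarrow> real) \<Rightarrow> bool" where
  "aas_at_most p X f \<longleftrightarrow>
     (\<exists>\<epsilon>::nat \<Rightarrow> real. \<epsilon> \<longlonglongrightarrow> 0 \<and> aas p (\<lambda>n E. X n E \<le> (1 + \<epsilon> n) * f n))"

end

(*
  If every pair of vertices is distinguished by at least R of the n vertices, then for any set X of
  candidate positions k sensors can be chosen greedily so that at most |X|^2 (1 - R/n)^k ordered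
  pairs of X stay undistinguished. Each set of candidates sharing one distance vector then has about
  |X| (1 - R/n)^(k/2) elements, and a move of the robber multiplies its size by at most the maximal
  size of a closed neighbourhood, roughly d. So k slightly above 2 (n/R) log d makes the candidate
  set shrink in every round, until a single vertex is left.

  For R, two disjoint sources of distinguishing vertices are used. With e = 8 sqrt(log n / d), a.a.s.
  all degrees are at most (1 + e) d, and all small sets expand by a factor of at least (1 - e) d, by
  a union bound over sets. As i e -> 0, two balls of radius i - 1 have size about d^(i-1) each and
  are nearly disjoint, so their symmetric difference gives 2 d^(i-1) vertices. Moreover, the balls of
  radius i - 1 around x and y depend only on the edges meeting the balls of radius i - 2.
  Conditionally on them, the vertices outside are independently adjacent to exactly one of the two
  spheres with probability about 2 exp(-c) (1 - exp(-c)); here a relative error i e in the size of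
  the ball is harmless because i c <= i log d <= 2 log n and e log n -> 0, which is where
  log^3 n << d enters.
*)

theory Submission
  imports Defs "HOL-Real_Asymp.Real_Asymp"
begin

text \<open>Since d^(i-1) = n c / d, the number R of distinguishing vertices is about 2 n times c/d
  + exp (- c) (1 - exp (- c)). The four cases are the ways in which the two terms compare. In (i)
  and (ii) the second term alone gives the bound; in (iii) they are of the same order, as (c/d) exp
  c tends to exp B; in (iv) the first term alone suffices. Hence the sphere estimate is only asked
  for when c is at most log d. That two balls overlap little is not argued through their
  intersection: expansion is started at the two-point set {x, y}, which bounds the union from below,
  while degrees bound each ball from above. Only edges meeting the ball of radius i - 2 around {x,
  y} are exposed, so i at least 2 has to be secured; otherwise c would be 1/n or p, and both tend to
  0. The 2 in R cancels the 2 in 2 (n/R) log d, and 2 log log n absorbs the additive constants of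
  the greedy choice. Each bound is first proved with a fixed relative error; the o(1) comes from a
  diagonal sequence at the end.\<close>

section \<open>Product weights on edge sets\<close>

text \<open>
  Expectations over the random graph are written as finite sums over edge sets, which spares
  measurability and integrability conditions.
\<close>

definition edge_weight :: "real \<Rightarrow> 'a set \<Rightarrow> 'a set \<Rightarrow> real" where
  "edge_weight q F E = (\<Prod>e\<in>F. if e \<in> E then q else 1 - q)"

definition expec :: "real \<Rightarrow> 'a set \<Rightarrow> ('a set \<Rightarrow> real) \<Rightarrow> real" where
  "expec q F f = (\<Sum>E\<in>Pow F. edge_weight q F E * f E)"

abbreviation pr :: "real \<Rightarrow> 'a set \<Rightarrow> ('a set \<Rightarrow> bool) \<Rightarrow> real" where
  "pr q F P \<equiv> expec q F (\<lambda>E. of_bool (P E))"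

lemma expec_empty [simp]: "expec q {} f = f {}"
  by (simp add: expec_def edge_weight_def)

lemma edge_weight_nonneg: "0 \<le> q \<Longrightarrow> q \<le> 1 \<Longrightarrow> 0 \<le> edge_weight q F E"
  by (auto simp: edge_weight_def intro!: prod_nonneg)

text \<open>Conditioning on the single edge \<open>e\<close>. The inductions over the edge set, such
  as \<open>expec_union\<close> and \<open>pr_pmf\<close>, rest on this recursion.\<close>

lemma expec_insert:
  assumes "finite F" "e \<notin> F"
  shows "expec q (insert e F) f = q * expec q F (\<lambda>E. f (insert e E)) + (1 - q) * expec q F f"
proof -
  have 1: "edge_weight q (insert e F) (insert e E) = q * edge_weight q F E" for E
  proof -
    have "(\<Prod>x\<in>F. if x \<in> insert e E then q else 1 - q) = (\<Prod>x\<in>F. if x \<in> E then q else 1 - q)"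
      using assms by (intro prod.cong) auto
    then show ?thesis using assms by (simp add: edge_weight_def)
  qed
  have 2: "edge_weight q (insert e F) E = (1 - q) * edge_weight q F E" if "E \<in> Pow F" for E
    using assms that by (auto simp: edge_weight_def)
  have inj: "inj_on (insert e) (Pow F)"
    using assms by (auto simp: inj_on_def)
  have "expec q (insert e F) f = (\<Sum>E\<in>Pow F. edge_weight q (insert e F) E * f E)
      + (\<Sum>E\<in>insert e ` Pow F. edge_weight q (insert e F) E * f E)"
    unfolding expec_def Pow_insert using assms by (subst sum.union_disjoint) auto
  also have "(\<Sum>E\<in>insert e ` Pow F. edge_weight q (insert e F) E * f E)
      = (\<Sum>E\<in>Pow F. q * edge_weight q F E * f (insert e E))"
    by (subst sum.reindex[OF inj]) (simp add: 1)
  also have "(\<Sum>E\<in>Pow F. edge_weight q (insert e F) E * f E)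
      = (\<Sum>E\<in>Pow F. (1 - q) * edge_weight q F E * f E)"
    by (intro sum.cong) (auto simp: 2)
  finally show ?thesis
    by (simp add: expec_def sum_distrib_left mult.assoc)
qed

lemma expec_cong: "(\<And>E. E \<subseteq> F \<Longrightarrow> f E = g E) \<Longrightarrow> expec q F f = expec q F g"
  by (simp add: expec_def)

lemma expec_mono:
  "0 \<le> q \<Longrightarrow> q \<le> 1 \<Longrightarrow> (\<And>E. E \<subseteq> F \<Longrightarrow> f E \<le> g E) \<Longrightarrow> expec q F f \<le> expec q F g"
  unfolding expec_def by (intro sum_mono mult_left_mono) (auto simp: edge_weight_nonneg)

lemma expec_add: "expec q F (\<lambda>E. f E + g E) = expec q F f + expec q F g"
  by (simp add: expec_def algebra_simps sum.distrib)

lemma expec_diff: "expec q F (\<lambda>E. f E - g E) = expec q F f - expec q F g"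
  by (simp add: expec_def algebra_simps sum_subtractf)

lemma expec_cmult: "expec q F (\<lambda>E. a * f E) = a * expec q F f"
  by (simp add: expec_def sum_distrib_left mult.left_commute)

lemma expec_cmult_right: "expec q F (\<lambda>E. f E * a) = expec q F f * a"
  using expec_cmult[of q F a f] by (simp add: mult.commute)

lemma expec_sum: "expec q F (\<lambda>E. \<Sum>z\<in>Z. f z E) = (\<Sum>z\<in>Z. expec q F (f z))"
  unfolding expec_def sum_distrib_left by (rule sum.swap)

lemma expec_const [simp]: "finite F \<Longrightarrow> expec q F (\<lambda>_. a) = a"
  by (induction F rule: finite_induct) (auto simp: expec_insert algebra_simps)

lemma expec_nonneg: "0 \<le> q \<Longrightarrow> q \<le> 1 \<Longrightarrow> (\<And>E. E \<subseteq> F \<Longrightarrow> 0 \<le> f E) \<Longrightarrow> 0 \<le> expec q F f"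
  unfolding expec_def by (intro sum_nonneg mult_nonneg_nonneg) (auto simp: edge_weight_nonneg)

lemma pr_not: "finite F \<Longrightarrow> pr q F (\<lambda>E. \<not> P E) = 1 - pr q F P"
  by (simp add: of_bool_not_iff expec_diff)

lemma pr_mono:
  "0 \<le> q \<Longrightarrow> q \<le> 1 \<Longrightarrow> (\<And>E. E \<subseteq> F \<Longrightarrow> P E \<Longrightarrow> Q E) \<Longrightarrow> pr q F P \<le> pr q F Q"
  by (rule expec_mono) (auto simp: of_bool_def)

lemma pr_union_bound:
  assumes "0 \<le> q" "q \<le> 1" "finite Z"
  shows "pr q F (\<lambda>E. \<exists>z\<in>Z. P z E) \<le> (\<Sum>z\<in>Z. pr q F (P z))"
proof -
  have "pr q F (\<lambda>E. \<exists>z\<in>Z. P z E) \<le> expec q F (\<lambda>E. \<Sum>z\<in>Z. of_bool (P z E))"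
  proof (rule expec_mono)
    fix E
    show "of_bool (\<exists>z\<in>Z. P z E) \<le> (\<Sum>z\<in>Z. of_bool (P z E) :: real)"
    proof (cases "\<exists>z\<in>Z. P z E")
      case True
      then obtain z where "z \<in> Z" "P z E" by blast
      then show ?thesis
        using member_le_sum[of z Z "\<lambda>z. of_bool (P z E) :: real"] assms by auto
    qed (auto intro: sum_nonneg)
  qed (use assms in auto)
  then show ?thesis by (simp add: expec_sum)
qed

lemma pr_disj:
  assumes "0 \<le> q" "q \<le> 1"
  shows "pr q F (\<lambda>E. P E \<or> Q E) \<le> pr q F P + pr q F Q"
  unfolding expec_add[symmetric] by (rule expec_mono) (use assms in auto)

lemma expec_union:
  assumes "finite A" "finite B" "A \<inter> B = {}"
  shows "expec q (A \<union> B) h = expec q A (\<lambda>E. expec q B (\<lambda>E'. h (E \<union> E')))"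
  using assms
proof (induction A arbitrary: h rule: finite_induct)
  case (insert e A)
  then show ?case by (simp add: expec_insert)
qed simp

lemma expec_prod2:
  assumes "finite A" "finite B" "A \<inter> B = {}"
  shows "expec q (A \<union> B) (\<lambda>E. f (E \<inter> A) * g (E \<inter> B)) = expec q A f * expec q B g"
proof -
  have "expec q (A \<union> B) (\<lambda>E. f (E \<inter> A) * g (E \<inter> B))
      = expec q A (\<lambda>E. expec q B (\<lambda>E'. f E * g E'))"
    unfolding expec_union[OF assms]
  proof (intro expec_cong)
    fix E E' assume "E \<subseteq> A" "E' \<subseteq> B"
    then have "(E \<union> E') \<inter> A = E" "(E \<union> E') \<inter> B = E'" using assms by auto
    then show "f ((E \<union> E') \<inter> A) * g ((E \<union> E') \<inter> B) = f E * g E'" by simp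
  qed
  then show ?thesis by (simp add: expec_cmult expec_cmult_right)
qed

text \<open>Dependence on a part of the edges is expressed by invariance under restriction, so
  events about whole graphs can be used without recasting them as functions of fewer edges.\<close>

lemma expec_indep:
  assumes "finite F" "A \<subseteq> F" "\<And>E. E \<subseteq> F \<Longrightarrow> f E = f (E \<inter> A)" "\<And>E. E \<subseteq> F \<Longrightarrow> g E = g (E - A)"
  shows "expec q F (\<lambda>E. f E * g E) = expec q F f * expec q F g"
proof -
  have F: "A \<union> (F - A) = F" and fin: "finite A" "finite (F - A)" and dis: "A \<inter> (F - A) = {}"
    using assms(1,2) finite_subset by auto
  have g: "g E = g (E \<inter> (F - A))" if "E \<subseteq> F" for E
  proof -
    have "E \<inter> (F - A) = E - A" using that by auto
    then show ?thesis using assms(4)[OF that] by metis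
  qed
  have "expec q F f = expec q F (\<lambda>E. f (E \<inter> A) * 1)"
    by (rule expec_cong) (use assms(3) in fastforce)
  also have "\<dots> = expec q A f"
    using expec_prod2[OF fin dis, of q f "\<lambda>_. 1"] fin unfolding F by simp
  finally have f': "expec q F f = expec q A f" .
  have "expec q F g = expec q F (\<lambda>E. 1 * g (E \<inter> (F - A)))"
    by (rule expec_cong) (use g in fastforce)
  also have "\<dots> = expec q (F - A) g"
    using expec_prod2[OF fin dis, of q "\<lambda>_. 1" g] fin unfolding F by simp
  finally have g': "expec q F g = expec q (F - A) g" .
  have "expec q F (\<lambda>E. f E * g E) = expec q F (\<lambda>E. f (E \<inter> A) * g (E \<inter> (F - A)))"
  proof (rule expec_cong)
    fix E assume "E \<subseteq> F"
    then show "f E * g E = f (E \<inter> A) * g (E \<inter> (F - A))"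
      using assms(3)[of E] g[of E] by presburger
  qed
  also have "\<dots> = expec q A f * expec q (F - A) g"
    using expec_prod2[OF fin dis, of q f g] unfolding F by simp
  finally show ?thesis by (simp add: f' g')
qed

text \<open>One factor is split off at a time: as the blocks \<open>K w\<close> are disjoint, the
  remaining product does not change when \<open>K v\<close> is removed from the edge set.\<close>

lemma expec_prod_indep:
  assumes "finite F" "finite T" "\<And>v. v \<in> T \<Longrightarrow> K v \<subseteq> F" "disjoint_family_on K T"
    and "\<And>v E. v \<in> T \<Longrightarrow> f v E = f v (E \<inter> K v)"
  shows "expec q F (\<lambda>E. \<Prod>v\<in>T. f v E) = (\<Prod>v\<in>T. expec q F (f v))"
  using assms(2-5)
proof (induction T rule: finite_induct)
  case (insert v T)
  have dis: "disjoint_family_on K T"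
    using insert.prems by (auto simp: disjoint_family_on_def)
  have "expec q F (\<lambda>E. f v E * (\<Prod>v\<in>T. f v E)) = expec q F (f v) * expec q F (\<lambda>E. \<Prod>v\<in>T. f v E)"
  proof (rule expec_indep[OF assms(1), of "K v"])
    fix E
    show "(\<Prod>w\<in>T. f w E) = (\<Prod>w\<in>T. f w (E - K v))"
    proof (rule prod.cong)
      fix w assume w: "w \<in> T"
      then have "K v \<inter> K w = {}"
        using insert.prems(2) insert.hyps by (auto simp: disjoint_family_on_def)
      then have "(E - K v) \<inter> K w = E \<inter> K w" by auto
      then show "f w E = f w (E - K v)"
        using insert.prems(3)[of w E] insert.prems(3)[of w "E - K v"] w by simp
    qed simp
  next
    show "K v \<subseteq> F" using insert.prems(1) by simp
    show "f v E = f v (E \<inter> K v)" for E by (rule insert.prems(3)) simp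
  qed
  moreover have "expec q F (\<lambda>E. \<Prod>v\<in>T. f v E) = (\<Prod>v\<in>T. expec q F (f v))"
  proof (rule insert.IH[OF _ dis])
    show "K w \<subseteq> F" if "w \<in> T" for w using that insert.prems(1) by simp
    show "f w E = f w (E \<inter> K w)" if "w \<in> T" for w E by (rule insert.prems(3)) (simp add: that)
  qed
  ultimately show ?case using insert.hyps by simp
qed (use assms(1) in simp)

text \<open>
  Here g explores the graph: the event g E = z is decided by the edges in A z alone, and P z by the
  other ones, so these are still fresh given g E = z.
\<close>

lemma pr_stopping:
  assumes q: "0 \<le> q" "q \<le> 1" and fin: "finite F" and b: "0 \<le> b"
    and g: "\<And>E z. E \<subseteq> F \<Longrightarrow> g E = z \<longleftrightarrow> g (E \<inter> A z) = z"
    and P: "\<And>E z. E \<subseteq> F \<Longrightarrow> P z E \<longleftrightarrow> P z (E - A z)"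
    and bound: "\<And>z. good z \<Longrightarrow> pr q F (P z) \<le> b"
  shows "pr q F (\<lambda>E. good (g E) \<and> P (g E) E) \<le> b"
proof -
  \<comment> \<open>Only finitely many outcomes are attained, so the total probability is a finite
    sum even over an infinite type of outcomes.\<close>
  define Z where "Z = {z \<in> g ` Pow F. good z}"
  have finZ: "finite Z" using fin by (auto simp: Z_def)
  have indep: "expec q F (\<lambda>E. of_bool (g E = z) * of_bool (P z E)) = pr q F (\<lambda>E. g E = z) * pr q F (P z)" for z
  proof (rule expec_indep[OF fin, of "A z \<inter> F"])
    fix E assume E: "E \<subseteq> F"
    have "E \<inter> (A z \<inter> F) = E \<inter> A z" "E - A z \<inter> F = E - A z" using E by auto
    then show "(of_bool (g E = z) :: real) = of_bool (g (E \<inter> (A z \<inter> F)) = z)"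
      "(of_bool (P z E) :: real) = of_bool (P z (E - A z \<inter> F))"
      using g[OF E, of z] P[OF E, of z] by (simp_all only: of_bool_eq_iff)
  qed simp
  have "pr q F (\<lambda>E. good (g E) \<and> P (g E) E)
      = expec q F (\<lambda>E. \<Sum>z\<in>Z. of_bool (g E = z) * of_bool (P z E))"
  proof (rule expec_cong)
    fix E assume E: "E \<subseteq> F"
    show "of_bool (good (g E) \<and> P (g E) E) = (\<Sum>z\<in>Z. of_bool (g E = z) * of_bool (P z E) :: real)"
    proof (cases "good (g E)")
      case True
      then have "g E \<in> Z" using E by (auto simp: Z_def)
      have "(\<Sum>z\<in>Z. of_bool (g E = z) * of_bool (P z E) :: real)
          = (\<Sum>z\<in>{g E}. of_bool (g E = z) * of_bool (P z E))"
        using \<open>g E \<in> Z\<close> finZ by (intro sum.mono_neutral_right) auto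
      then show ?thesis using True by simp
    next
      case False
      then have "g E \<notin> Z" by (auto simp: Z_def)
      then have "(\<Sum>z\<in>Z. of_bool (g E = z) * of_bool (P z E) :: real) = 0"
        by (intro sum.neutral) auto
      then show ?thesis using False by simp
    qed
  qed
  also have "\<dots> = (\<Sum>z\<in>Z. pr q F (\<lambda>E. g E = z) * pr q F (P z))"
    by (simp add: expec_sum indep)
  also have "\<dots> \<le> (\<Sum>z\<in>Z. pr q F (\<lambda>E. g E = z) * b)"
    by (intro sum_mono mult_left_mono bound expec_nonneg q) (auto simp: Z_def)
  also have "\<dots> = expec q F (\<lambda>E. \<Sum>z\<in>Z. of_bool (g E = z)) * b"
    by (simp add: expec_sum sum_distrib_right)
  \<comment> \<open>The events \<open>g E = z\<close> exclude each other: for each \<open>E\<close>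
    at most one summand is 1.\<close>
  also have "\<dots> \<le> expec q F (\<lambda>E. 1) * b"
  proof (intro mult_right_mono expec_mono q b)
    fix E
    have "(\<Sum>z\<in>Z. of_bool (g E = z) :: real) \<le> (\<Sum>z\<in>insert (g E) Z. of_bool (g E = z))"
      using finZ by (intro sum_mono2) auto
    also have "\<dots> = (\<Sum>z\<in>{g E}. of_bool (g E = z))"
      using finZ by (intro sum.mono_neutral_right) auto
    finally show "(\<Sum>z\<in>Z. of_bool (g E = z) :: real) \<le> 1" by simp
  qed
  finally show ?thesis using fin by simp
qed

section \<open>Agreement of the finite sums with the random graph as a pmf\<close>

lemma prob_bind_bernoulli_pmf:
  assumes "0 \<le> q" "q \<le> 1"
  shows "measure_pmf.prob (bind_pmf (bernoulli_pmf q) f) A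
    = q * measure_pmf.prob (f True) A + (1 - q) * measure_pmf.prob (f False) A"
proof -
  have "emeasure (measure_pmf (bind_pmf (bernoulli_pmf q) f)) A
      = ennreal q * emeasure (measure_pmf (f True)) A + ennreal (1 - q) * emeasure (measure_pmf (f False)) A"
    using assms by (simp add: mult.commute)
  also have "\<dots> = ennreal (q * measure_pmf.prob (f True) A + (1 - q) * measure_pmf.prob (f False) A)"
    using assms by (simp add: measure_pmf.emeasure_eq_measure ennreal_mult ennreal_plus)
  finally have "ennreal (measure_pmf.prob (bind_pmf (bernoulli_pmf q) f) A)
      = ennreal (q * measure_pmf.prob (f True) A + (1 - q) * measure_pmf.prob (f False) A)"
    by (simp only: measure_pmf.emeasure_eq_measure)
  then show ?thesis using assms by (subst (asm) ennreal_inj) auto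
qed

lemma pr_pmf:
  assumes "0 \<le> q" "q \<le> 1" "finite F"
  shows "measure_pmf.prob (map_pmf (\<lambda>f. {e \<in> F. f e}) (Pi_pmf F False (\<lambda>_. bernoulli_pmf q))) {E. P E}
       = pr q F P"
  using assms(3)
proof (induction F arbitrary: P rule: finite_induct)
  case empty
  then show ?case by simp
next
  case (insert e F)
  let ?M = "Pi_pmf F False (\<lambda>_. bernoulli_pmf q)"
  let ?m = "\<lambda>f. {e \<in> F. f e}"
  have *: "{e' \<in> insert e F. (f(e := b)) e'} = (if b then insert e (?m f) else ?m f)" for f b
    using insert.hyps by auto
  have "map_pmf (\<lambda>f. {e' \<in> insert e F. f e'}) (Pi_pmf (insert e F) False (\<lambda>_. bernoulli_pmf q))
     = bind_pmf (bernoulli_pmf q) (\<lambda>b. map_pmf (\<lambda>f. if b then insert e (?m f) else ?m f) ?M)"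
    by (simp only: Pi_pmf_insert'[OF insert.hyps] map_bind_pmf map_return_pmf *)
      (simp only: map_pmf_def)
  moreover have "measure_pmf.prob (map_pmf (\<lambda>f. insert e (?m f)) ?M) {E. P E}
      = measure_pmf.prob (map_pmf ?m ?M) {E. P (insert e E)}"
    by (simp only: measure_map_pmf vimage_Collect_eq)
  ultimately show ?case
    using insert.hyps insert.IH[of P] insert.IH[of "\<lambda>E. P (insert e E)"]
    by (simp only: prob_bind_bernoulli_pmf[OF assms(1,2)] expec_insert[OF insert.hyps] if_True if_False)
qed

lemma prob_binomial_random_graph:
  assumes "0 \<le> q" "q \<le> 1"
  shows "measure_pmf.prob (binomial_random_graph n q) {E. P E} = pr q (vertex_pairs n) P"
proof -
  have "finite (vertex_pairs n)" unfolding vertex_pairs_def by simp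
  then show ?thesis
    unfolding binomial_random_graph_def by (rule pr_pmf[OF assms])
qed

text \<open>The exponential moment method for both tails at once. The sign of \<open>l\<close> is
  left open, so event and hypothesis are multiplied by \<open>l\<close> and
  \<open>exp l - 1\<close>: for positive \<open>l\<close> this reads as an upper tail and
  \<open>b\<close> bounds the probabilities from above, for negative \<open>l\<close> as a lower
  tail and \<open>b\<close> bounds them from below.\<close>

lemma chernoff_moment:
  assumes q: "0 \<le> q" "q \<le> 1" and "finite F" "finite T" "\<And>v. v \<in> T \<Longrightarrow> K v \<subseteq> F" "disjoint_family_on K T"
    and Q: "\<And>v E. v \<in> T \<Longrightarrow> Q v E \<longleftrightarrow> Q v (E \<inter> K v)"
    and le: "\<And>v. v \<in> T \<Longrightarrow> (exp l - 1) * pr q F (Q v) \<le> (exp l - 1) * b"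
  shows "pr q F (\<lambda>E. l * a \<le> l * real (card {v \<in> T. Q v E})) \<le> exp ((exp l - 1) * b * card T - l * a)"
proof -
  \<comment> \<open>This is \<open>exp (l * of_bool (Q v E))\<close>, written linearly in the
    indicator so that its expectation can be read off.\<close>
  let ?f = "\<lambda>v E. 1 + (exp l - 1) * of_bool (Q v E)"
  have "pr q F (\<lambda>E. l * a \<le> l * real (card {v \<in> T. Q v E}))
      \<le> expec q F (\<lambda>E. exp (- l * a) * (\<Prod>v\<in>T. ?f v E))"
  proof (rule expec_mono[OF q])
    fix E
    have "(\<Prod>v\<in>T. ?f v E) = (\<Prod>v\<in>T. exp (l * of_bool (Q v E)))"
      by (intro prod.cong) auto
    also have "\<dots> = exp (\<Sum>v\<in>T. l * of_bool (Q v E))"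
      by (rule exp_sum[OF \<open>finite T\<close>, symmetric])
    also have "(\<Sum>v\<in>T. l * of_bool (Q v E)) = l * real (card {v \<in> T. Q v E})"
      using \<open>finite T\<close> by (simp add: of_bool_def sum_distrib_left[symmetric] sum.If_cases Int_def)
    finally have "exp (- l * a) * (\<Prod>v\<in>T. ?f v E) = exp (l * real (card {v \<in> T. Q v E}) - l * a)"
      by (simp add: exp_diff exp_minus field_simps)
    then show "of_bool (l * a \<le> l * real (card {v \<in> T. Q v E})) \<le> exp (- l * a) * (\<Prod>v\<in>T. ?f v E)"
      by auto
  qed
  also have "\<dots> = exp (- l * a) * (\<Prod>v\<in>T. expec q F (?f v))"
  proof -
    have "?f v E = ?f v (E \<inter> K v)" if "v \<in> T" for v E
      using Q[OF that, of E] by (simp only:)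
    then show ?thesis unfolding expec_cmult
      by (subst expec_prod_indep[OF assms(3-6)]) auto
  qed
  also have "\<dots> \<le> exp (- l * a) * (\<Prod>v\<in>T. exp ((exp l - 1) * b))"
  proof (intro mult_left_mono prod_mono conjI)
    fix v assume v: "v \<in> T"
    show "0 \<le> expec q F (?f v)" by (rule expec_nonneg[OF q]) auto
    have "expec q F (?f v) = 1 + (exp l - 1) * pr q F (Q v)"
      using \<open>finite F\<close> by (simp add: expec_add expec_cmult)
    also have "\<dots> \<le> 1 + (exp l - 1) * b" using le[OF v] by simp
    also have "\<dots> \<le> exp ((exp l - 1) * b)" by simp
    finally show "expec q F (?f v) \<le> exp ((exp l - 1) * b)" .
  qed simp
  also have "\<dots> = exp ((exp l - 1) * b * card T - l * a)"
    by (simp add: exp_of_nat_mult[symmetric] mult_exp_exp algebra_simps)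
  finally show ?thesis .
qed

lemma chernoff_upper:
  assumes q: "0 \<le> q" "q \<le> 1" and "finite F" "finite T" "\<And>v. v \<in> T \<Longrightarrow> K v \<subseteq> F" "disjoint_family_on K T"
    and Q: "\<And>v E. v \<in> T \<Longrightarrow> Q v E \<longleftrightarrow> Q v (E \<inter> K v)"
    and le: "\<And>v. v \<in> T \<Longrightarrow> pr q F (Q v) \<le> b" and m: "b * card T \<le> m"
    and e: "0 < \<epsilon>" "\<epsilon> \<le> 2"
  shows "pr q F (\<lambda>E. (1 + \<epsilon>) * m \<le> real (card {v \<in> T. Q v E})) \<le> exp (- \<epsilon>\<^sup>2 * m / 4)"
proof -
  \<comment> \<open>With \<open>exp l \<le> 1 + l + l\<^sup>2\<close>, valid for
    \<open>l \<le> 1\<close>, the exponent is at most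
    \<open>(l\<^sup>2 - l * \<epsilon>) * m\<close>, and \<open>\<epsilon> / 2\<close> minimises
    it.\<close>
  define l where "l = \<epsilon> / 2"
  have l: "0 < l" "l \<le> 1" using e by (auto simp: l_def)
  have "pr q F (\<lambda>E. (1 + \<epsilon>) * m \<le> real (card {v \<in> T. Q v E}))
      = pr q F (\<lambda>E. l * ((1 + \<epsilon>) * m) \<le> l * real (card {v \<in> T. Q v E}))"
    using l by simp
  also have "\<dots> \<le> exp ((exp l - 1) * b * card T - l * ((1 + \<epsilon>) * m))"
    by (rule chernoff_moment[where K = K and Q = Q, OF assms(1-7)]) (use l in \<open>auto intro!: mult_left_mono le\<close>)
  also have "\<dots> \<le> exp (- \<epsilon>\<^sup>2 * m / 4)"
  proof -
    have T: "0 \<le> m"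
    proof (cases "T = {}")
      case False
      then obtain v where "v \<in> T" by blast
      have "0 \<le> pr q F (Q v)" by (rule expec_nonneg[OF q]) auto
      then have "0 \<le> b" using le[OF \<open>v \<in> T\<close>] by linarith
      then have "0 \<le> b * card T" by simp
      then show ?thesis using m by linarith
    qed (use m in auto)
    have "exp l \<le> 1 + l + l\<^sup>2" using exp_bound[of l] l by simp
    have "(exp l - 1) * (b * card T) \<le> (exp l - 1) * m" using m l by (intro mult_left_mono) auto
    also have "\<dots> \<le> (l + l\<^sup>2) * m" using \<open>exp l \<le> _\<close> T by (intro mult_right_mono) auto
    finally have "(exp l - 1) * b * card T - l * ((1 + \<epsilon>) * m) \<le> (l\<^sup>2 - l * \<epsilon>) * m"
      by (simp add: algebra_simps)
    also have "(l\<^sup>2 - l * \<epsilon>) * m = - \<epsilon>\<^sup>2 * m / 4"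
      by (simp add: l_def field_simps power2_eq_square)
    finally show ?thesis by simp
  qed
  finally show ?thesis .
qed

lemma exp_minus_le_quadratic: "0 \<le> (x::real) \<Longrightarrow> exp (- x) \<le> 1 - x + x\<^sup>2 / 2"
proof -
  assume "0 \<le> x"
  let ?f = "\<lambda>x::real. 1 - x + x\<^sup>2 / 2 - exp (- x)"
  have "?f 0 \<le> ?f x"
  proof (rule DERIV_nonneg_imp_nondecreasing[OF \<open>0 \<le> x\<close>])
    fix y :: real assume "0 \<le> y"
    have "(?f has_real_derivative (y - 1 + exp (- y))) (at y)"
      by (auto intro!: derivative_eq_intros)
    moreover have "0 \<le> y - 1 + exp (- y)" using exp_ge_add_one_self[of "- y"] by linarith
    ultimately show "\<exists>z. (?f has_real_derivative z) (at y) \<and> 0 \<le> z" by blast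
  qed
  then show ?thesis by simp
qed

lemma chernoff_lower:
  assumes q: "0 \<le> q" "q \<le> 1" and "finite F" "finite T" "\<And>v. v \<in> T \<Longrightarrow> K v \<subseteq> F" "disjoint_family_on K T"
    and Q: "\<And>v E. v \<in> T \<Longrightarrow> Q v E \<longleftrightarrow> Q v (E \<inter> K v)"
    and le: "\<And>v. v \<in> T \<Longrightarrow> b \<le> pr q F (Q v)" and b: "0 \<le> b"
    and m: "m = b * card T"
    and e: "0 < \<epsilon>"
  shows "pr q F (\<lambda>E. real (card {v \<in> T. Q v E}) \<le> (1 - \<epsilon>) * m) \<le> exp (- \<epsilon>\<^sup>2 * m / 2)"
proof -
  \<comment> \<open>By the quadratic bound on \<open>exp (- \<epsilon>)\<close> the exponent is at
    most (-eps + eps^2/2 + eps (1 - eps)) m = - eps^2 m / 2.\<close>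
  define l where "l = - \<epsilon>"
  have l: "l < 0" using e by (auto simp: l_def)
  have "pr q F (\<lambda>E. real (card {v \<in> T. Q v E}) \<le> (1 - \<epsilon>) * m)
      = pr q F (\<lambda>E. l * ((1 - \<epsilon>) * m) \<le> l * real (card {v \<in> T. Q v E}))"
    using l by simp
  also have "\<dots> \<le> exp ((exp l - 1) * b * card T - l * ((1 - \<epsilon>) * m))"
    by (rule chernoff_moment[where K = K and Q = Q, OF assms(1-7)]) (use l in \<open>auto intro!: mult_left_mono_neg le\<close>)
  also have "\<dots> \<le> exp (- \<epsilon>\<^sup>2 * m / 2)"
  proof -
    have "0 \<le> m" using m b by simp
    have "exp l - 1 \<le> - \<epsilon> + \<epsilon>\<^sup>2 / 2"
      using exp_minus_le_quadratic[of \<epsilon>] e by (simp add: l_def)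
    then have "(exp l - 1) * m \<le> (- \<epsilon> + \<epsilon>\<^sup>2 / 2) * m"
      using \<open>0 \<le> m\<close> by (rule mult_right_mono)
    then have "(exp l - 1) * b * card T - l * ((1 - \<epsilon>) * m) \<le> - \<epsilon>\<^sup>2 * m / 2"
      by (simp add: l_def m algebra_simps power2_eq_square)
    then show ?thesis by simp
  qed
  finally show ?thesis .
qed

section \<open>Avoiding and meeting fixed edge sets\<close>

lemma pr_avoid:
  assumes "finite F" "A \<subseteq> F"
  shows "pr q F (\<lambda>E. E \<inter> A = {}) = (1 - q) ^ card A"
proof -
  have "finite A" using assms finite_subset by auto
  then show ?thesis using assms(2)
  proof (induction A rule: finite_induct)
    case (insert e A)
    have "pr q F (\<lambda>E. E \<inter> insert e A = {}) = expec q F (\<lambda>E. of_bool (e \<notin> E) * of_bool (E \<inter> A = {}))"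
      by (rule expec_cong) auto
    also have "\<dots> = pr q F (\<lambda>E. e \<notin> E) * pr q F (\<lambda>E. E \<inter> A = {})"
    proof (rule expec_indep[OF assms(1), of "{e}"])
      fix E
      show "(of_bool (E \<inter> A = {}) :: real) = of_bool ((E - {e}) \<inter> A = {})"
        using insert.hyps by (auto simp: of_bool_def)
    qed (use insert.prems in auto)
    also have "pr q F (\<lambda>E. e \<notin> E) = 1 - q"
    proof -
      have F: "F = insert e (F - {e})" using insert.prems by auto
      have *: "expec q (F - {e}) (\<lambda>E. of_bool (e \<notin> E)) = expec q (F - {e}) (\<lambda>E. 1)"
        by (rule expec_cong) auto
      show ?thesis
        by (subst F, subst expec_insert) (use assms * in auto)
    qed
    finally show ?case using insert by simp
  qed (use assms in simp)
qed

lemma pr_avoid_hit: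
  assumes "finite F" "A \<subseteq> F" "B \<subseteq> F" "A \<inter> B = {}"
  shows "pr q F (\<lambda>E. E \<inter> A = {} \<and> E \<inter> B \<noteq> {}) = (1 - q) ^ card A * (1 - (1 - q) ^ card B)"
proof -
  have "pr q F (\<lambda>E. E \<inter> A = {} \<and> E \<inter> B \<noteq> {})
      = expec q F (\<lambda>E. of_bool (E \<inter> A = {}) * of_bool (E \<inter> B \<noteq> {}))"
    by (rule expec_cong) auto
  also have "\<dots> = pr q F (\<lambda>E. E \<inter> A = {}) * pr q F (\<lambda>E. E \<inter> B \<noteq> {})"
  proof (rule expec_indep[OF assms(1), of A])
    fix E
    have "(E - A) \<inter> B = E \<inter> B" using assms by auto
    then show "(of_bool (E \<inter> B \<noteq> {}) :: real) = of_bool ((E - A) \<inter> B \<noteq> {})" by simp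
  qed (use assms in auto)
  also have "pr q F (\<lambda>E. E \<inter> B \<noteq> {}) = 1 - (1 - q) ^ card B"
    using assms by (subst pr_not) (simp_all add: pr_avoid)
  finally show ?thesis using assms by (simp add: pr_avoid)
qed

section \<open>The localization game\<close>

definition closed_nbhd :: "'a set set \<Rightarrow> 'a set \<Rightarrow> 'a set" where
  "closed_nbhd E S = S \<union> {v. \<exists>u\<in>S. {u, v} \<in> E}"

lemma closed_nbhd_subset: "\<Union>E \<subseteq> V \<Longrightarrow> S \<subseteq> V \<Longrightarrow> closed_nbhd E S \<subseteq> V"
  by (auto simp: closed_nbhd_def)

lemma closed_nbhd_eq_UN: "closed_nbhd E S = (\<Union>v\<in>S. closed_nbhd E {v})"
  by (auto simp: closed_nbhd_def)

lemma card_closed_nbhd_le: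
  assumes "finite S" "\<And>v. v \<in> S \<Longrightarrow> real (card (closed_nbhd E {v})) \<le> D"
  shows "real (card (closed_nbhd E S)) \<le> D * card S"
proof -
  have "card (closed_nbhd E S) \<le> (\<Sum>v\<in>S. card (closed_nbhd E {v}))"
    by (subst closed_nbhd_eq_UN) (rule card_UN_le[OF assms(1)])
  then have "real (card (closed_nbhd E S)) \<le> (\<Sum>v\<in>S. real (card (closed_nbhd E {v})))"
    using of_nat_mono by fastforce
  also have "\<dots> \<le> (\<Sum>v\<in>S. D)" by (rule sum_mono) (rule assms(2))
  finally show ?thesis by (simp add: mult.commute)
qed

text \<open>
  The positions the robber may have in the next round after the distance vectors in the list, when
  the sensors are chosen by sen from the current set of candidates.
\<close>

definition candidates ::
    "'a set \<Rightarrow> 'a set set \<Rightarrow> ('a set \<Rightarrow> 'a set) \<Rightarrow> ('a \<Rightarrow> enat) list \<Rightarrow> 'a set" where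
  "candidates V E sen =
     foldl (\<lambda>X b. closed_nbhd E {u \<in> X. dist_vector E (sen X) u = b}) V"

lemma candidates_subset:
  assumes "\<Union>E \<subseteq> V"
  shows "candidates V E sen h \<subseteq> V"
proof (induction h rule: rev_induct)
  case (snoc b h)
  then show ?case
    unfolding candidates_def foldl_append foldl_Cons foldl_Nil
    by (intro closed_nbhd_subset assms) auto
qed (simp add: candidates_def)

text \<open>The cops keep track of the candidate set and let it determine the sensors. If the
  candidates sharing the observed vector are not yet down to one, their closed neighbourhood is the
  next candidate set and is strictly smaller, which cannot go on forever.\<close>

lemma cops_can_winI:
  assumes "finite V" "\<Union>E \<subseteq> V"
    and sen: "\<And>X. X \<subseteq> V \<Longrightarrow> sen X \<subseteq> V \<and> card (sen X) = k"
    and shrink: "\<And>X b C. X \<subseteq> V \<Longrightarrow> C = {u \<in> X. dist_vector E (sen X) u = b} \<Longrightarrow>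
      card C \<le> 1 \<or> card (closed_nbhd E C) < card X"
  shows "cops_can_win V E k"
proof -
  define \<sigma> where "\<sigma> h = sen (candidates V E sen h)" for h
  have "\<exists>t\<ge>1. cops_win_in_round V E \<sigma> v t" for v
  proof -
    define X where "X t = candidates V E sen (observations E \<sigma> v t)" for t
    define C where "C t = {u \<in> X t. dist_vector E (sen (X t)) u = dist_vector E (sen (X t)) (v (Suc t))}" for t
    have X0: "X 0 = V" by (simp add: X_def candidates_def)
    have XS: "X (Suc t) = closed_nbhd E (C t)" for t
      by (simp add: X_def candidates_def C_def \<sigma>_def)
    have XV: "X t \<subseteq> V" for t
      unfolding X_def by (rule candidates_subset[OF assms(2)])
    have sensors: "sensors E \<sigma> v (Suc t) = sen (X t)" for t
      by (simp add: sensors_def \<sigma>_def X_def)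
    \<comment> \<open>Every walk that agrees with the observations stays among the candidates.
      Rounds start at 1 and candidate sets at 0, hence the shift by one.\<close>
    have in_C: "w (Suc j) \<in> C j"
      if w: "lazy_walk V E t w" and j: "j < t" and obs: "\<forall>j\<in>{1..t}. dist_vector E (sensors E \<sigma> v j) (w j)
        = dist_vector E (sensors E \<sigma> v j) (v j)" for w j t
      using j
    proof (induction j)
      case 0
      have "w 1 \<in> V" using w 0 by (auto simp: lazy_walk_def)
      moreover have "dist_vector E (sensors E \<sigma> v 1) (w 1) = dist_vector E (sensors E \<sigma> v 1) (v 1)"
        using obs 0 by auto
      ultimately show ?case using sensors[of 0] by (simp add: C_def X0)
    next
      case (Suc j)
      then have "w (Suc j) \<in> C j" by simp
      moreover have "w (Suc (Suc j)) = w (Suc j) \<or> {w (Suc j), w (Suc (Suc j))} \<in> E"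
        using w Suc.prems by (simp add: lazy_walk_def)
      ultimately have "w (Suc (Suc j)) \<in> X (Suc j)"
        unfolding XS closed_nbhd_def by auto
      moreover have "dist_vector E (sensors E \<sigma> v (Suc (Suc j))) (w (Suc (Suc j)))
          = dist_vector E (sensors E \<sigma> v (Suc (Suc j))) (v (Suc (Suc j)))"
        using obs Suc.prems by auto
      ultimately show ?case unfolding sensors by (simp add: C_def)
    qed
    have "\<exists>t. card (C t) \<le> 1"
    proof (rule ccontr)
      assume "\<not> (\<exists>t. card (C t) \<le> 1)"
      then have less: "card (X (Suc t)) < card (X t)" for t
        using shrink[OF XV[of t], of "C t"] unfolding XS by (auto simp: C_def)
      have "card (X t) + t \<le> card (X 0)" for t
      proof (induction t)
        case (Suc t)
        then show ?case using less[of t] by linarith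
      qed simp
      from this[of "Suc (card (X 0))"] show False by simp
    qed
    then obtain t where t: "card (C t) \<le> 1" by blast
    have "finite (C t)"
      using XV[of t] assms(1) by (auto simp: C_def intro: finite_subset)
    have "cops_win_in_round V E \<sigma> v (Suc t)"
      unfolding cops_win_in_round_def
    proof (intro allI impI)
      fix w x
      assume "lazy_walk V E (Suc t) w" "lazy_walk V E (Suc t) x"
        "\<forall>j\<in>{1..Suc t}. dist_vector E (sensors E \<sigma> v j) (w j) = dist_vector E (sensors E \<sigma> v j) (v j)"
        "\<forall>j\<in>{1..Suc t}. dist_vector E (sensors E \<sigma> v j) (x j) = dist_vector E (sensors E \<sigma> v j) (v j)"
      then have "w (Suc t) \<in> C t" "x (Suc t) \<in> C t" using in_C[of "Suc t" _ t] by blast+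
      then show "w (Suc t) = x (Suc t)"
        using t \<open>finite (C t)\<close> by (metis card_le_Suc0_iff_eq One_nat_def)
    qed
    then show ?thesis by (intro exI[of _ "Suc t"]) simp
  qed
  moreover have "\<sigma> h \<subseteq> V \<and> card (\<sigma> h) = k" for h
    unfolding \<sigma>_def by (intro sen candidates_subset assms)
  ultimately show ?thesis unfolding cops_can_win_def by blast
qed

section \<open>Greedy choice of sensors\<close>

lemma ex_above_average:
  fixes R :: real
  assumes "finite V" "V \<noteq> {}" "finite P"
    and "\<And>\<pi>. \<pi> \<in> P \<Longrightarrow> R \<le> real (card {s \<in> V. dis s \<pi>})"
  shows "\<exists>s\<in>V. real (card {\<pi> \<in> P. \<not> dis s \<pi>}) \<le> real (card P) * (1 - R / card V)"
proof (rule ccontr)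
  assume "\<not> ?thesis"
  then have less: "real (card P) * (1 - R / card V) < real (card {\<pi> \<in> P. \<not> dis s \<pi>})" if "s \<in> V" for s
    using that by force
  have n: "0 < card V" using assms by (simp add: card_gt_0_iff)
  have "real (card V) * (real (card P) * (1 - R / card V))
      = (\<Sum>s\<in>V. real (card P) * (1 - R / card V))" by simp
  also have "\<dots> < (\<Sum>s\<in>V. real (card {\<pi> \<in> P. \<not> dis s \<pi>}))"
    using assms less by (intro sum_strict_mono) auto
  also have "\<dots> = (\<Sum>s\<in>V. \<Sum>\<pi>\<in>P. of_bool (\<not> dis s \<pi>))"
    using \<open>finite P\<close> by (simp add: of_bool_def sum.If_cases Int_def)
  \<comment> \<open>Double counting of the incidences between vertices and pairs they fail to
    distinguish: each pair is missed by at most \<open>card V - R\<close> vertices, so some vertex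
    misses no more than the average.\<close>
  also have "\<dots> = (\<Sum>\<pi>\<in>P. \<Sum>s\<in>V. of_bool (\<not> dis s \<pi>))" by (rule sum.swap)
  also have "\<dots> = (\<Sum>\<pi>\<in>P. real (card {s \<in> V. \<not> dis s \<pi>}))"
    using \<open>finite V\<close> by (simp add: of_bool_def sum.If_cases Int_def)
  also have "\<dots> \<le> (\<Sum>\<pi>\<in>P. real (card V) - R)"
  proof (rule sum_mono)
    fix \<pi> assume "\<pi> \<in> P"
    have "card V = card {s \<in> V. dis s \<pi>} + card {s \<in> V. \<not> dis s \<pi>}"
      using \<open>finite V\<close> by (subst card_Un_disjoint[symmetric]) (auto intro: arg_cong[where f = card])
    then show "real (card {s \<in> V. \<not> dis s \<pi>}) \<le> real (card V) - R"
      using assms(4)[OF \<open>\<pi> \<in> P\<close>] by linarith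
  qed
  also have "\<dots> = real (card V) * (real (card P) * (1 - R / card V))"
    using n by (simp add: field_simps)
  finally show False by simp
qed

lemma ex_distinguishing_sensors:
  fixes R :: real
  assumes "finite V" "V \<noteq> {}" "finite X" "X \<subseteq> V" "R \<le> card V" "k \<le> card V"
    and "\<And>x y. x \<in> V \<Longrightarrow> y \<in> V \<Longrightarrow> x \<noteq> y \<Longrightarrow>
      R \<le> real (card {s \<in> V. graph_dist E s x \<noteq> graph_dist E s y})"
  shows "\<exists>S\<subseteq>V. card S = k \<and>
    real (card {(x, y) \<in> X \<times> X. x \<noteq> y \<and> (\<forall>s\<in>S. graph_dist E s x = graph_dist E s y)})
      \<le> real ((card X)\<^sup>2) * (1 - R / card V) ^ k"
proof -
  let ?P = "\<lambda>S. {(x, y) \<in> X \<times> X. x \<noteq> y \<and> (\<forall>s\<in>S. graph_dist E s x = graph_dist E s y)}"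
  have fin: "finite (?P S)" for S
    by (rule finite_subset[of _ "X \<times> X"]) (use \<open>finite X\<close> in auto)
  have r: "0 \<le> 1 - R / card V"
    using assms by (auto simp: card_gt_0_iff field_simps)
  \<comment> \<open>Only \<open>card S \<le> k\<close> is claimed here, since the greedy step may
    pick a vertex again. Padding to exactly \<open>k\<close> sensors afterwards can only distinguish
    more pairs.\<close>
  have "\<exists>S\<subseteq>V. card S \<le> k \<and> real (card (?P S)) \<le> real ((card X)\<^sup>2) * (1 - R / card V) ^ k"
  proof (induction k)
    case 0
    have "card (?P {}) \<le> card (X \<times> X)" by (rule card_mono) (use \<open>finite X\<close> in auto)
    also have "\<dots> = (card X)\<^sup>2" by (simp add: card_cartesian_product power2_eq_square)
    finally have "real (card (?P {})) \<le> real ((card X)\<^sup>2)" by (rule of_nat_mono)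
    then show ?case by (intro exI[of _ "{}"]) simp
  next
    case (Suc k)
    then obtain S where S: "S \<subseteq> V" "card S \<le> k"
      "real (card (?P S)) \<le> real ((card X)\<^sup>2) * (1 - R / card V) ^ k" by blast
    have "\<exists>s\<in>V. real (card {\<pi> \<in> ?P S. \<not> graph_dist E s (fst \<pi>) \<noteq> graph_dist E s (snd \<pi>)})
        \<le> real (card (?P S)) * (1 - R / card V)"
    proof (rule ex_above_average[OF assms(1,2) fin])
      fix \<pi> assume "\<pi> \<in> ?P S"
      then have "fst \<pi> \<in> V" "snd \<pi> \<in> V" "fst \<pi> \<noteq> snd \<pi>" using assms(4) by auto
      then show "R \<le> real (card {s \<in> V. graph_dist E s (fst \<pi>) \<noteq> graph_dist E s (snd \<pi>)})"
        by (rule assms(7))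
    qed
    then obtain s where s: "s \<in> V"
      "real (card {\<pi> \<in> ?P S. graph_dist E s (fst \<pi>) = graph_dist E s (snd \<pi>)})
        \<le> real (card (?P S)) * (1 - R / card V)" by auto
    have eq: "?P (insert s S) = {\<pi> \<in> ?P S. graph_dist E s (fst \<pi>) = graph_dist E s (snd \<pi>)}"
      by auto
    have "real (card (?P (insert s S))) \<le> real (card (?P S)) * (1 - R / card V)"
      using s unfolding eq by blast
    also have "\<dots> \<le> real ((card X)\<^sup>2) * (1 - R / card V) ^ k * (1 - R / card V)"
      using S r by (intro mult_right_mono) auto
    finally have "real (card (?P (insert s S))) \<le> real ((card X)\<^sup>2) * (1 - R / card V) ^ Suc k"
      by (simp add: mult_ac)
    moreover have "card (insert s S) \<le> Suc k"
      using S assms(1) finite_subset[of S V] by (simp add: card_insert_if)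
    ultimately show ?case using S s by (intro exI[of _ "insert s S"]) auto
  qed
  then obtain S where S: "S \<subseteq> V" "card S \<le> k"
      "real (card (?P S)) \<le> real ((card X)\<^sup>2) * (1 - R / card V) ^ k" by blast
  obtain T where T: "S \<subseteq> T" "T \<subseteq> V" "card T = k"
    using exists_subset_between[OF S(2) assms(6) S(1) assms(1)] by blast
  have "card (?P T) \<le> card (?P S)"
    by (intro card_mono fin) (use T in auto)
  then have "real (card (?P T)) \<le> real (card (?P S))" by (rule of_nat_mono)
  then show ?thesis using S T by (intro exI[of _ T]) auto
qed

text \<open>The sensor at the robber's vertex shows 0 and no other one does. This covers the case in
  which the number of sensors asked for exceeds the number of vertices.\<close>

lemma cops_can_win_all:
  assumes "finite V" "\<Union>E \<subseteq> V"
  shows "cops_can_win V E (card V)"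
proof (rule cops_can_winI[where sen = "\<lambda>_. V"])
  fix X b C assume X: "X \<subseteq> V" and C: "C = {u \<in> X. dist_vector E V u = b}"
  have "x = y" if "x \<in> C" "y \<in> C" for x y
  proof -
    have "dist_vector E V x x = dist_vector E V y x" using that C by simp
    then have "graph_dist E x x = graph_dist E x y"
      using that C X by (auto simp: dist_vector_def)
    moreover have "graph_dist E x x = 0"
    proof -
      have "graph_dist E x x \<le> enat 0"
        unfolding graph_dist_def by (rule INF_lower) simp
      then show ?thesis by (simp add: zero_enat_def[symmetric])
    qed
    ultimately have "graph_dist E x y < enat 1" by (metis enat_ord_simps(2) zero_enat_def zero_less_one)
    then obtain m where "((\<lambda>x y. {x, y} \<in> E) ^^ m) x y" "enat m < enat 1"
      unfolding graph_dist_def INF_less_iff by blast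
    then show "x = y" by simp
  qed
  moreover have "finite C" using C X assms finite_subset by fastforce
  ultimately have "card C \<le> 1" by (simp add: card_le_Suc0_iff_eq)
  then show "card C \<le> 1 \<or> card (closed_nbhd E C) < card X" ..
qed (use assms in auto)

text \<open>For a class C of at least two candidates with the same vector, the |C|^2 - |C| ordered
  pairs are all undistinguished, and this number is at least |C|^2 / 2. With q = (1 - R/n)^K the
  next candidate set thus has a square of at most D^2 |C|^2, hence at most 2 D^2 q |X|^2, which is
  below |X|^2.\<close>

lemma localization_number_le:
  fixes R :: real
  assumes "finite V" "V \<noteq> {}" "\<Union>E \<subseteq> V" "R \<le> card V"
    and D: "\<And>v. v \<in> V \<Longrightarrow> real (card (closed_nbhd E {v})) \<le> D"
    and R: "\<And>x y. x \<in> V \<Longrightarrow> y \<in> V \<Longrightarrow> x \<noteq> y \<Longrightarrow>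
      R \<le> real (card {s \<in> V. graph_dist E s x \<noteq> graph_dist E s y})"
    and K: "2 * D\<^sup>2 * (1 - R / card V) ^ K < 1"
  shows "localization_number V E \<le> K"
proof (cases "card V \<le> K")
  case True
  have "localization_number V E \<le> card V"
    unfolding localization_number_def by (intro Least_le cops_can_win_all assms)
  then show ?thesis using True by simp
next
  case False
  let ?q = "(1 - R / card V) ^ K"
  let ?G = "\<lambda>X S. S \<subseteq> V \<and> card S = K \<and>
    real (card {(x, y) \<in> X \<times> X. x \<noteq> y \<and> (\<forall>s\<in>S. graph_dist E s x = graph_dist E s y)})
      \<le> real ((card X)\<^sup>2) * ?q"
  have "\<forall>X\<in>Pow V. \<exists>S. ?G X S"
  proof
    fix X assume "X \<in> Pow V"
    then have "X \<subseteq> V" "finite X" using assms(1) finite_subset by auto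
    then show "\<exists>S. ?G X S"
      using ex_distinguishing_sensors[where X = X and k = K and E = E, OF assms(1,2) _ _ assms(4) _ R] False by simp
  qed
  from bchoice[OF this] obtain sen where "\<forall>X\<in>Pow V. ?G X (sen X)" by blast
  then have sen: "?G X (sen X)" if "X \<subseteq> V" for X using that by blast
  have "cops_can_win V E K"
  proof (rule cops_can_winI[where sen = sen])
    fix X b C assume X: "X \<subseteq> V" and C: "C = {u \<in> X. dist_vector E (sen X) u = b}"
    let ?P = "{(x, y) \<in> X \<times> X. x \<noteq> y \<and> (\<forall>s\<in>sen X. graph_dist E s x = graph_dist E s y)}"
    have fin: "finite X" "finite C" using C X finite_subset[OF _ assms(1)] by (auto intro: finite_subset)
    have "finite ?P" by (rule finite_subset[of _ "X \<times> X"]) (use fin in auto)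
    have "graph_dist E s x = graph_dist E s y" if "x \<in> C" "y \<in> C" "s \<in> sen X" for s x y
    proof -
      have "dist_vector E (sen X) x s = dist_vector E (sen X) y s" using that C by simp
      then show ?thesis using that by (simp add: dist_vector_def)
    qed
    \<comment> \<open>The diagonal is removed because \<open>?P\<close> only counts pairs of
      different vertices.\<close>
    then have "C \<times> C - (\<lambda>x. (x, x)) ` C \<subseteq> ?P" using C by auto
    then have "card (C \<times> C - (\<lambda>x. (x, x)) ` C) \<le> card ?P"
      using \<open>finite ?P\<close> by (rule card_mono[rotated])
    moreover have "card (C \<times> C - (\<lambda>x. (x, x)) ` C) = (card C)\<^sup>2 - card C"
      using fin by (subst card_Diff_subset) (auto simp: card_cartesian_product power2_eq_square card_image inj_on_def)
    ultimately have "real ((card C)\<^sup>2 - card C) \<le> real ((card X)\<^sup>2) * ?q"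
      using sen[OF X] by linarith
    moreover have "card C \<le> (card C)\<^sup>2" by (simp add: power2_eq_square)
    ultimately have le: "(real (card C))\<^sup>2 - real (card C) \<le> (real (card X))\<^sup>2 * ?q"
      by (simp add: of_nat_diff)
    show "card C \<le> 1 \<or> card (closed_nbhd E C) < card X"
    proof (cases "card C \<le> 1")
      case False
      then have C2: "2 \<le> real (card C)" by linarith
      then have "0 < card C" by linarith
      moreover have "card C \<le> card X" using fin C by (intro card_mono) auto
      ultimately have Xpos: "0 < real (card X)" by linarith
      have "real (card (closed_nbhd E C)) \<le> D * card C"
        by (rule card_closed_nbhd_le[OF fin(2)]) (use D C X in auto)
      then have "(real (card (closed_nbhd E C)))\<^sup>2 \<le> (D * card C)\<^sup>2"
        by (intro power_mono) auto
      also have "\<dots> = D\<^sup>2 * (real (card C))\<^sup>2" by (simp add: power_mult_distrib)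
      also have "\<dots> \<le> D\<^sup>2 * (2 * ((real (card C))\<^sup>2 - real (card C)))"
      proof (rule mult_left_mono)
        have "2 * real (card C) \<le> real (card C) * real (card C)"
          using C2 by (intro mult_right_mono) auto
        then show "(real (card C))\<^sup>2 \<le> 2 * ((real (card C))\<^sup>2 - real (card C))"
          by (simp add: power2_eq_square)
      qed simp
      also have "\<dots> \<le> D\<^sup>2 * (2 * ((real (card X))\<^sup>2 * ?q))"
        using le by (intro mult_left_mono) auto
      also have "\<dots> = (real (card X))\<^sup>2 * (2 * D\<^sup>2 * ?q)" by (simp add: mult_ac)
      also have "\<dots> < (real (card X))\<^sup>2 * 1"
        using K Xpos by (intro mult_strict_left_mono) auto
      finally have "real (card (closed_nbhd E C)) < real (card X)"
        using power2_less_imp_less[of "real (card (closed_nbhd E C))" "real (card X)"] by simp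
      then show ?thesis by simp
    qed simp
  qed (use assms(1,3) sen in blast)+
  then show ?thesis unfolding localization_number_def by (rule Least_le)
qed

section \<open>Neighbourhoods and expansion in the random graph\<close>

abbreviation nbhd_ball :: "'a set set \<Rightarrow> nat \<Rightarrow> 'a set \<Rightarrow> 'a set" where
  "nbhd_ball E j S \<equiv> (closed_nbhd E ^^ j) S"

lemma subset_closed_nbhd: "S \<subseteq> closed_nbhd E S"
  by (auto simp: closed_nbhd_def)

lemma closed_nbhd_Un: "closed_nbhd E (S \<union> T) = closed_nbhd E S \<union> closed_nbhd E T"
  by (auto simp: closed_nbhd_def)

lemma nbhd_ball_Un: "nbhd_ball E j (S \<union> T) = nbhd_ball E j S \<union> nbhd_ball E j T"
  by (induction j) (simp_all add: closed_nbhd_Un)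

lemma nbhd_ball_mono: "j \<le> m \<Longrightarrow> nbhd_ball E j S \<subseteq> nbhd_ball E m S"
  by (induction rule: dec_induct) (use subset_closed_nbhd in fastforce)+

lemma nbhd_ball_subset: "\<Union>E \<subseteq> V \<Longrightarrow> S \<subseteq> V \<Longrightarrow> nbhd_ball E j S \<subseteq> V"
  by (induction j) (simp_all add: closed_nbhd_subset)

text \<open>Links the distances of the game to iterated neighbourhoods, on which expansion acts. The
  ball grows at \<open>s\<close>, so walks from \<open>s\<close> to \<open>x\<close> are extended at
  their first vertex.\<close>

lemma graph_dist_le_iff: "graph_dist E s x \<le> enat j \<longleftrightarrow> s \<in> nbhd_ball E j {x}"
proof -
  let ?R = "\<lambda>a b. {a, b} \<in> E"
  have "s \<in> nbhd_ball E j {x} \<longleftrightarrow> (\<exists>m\<le>j. (?R ^^ m) s x)" for s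
  proof (induction j arbitrary: s)
    case (Suc j)
    have "s \<in> nbhd_ball E (Suc j) {x} \<longleftrightarrow> (\<exists>m\<le>j. (?R ^^ m) s x) \<or> (\<exists>u. ?R s u \<and> (\<exists>m\<le>j. (?R ^^ m) u x))"
    proof -
      have "s \<in> nbhd_ball E (Suc j) {x} \<longleftrightarrow> s \<in> nbhd_ball E j {x} \<or> (\<exists>u. {u, s} \<in> E \<and> u \<in> nbhd_ball E j {x})"
        by (auto simp: closed_nbhd_def)
      then show ?thesis unfolding Suc.IH insert_commute[of _ s] .
    qed
    also have "\<dots> \<longleftrightarrow> (\<exists>m\<le>Suc j. (?R ^^ m) s x)"
    proof
      assume "(\<exists>m\<le>j. (?R ^^ m) s x) \<or> (\<exists>u. ?R s u \<and> (\<exists>m\<le>j. (?R ^^ m) u x))"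
      then show "\<exists>m\<le>Suc j. (?R ^^ m) s x"
      proof
        assume "\<exists>m\<le>j. (?R ^^ m) s x"
        then show ?thesis using le_SucI by blast
      next
        assume "\<exists>u. ?R s u \<and> (\<exists>m\<le>j. (?R ^^ m) u x)"
        then obtain u m where "?R s u" "m \<le> j" "(?R ^^ m) u x" by blast
        then have "(?R ^^ Suc m) s x" "Suc m \<le> Suc j" by (blast intro: relpowp_Suc_I2, simp)
        then show ?thesis by blast
      qed
    next
      assume "\<exists>m\<le>Suc j. (?R ^^ m) s x"
      then obtain m where m: "m \<le> Suc j" "(?R ^^ m) s x" by blast
      show "(\<exists>m\<le>j. (?R ^^ m) s x) \<or> (\<exists>u. ?R s u \<and> (\<exists>m\<le>j. (?R ^^ m) u x))"
      proof (cases m)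
        case 0
        then show ?thesis using m by blast
      next
        case (Suc k)
        then have "(?R ^^ Suc k) s x" "k \<le> j" using m by simp_all
        from relpowp_Suc_D2[OF this(1)] show ?thesis using \<open>k \<le> j\<close> by blast
      qed
    qed
    finally show ?case .
  qed auto
  moreover have "graph_dist E s x \<le> enat j \<longleftrightarrow> (\<exists>m\<le>j. (?R ^^ m) s x)"
  proof
    assume "graph_dist E s x \<le> enat j"
    then have "graph_dist E s x < enat (Suc j)" by (simp add: order_le_less_trans)
    then obtain m where "(?R ^^ m) s x" "enat m < enat (Suc j)"
      unfolding graph_dist_def INF_less_iff by blast
    then have "m \<le> j" by simp
    then show "\<exists>m\<le>j. (?R ^^ m) s x" using \<open>(?R ^^ m) s x\<close> by blast
  next
    assume "\<exists>m\<le>j. (?R ^^ m) s x"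
    then obtain m where m: "m \<le> j" "(?R ^^ m) s x" by blast
    then have "graph_dist E s x \<le> enat m"
      unfolding graph_dist_def by (intro INF_lower) simp
    then show "graph_dist E s x \<le> enat j" using m by (meson enat_ord_simps(1) order_trans)
  qed
  ultimately show ?thesis by simp
qed

text \<open>A vertex lying in exactly one of two balls of equal radius is at different distances
  from the centres; this is used for the radii \<open>j\<close> and \<open>Suc j\<close>. The
  symmetric difference is written as 2 |X \<union> Y| - |X| - |Y|, so that a lower bound is needed
  for the union only and upper bounds for the single balls.\<close>

lemma card_distinguished_ge:
  assumes "finite V" "\<Union>E \<subseteq> V" "x \<in> V" "y \<in> V"
    and X: "X = nbhd_ball E j {x}" and Y: "Y = nbhd_ball E j {y}"
  shows "2 * real (card (X \<union> Y)) - real (card X) - real (card Y)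
      + real (card {s \<in> V - (X \<union> Y). (s \<in> closed_nbhd E X) \<noteq> (s \<in> closed_nbhd E Y)})
    \<le> real (card {s \<in> V. graph_dist E s x \<noteq> graph_dist E s y})"
proof -
  let ?Z = "{s \<in> V - (X \<union> Y). (s \<in> closed_nbhd E X) \<noteq> (s \<in> closed_nbhd E Y)}"
  let ?M = "{s \<in> V. graph_dist E s x \<noteq> graph_dist E s y}"
  have XV: "X \<subseteq> V" "Y \<subseteq> V" unfolding X Y using assms(3,4) by (intro nbhd_ball_subset[OF assms(2)]; simp)+
  then have fin: "finite X" "finite Y" using assms(1) finite_subset by auto
  have "s \<in> nbhd_ball E m {x} \<longleftrightarrow> s \<in> nbhd_ball E m {y}"
    if "graph_dist E s x = graph_dist E s y" for s m
    using that by (simp flip: graph_dist_le_iff)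
  from this[of _ j] this[of _ "Suc j"]
  have "(X - Y) \<union> (Y - X) \<union> ?Z \<subseteq> ?M" using XV by (auto simp: X Y)
  then have le: "card ((X - Y) \<union> (Y - X) \<union> ?Z) \<le> card ?M" using assms(1) by (intro card_mono) auto
  have "card ((X - Y) \<union> (Y - X) \<union> ?Z) = card (X - Y) + card (Y - X) + card ?Z"
    using fin assms(1) by (subst card_Un_disjoint; (subst card_Un_disjoint)?) auto
  moreover have "card (X \<union> Y) = card (X - Y) + card Y" "card (X \<union> Y) = card (Y - X) + card X"
    using fin by (metis card_Un_disjoint finite_Diff Diff_disjoint Un_Diff_cancel Int_commute Un_commute add.commute)+
  ultimately show ?thesis using le by linarith
qed

lemma finite_vertex_pairs [simp]: "finite (vertex_pairs n)"
  unfolding vertex_pairs_def by simp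

lemma vertex_pairs_subset: "E \<subseteq> vertex_pairs n \<Longrightarrow> \<Union>E \<subseteq> {1..n}"
  by (auto simp: vertex_pairs_def)

lemma doubleton_in_vertex_pairs:
  "{u, v} \<in> vertex_pairs n \<longleftrightarrow> u \<noteq> v \<and> u \<in> {1..n} \<and> v \<in> {1..n}"
  by (auto simp: vertex_pairs_def card_insert_if)

section \<open>Degrees and expansion of small sets\<close>

lemma pr_degree:
  fixes p d \<epsilon> :: real
  assumes p: "0 \<le> p" "p \<le> 1" and d: "d = p * real n" and e: "0 < \<epsilon>" "\<epsilon> \<le> 2" and v: "v \<in> {1..n}"
  shows "pr p (vertex_pairs n) (\<lambda>E. (1 + \<epsilon>) * d + 1 < real (card (closed_nbhd E {v}))) \<le> exp (- \<epsilon>\<^sup>2 * d / 4)"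
proof -
  let ?T = "{1..n} - {v}"
  have "pr p (vertex_pairs n) (\<lambda>E. (1 + \<epsilon>) * d + 1 < real (card (closed_nbhd E {v})))
      \<le> pr p (vertex_pairs n) (\<lambda>E. (1 + \<epsilon>) * d \<le> real (card {u \<in> ?T. {v, u} \<in> E}))"
  proof (rule pr_mono[OF p])
    fix E assume E: "E \<subseteq> vertex_pairs n" and big: "(1 + \<epsilon>) * d + 1 < real (card (closed_nbhd E {v}))"
    \<comment> \<open>The vertex itself belongs to its closed neighbourhood, which costs the
      \<open>+ 1\<close> in the event.\<close>
    have "closed_nbhd E {v} \<subseteq> insert v {u \<in> ?T. {v, u} \<in> E}"
      using E by (auto simp: closed_nbhd_def doubleton_in_vertex_pairs dest!: subsetD)
    then have "card (closed_nbhd E {v}) \<le> card (insert v {u \<in> ?T. {v, u} \<in> E})"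
      by (intro card_mono) auto
    also have "\<dots> = Suc (card {u \<in> ?T. {v, u} \<in> E})" by (subst card_insert_disjoint) auto
    finally show "(1 + \<epsilon>) * d \<le> real (card {u \<in> ?T. {v, u} \<in> E})" using big by linarith
  qed
  also have "\<dots> \<le> exp (- \<epsilon>\<^sup>2 * d / 4)"
  proof (rule chernoff_upper[where K = "\<lambda>u. {{v, u}}" and b = p])
    fix u assume u: "u \<in> ?T"
    then have in_F: "{v, u} \<in> vertex_pairs n" using v by (simp add: doubleton_in_vertex_pairs)
    then show sub: "{{v, u}} \<subseteq> vertex_pairs n" by simp
    have "pr p (vertex_pairs n) (\<lambda>E. {v, u} \<in> E) = pr p (vertex_pairs n) (\<lambda>E. \<not> E \<inter> {{v, u}} = {})"
      by (rule expec_cong) auto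
    also have "\<dots> = 1 - (1 - p) ^ card {{v, u}}"
      by (simp only: pr_not[OF finite_vertex_pairs] pr_avoid[OF finite_vertex_pairs sub])
    also have "\<dots> = p" by simp
    finally show "pr p (vertex_pairs n) (\<lambda>E. {v, u} \<in> E) \<le> p" by simp
  next
    have "real (card ?T) \<le> real n" using card_mono[of "{1..n}" ?T] by auto
    then show "p * real (card ?T) \<le> d" unfolding d using p by (intro mult_left_mono) auto
  qed (use p e in \<open>auto simp: disjoint_family_on_def doubleton_eq_iff\<close>)
  finally show ?thesis .
qed

lemma star_image_inj: "s \<notin> S \<Longrightarrow> inj_on (\<lambda>u. {u, s}) S"
  by (auto simp: inj_on_def doubleton_eq_iff)

lemma star_subset: "S \<subseteq> {1..n} \<Longrightarrow> s \<in> {1..n} \<Longrightarrow> s \<notin> S \<Longrightarrow> (\<lambda>u. {u, s}) ` S \<subseteq> vertex_pairs n"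
  by (auto simp: doubleton_in_vertex_pairs)

lemma disjoint_stars: "T \<inter> S = {} \<Longrightarrow> disjoint_family_on (\<lambda>s. (\<lambda>u. {u, s}) ` S) T"
  by (auto simp: disjoint_family_on_def doubleton_eq_iff)

text \<open>Only the edges between S and its complement are looked at, so outside vertices are hit
  independently. The bound is a power with exponent \<open>card S\<close> in order to survive a
  union bound over all sets of that size.\<close>

lemma pr_small_nbhd:
  fixes p d \<epsilon> :: real
  assumes p: "0 \<le> p" "p \<le> 1" and d: "d = p * real n" and e: "0 < \<epsilon>" "\<epsilon> \<le> 1"
    and S: "S \<subseteq> {1..n}" and small: "p * card S \<le> \<epsilon> / 4" "card S \<le> \<epsilon> / 4 * n"
  shows "pr p (vertex_pairs n) (\<lambda>E. real (card (closed_nbhd E S)) < (1 - \<epsilon>) * d * card S)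
    \<le> exp (- \<epsilon>\<^sup>2 * d / 16) ^ card S"
proof -
  let ?T = "{1..n} - S"
  let ?s = "real (card S)"
  \<comment> \<open>With x = p |S|, a vertex is hit with probability at least x - x^2/2, and x is at
    most eps/4. Together with the loss of eps/4 from the vertices inside S this stays within a
    factor 1 - eps/2; a deviation of eps/2 then leaves (1 - eps/2)^2, at least 1 - eps.\<close>
  define b where "b = p * ?s * (1 - \<epsilon> / 8)"
  define m where "m = b * real (card ?T)"
  have "finite S" using S finite_subset by blast
  have b0: "0 \<le> b" using p e by (simp add: b_def)
  have T: "real (card ?T) = real n - ?s"
  proof -
    have "card S \<le> n" using card_mono[OF _ S] by simp
    then show ?thesis using S \<open>finite S\<close> by (simp add: card_Diff_subset of_nat_diff)
  qed
  have m_ge: "(1 - \<epsilon> / 2) * (d * ?s) \<le> m"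
  proof -
    have "(1 - \<epsilon> / 2) * (d * ?s) \<le> (1 - \<epsilon> / 8) * (1 - \<epsilon> / 4) * (d * ?s)"
      using p d e by (intro mult_right_mono) (auto simp: field_simps)
    also have "\<dots> = b * ((1 - \<epsilon> / 4) * n)" by (simp add: b_def d)
    also have "\<dots> \<le> m"
      unfolding m_def T using small b0 by (intro mult_left_mono) (auto simp: field_simps)
    finally show ?thesis .
  qed
  have ds: "0 \<le> d * ?s" using d p by simp
  have "pr p (vertex_pairs n) (\<lambda>E. real (card (closed_nbhd E S)) < (1 - \<epsilon>) * d * card S)
      \<le> pr p (vertex_pairs n) (\<lambda>E. real (card {v \<in> ?T. \<exists>u\<in>S. {u, v} \<in> E}) \<le> (1 - \<epsilon> / 2) * m)"
  proof (rule pr_mono[OF p])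
    fix E assume E: "E \<subseteq> vertex_pairs n" and less: "real (card (closed_nbhd E S)) < (1 - \<epsilon>) * d * card S"
    have "closed_nbhd E S \<subseteq> {1..n}" by (intro closed_nbhd_subset vertex_pairs_subset E S)
    then have "card {v \<in> ?T. \<exists>u\<in>S. {u, v} \<in> E} \<le> card (closed_nbhd E S)"
      by (intro card_mono) (auto simp: closed_nbhd_def intro: finite_subset)
    then have "real (card {v \<in> ?T. \<exists>u\<in>S. {u, v} \<in> E}) \<le> (1 - \<epsilon>) * (d * ?s)" using less by simp
    also have "\<dots> \<le> (1 - \<epsilon> / 2) * (1 - \<epsilon> / 2) * (d * ?s)"
      using ds by (intro mult_right_mono) (auto simp: field_simps)
    also have "\<dots> \<le> (1 - \<epsilon> / 2) * m"
      using m_ge e by (simp only: mult.assoc) (intro mult_left_mono, auto)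
    finally show "real (card {v \<in> ?T. \<exists>u\<in>S. {u, v} \<in> E}) \<le> (1 - \<epsilon> / 2) * m" .
  qed
  also have "\<dots> \<le> exp (- (\<epsilon> / 2)\<^sup>2 * m / 2)"
  proof (rule chernoff_lower[where K = "\<lambda>v. (\<lambda>u. {u, v}) ` S" and b = b])
    fix v assume v: "v \<in> ?T"
    then show F: "(\<lambda>u. {u, v}) ` S \<subseteq> vertex_pairs n" by (intro star_subset S) auto
    have "card ((\<lambda>u. {u, v}) ` S) = card S" using v by (intro card_image star_image_inj) auto
    have "b \<le> p * ?s * (1 - p * ?s / 2)"
      unfolding b_def using p small by (intro mult_left_mono) auto
    also have "\<dots> = p * ?s - (p * ?s)\<^sup>2 / 2" by (simp add: algebra_simps power2_eq_square)
    also have "\<dots> \<le> 1 - exp (- (p * ?s))"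
      using exp_minus_le_quadratic[of "p * ?s"] p by simp
    also have "\<dots> \<le> 1 - (1 - p) ^ card S"
    proof -
      have "(1 - p) ^ card S \<le> exp (- p) ^ card S"
        using p exp_ge_add_one_self[of "- p"] by (intro power_mono) auto
      also have "\<dots> = exp (- (p * ?s))" by (simp add: exp_of_nat_mult[symmetric] mult.commute)
      finally show ?thesis by simp
    qed
    also have "\<dots> = pr p (vertex_pairs n) (\<lambda>E. \<not> E \<inter> (\<lambda>u. {u, v}) ` S = {})"
      by (simp only: pr_not[OF finite_vertex_pairs] pr_avoid[OF finite_vertex_pairs F]
          \<open>card ((\<lambda>u. {u, v}) ` S) = card S\<close>)
    also have "\<dots> = pr p (vertex_pairs n) (\<lambda>E. \<exists>u\<in>S. {u, v} \<in> E)"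
      by (rule expec_cong) (auto simp: of_bool_def)
    finally show "b \<le> pr p (vertex_pairs n) (\<lambda>E. \<exists>u\<in>S. {u, v} \<in> E)" .
  next
    show "disjoint_family_on (\<lambda>v. (\<lambda>u. {u, v}) ` S) ?T" by (rule disjoint_stars) auto
  qed (use p e b0 in \<open>auto simp: m_def\<close>)
  also have "\<dots> \<le> exp (- (\<epsilon> / 2)\<^sup>2 * (d * ?s / 2) / 2)"
  proof -
    have "d * ?s / 2 \<le> (1 - \<epsilon> / 2) * (d * ?s)"
      using mult_right_mono[OF _ ds, of "1/2" "1 - \<epsilon> / 2"] e by simp
    then have "d * ?s / 2 \<le> m" using m_ge by linarith
    then have "(\<epsilon> / 2)\<^sup>2 * (d * ?s / 2) \<le> (\<epsilon> / 2)\<^sup>2 * m" by (intro mult_left_mono) auto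
    then show ?thesis by (simp only: exp_le_cancel_iff mult_minus_left)
  qed
  also have "\<dots> = exp (- \<epsilon>\<^sup>2 * d / 16) ^ card S"
    by (simp add: exp_of_nat_mult[symmetric] power2_eq_square)
  finally show ?thesis .
qed

text \<open>Summing over all sets at once replaces grouping them by size with binomial
  coefficients.\<close>

lemma sum_power_card_Pow:
  "finite A \<Longrightarrow> (\<Sum>S\<in>Pow A. (b::real) ^ card S) = (1 + b) ^ card A"
  using prod_add[of A "\<lambda>_. b" "\<lambda>_. 1"] by (simp add: add.commute)

text \<open>Upper bounds for neighbourhoods of sets follow from those for vertices, but lower bounds
  do not, because neighbourhoods may overlap. Hence one condition is on vertices and the other on
  sets.\<close>

definition regular_expander :: "nat \<Rightarrow> real \<Rightarrow> real \<Rightarrow> real \<Rightarrow> nat set set \<Rightarrow> bool" where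
  "regular_expander n d \<epsilon> s0 E \<longleftrightarrow>
     (\<forall>v\<in>{1..n}. real (card (closed_nbhd E {v})) \<le> (1 + \<epsilon>) * d) \<and>
     (\<forall>S\<subseteq>{1..n}. real (card S) \<le> s0 \<longrightarrow> (1 - \<epsilon>) * d * card S \<le> real (card (closed_nbhd E S)))"

lemma pr_not_regular_expander:
  fixes p d \<epsilon> s0 b :: real
  assumes p: "0 \<le> p" "p \<le> 1" and d: "d = p * real n" and e: "0 < \<epsilon>" "\<epsilon> \<le> 1" "2 \<le> \<epsilon> * d"
    and small: "p * s0 \<le> \<epsilon> / 4" "s0 \<le> \<epsilon> / 4 * n"
    and b: "b = exp (- \<epsilon>\<^sup>2 * d / 16)" "n * b \<le> 1"
  shows "pr p (vertex_pairs n) (\<lambda>E. \<not> regular_expander n d \<epsilon> s0 E) \<le> 3 * (n * b)"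
proof -
  let ?F = "vertex_pairs n" and ?SS = "{S \<in> Pow {1..n}. real (card S) \<le> s0 \<and> S \<noteq> {}}"
  have finS: "finite ?SS" by simp
  \<comment> \<open>The degree estimate is used with \<open>\<epsilon> / 2\<close>: the other half
    of the deviation absorbs the \<open>+ 1\<close>, as
    \<open>2 \<le> \<epsilon> * d\<close>.\<close>
  have "pr p ?F (\<lambda>E. \<not> regular_expander n d \<epsilon> s0 E)
      \<le> pr p ?F (\<lambda>E. (\<exists>v\<in>{1..n}. (1 + \<epsilon> / 2) * d + 1 < real (card (closed_nbhd E {v}))) \<or>
           (\<exists>S\<in>?SS. real (card (closed_nbhd E S)) < (1 - \<epsilon>) * d * card S))"
  proof (rule pr_mono[OF p])
    fix E assume "\<not> regular_expander n d \<epsilon> s0 E"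
    then consider v where "v \<in> {1..n}" "(1 + \<epsilon>) * d < real (card (closed_nbhd E {v}))"
      | S where "S \<subseteq> {1..n}" "real (card S) \<le> s0" "real (card (closed_nbhd E S)) < (1 - \<epsilon>) * d * card S"
      unfolding regular_expander_def by (meson not_le)
    then show "(\<exists>v\<in>{1..n}. (1 + \<epsilon> / 2) * d + 1 < real (card (closed_nbhd E {v}))) \<or>
           (\<exists>S\<in>?SS. real (card (closed_nbhd E S)) < (1 - \<epsilon>) * d * card S)"
    proof cases
      case 1
      have "(1 + \<epsilon> / 2) * d + 1 \<le> (1 + \<epsilon>) * d" using e by (simp add: algebra_simps)
      then show ?thesis using 1 by (intro disjI1 bexI[of _ v]) auto
    next
      case 2
      then have "S \<noteq> {}" by auto
      then show ?thesis using 2 by blast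
    qed
  qed
  also have "\<dots> \<le> pr p ?F (\<lambda>E. \<exists>v\<in>{1..n}. (1 + \<epsilon> / 2) * d + 1 < real (card (closed_nbhd E {v})))
      + pr p ?F (\<lambda>E. \<exists>S\<in>?SS. real (card (closed_nbhd E S)) < (1 - \<epsilon>) * d * card S)"
    by (rule pr_disj[OF p])
  also have "pr p ?F (\<lambda>E. \<exists>v\<in>{1..n}. (1 + \<epsilon> / 2) * d + 1 < real (card (closed_nbhd E {v}))) \<le> n * b"
  proof -
    have "pr p ?F (\<lambda>E. \<exists>v\<in>{1..n}. (1 + \<epsilon> / 2) * d + 1 < real (card (closed_nbhd E {v})))
        \<le> (\<Sum>v\<in>{1..n}. pr p ?F (\<lambda>E. (1 + \<epsilon> / 2) * d + 1 < real (card (closed_nbhd E {v}))))"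
      by (rule pr_union_bound[OF p]) simp
    also have "\<dots> \<le> (\<Sum>v\<in>{1..n}. b)"
    proof (rule sum_mono)
      fix v assume "v \<in> {1..n}"
      have "pr p ?F (\<lambda>E. (1 + \<epsilon> / 2) * d + 1 < real (card (closed_nbhd E {v}))) \<le> exp (- (\<epsilon> / 2)\<^sup>2 * d / 4)"
        using e by (intro pr_degree[OF p d _ _ \<open>v \<in> {1..n}\<close>]) auto
      also have "\<dots> = b" unfolding b by (simp add: power2_eq_square)
      finally show "pr p ?F (\<lambda>E. (1 + \<epsilon> / 2) * d + 1 < real (card (closed_nbhd E {v}))) \<le> b" .
    qed
    finally show ?thesis by simp
  qed
  also have "pr p ?F (\<lambda>E. \<exists>S\<in>?SS. real (card (closed_nbhd E S)) < (1 - \<epsilon>) * d * card S) \<le> 2 * (n * b)"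
  proof -
    have "pr p ?F (\<lambda>E. \<exists>S\<in>?SS. real (card (closed_nbhd E S)) < (1 - \<epsilon>) * d * card S)
        \<le> (\<Sum>S\<in>?SS. pr p ?F (\<lambda>E. real (card (closed_nbhd E S)) < (1 - \<epsilon>) * d * card S))"
      by (rule pr_union_bound[OF p finS])
    also have "\<dots> \<le> (\<Sum>S\<in>?SS. b ^ card S)"
    proof (rule sum_mono)
      fix S assume S: "S \<in> ?SS"
      then have "p * card S \<le> p * s0" using p by (intro mult_left_mono) auto
      then show "pr p ?F (\<lambda>E. real (card (closed_nbhd E S)) < (1 - \<epsilon>) * d * card S) \<le> b ^ card S"
        unfolding b using S small by (intro pr_small_nbhd[OF p d e(1,2)]) auto
    qed
    also have "\<dots> \<le> (\<Sum>S\<in>Pow {1..n} - {{}}. b ^ card S)"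
      by (intro sum_mono2) (auto simp: b)
    \<comment> \<open>Without the empty set the sum is at most exp (n b) - 1, and this is at most 2
      n b because n b is at most 1.\<close>
    also have "\<dots> = (1 + b) ^ n - 1"
      by (subst sum_diff1) (auto simp: sum_power_card_Pow)
    also have "\<dots> \<le> exp b ^ n - 1"
      using exp_ge_add_one_self[of b] by (simp add: power_mono b)
    also have "\<dots> = exp (n * b) - 1" by (simp add: exp_of_nat_mult)
    also have "\<dots> \<le> n * b + (n * b)\<^sup>2"
      using exp_bound[of "n * b"] b by simp
    also have "\<dots> \<le> 2 * (n * b)"
    proof -
      have "0 \<le> n * b" by (simp add: b)
      then have "(n * b) * (n * b) \<le> n * b" using b(2) mult_left_le by blast
      then show ?thesis unfolding power2_eq_square by linarith
    qed
    finally show ?thesis .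
  qed
  finally show ?thesis by (simp add: mult_ac)
qed

text \<open>Expansion towards radius \<open>Suc j\<close> is applied to balls of radius at most
  \<open>j\<close>. So \<open>s0\<close> has to bound these smaller balls only, and the largest ball
  may exceed it.\<close>

lemma regular_expander_balls:
  assumes E: "E \<subseteq> vertex_pairs n" and reg: "regular_expander n d \<epsilon> s0 E" and d: "0 \<le> d" "0 \<le> \<epsilon>" "\<epsilon> \<le> 1"
    and S: "S \<subseteq> {1..n}"
  shows "real (card (nbhd_ball E m S)) \<le> ((1 + \<epsilon>) * d) ^ m * card S"
    and "\<And>j. 1 \<le> (1 + \<epsilon>) * d \<Longrightarrow> ((1 + \<epsilon>) * d) ^ j * card S \<le> s0 \<Longrightarrow> m \<le> Suc j \<Longrightarrow>
      ((1 - \<epsilon>) * d) ^ m * card S \<le> real (card (nbhd_ball E m S))"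
proof -
  let ?D = "(1 + \<epsilon>) * d"
  have sub: "nbhd_ball E m S \<subseteq> {1..n}" for m
    by (intro nbhd_ball_subset vertex_pairs_subset E S)
  have fin: "finite (nbhd_ball E m S)" for m using sub finite_subset by blast
  show upper: "real (card (nbhd_ball E m S)) \<le> ?D ^ m * card S" for m
  proof (induction m)
    case (Suc m)
    have "real (card (nbhd_ball E (Suc m) S)) \<le> ?D * card (nbhd_ball E m S)"
      using reg sub[of m] card_closed_nbhd_le[OF fin, of m E ?D] unfolding regular_expander_def by auto
    also have "\<dots> \<le> ?D * (?D ^ m * card S)" using Suc d by (intro mult_left_mono) auto
    finally show ?case by simp
  qed simp
  fix j assume D1: "1 \<le> ?D" and s0: "?D ^ j * card S \<le> s0"
  show "m \<le> Suc j \<Longrightarrow> ((1 - \<epsilon>) * d) ^ m * card S \<le> real (card (nbhd_ball E m S))" for m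
  proof (induction m)
    case (Suc m)
    have "real (card (nbhd_ball E m S)) \<le> ?D ^ m * card S" by (rule upper)
    also have "\<dots> \<le> ?D ^ j * card S" using D1 Suc.prems by (intro mult_right_mono power_increasing) auto
    finally have "real (card (nbhd_ball E m S)) \<le> s0" using s0 by linarith
    then have "(1 - \<epsilon>) * d * card (nbhd_ball E m S) \<le> real (card (nbhd_ball E (Suc m) S))"
      using reg sub[of m] unfolding regular_expander_def by auto
    moreover have "(1 - \<epsilon>) * d * (((1 - \<epsilon>) * d) ^ m * card S) \<le> (1 - \<epsilon>) * d * card (nbhd_ball E m S)"
      using Suc d by (intro mult_left_mono) auto
    ultimately show ?case by (simp add: mult.assoc)
  qed simp
qed

section \<open>Exposing two balls\<close>

text \<open>A breadth-first search to radius \<open>Suc j\<close> inspects only edges that meet the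
  ball of radius \<open>j\<close>. That ball is itself computed in \<open>E\<close>, which makes
  this usable as a stopping rule.\<close>

lemma nbhd_ball_cong:
  assumes "\<And>e. e \<inter> nbhd_ball E j S \<noteq> {} \<Longrightarrow> e \<in> E \<longleftrightarrow> e \<in> E'" and "R \<subseteq> S" and "m \<le> Suc j"
  shows "nbhd_ball E' m R = nbhd_ball E m R"
  using assms(3)
proof (induction m)
  case (Suc m)
  have "nbhd_ball E m R \<subseteq> nbhd_ball E m S"
    using nbhd_ball_Un[where E = E and j = m and S = R and T = S] \<open>R \<subseteq> S\<close> by (simp add: Un_absorb1) blast
  also have "\<dots> \<subseteq> nbhd_ball E j S" using Suc.prems by (intro nbhd_ball_mono) simp
  finally have sub: "nbhd_ball E m R \<subseteq> nbhd_ball E j S" .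
  have "{u, v} \<in> E' \<longleftrightarrow> {u, v} \<in> E" if "u \<in> nbhd_ball E m R" for u v
    using assms(1)[of "{u, v}"] that sub by auto
  moreover have "closed_nbhd E' B = closed_nbhd E B"
    if "\<And>u v. u \<in> B \<Longrightarrow> {u, v} \<in> E' \<longleftrightarrow> {u, v} \<in> E" for B
    using that by (auto simp: closed_nbhd_def)
  ultimately have "closed_nbhd E' (nbhd_ball E m R) = closed_nbhd E (nbhd_ball E m R)" by blast
  then show ?case using Suc by simp
qed simp

text \<open>The first component is recorded because it tells which edges have been inspected, namely
  those meeting it.\<close>

definition exposed :: "nat set set \<Rightarrow> nat \<Rightarrow> nat \<Rightarrow> nat \<Rightarrow> nat set \<times> nat set \<times> nat set" where
  "exposed E j x y = (nbhd_ball E j {x, y}, nbhd_ball E (Suc j) {x}, nbhd_ball E (Suc j) {y})"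

lemma exposed_cong:
  assumes "\<And>e. e \<inter> fst (exposed E j x y) \<noteq> {} \<Longrightarrow> e \<in> E \<longleftrightarrow> e \<in> E'"
  shows "exposed E' j x y = exposed E j x y"
proof -
  have "nbhd_ball E' m R = nbhd_ball E m R" if "R \<subseteq> {x, y}" "m \<le> Suc j" for R m
    by (rule nbhd_ball_cong[OF _ that]) (use assms in \<open>simp add: exposed_def\<close>)
  from this[of "{x, y}" j] this[of "{x}" "Suc j"] this[of "{y}" "Suc j"]
  show ?thesis unfolding exposed_def by (metis insertI1 insert_subset empty_subsetI insertI2 order_refl le_SucI)
qed

text \<open>The condition on \<open>g\<close> in \<open>pr_stopping\<close>. Either graph can play
  the part in which the inspected ball is computed, hence both directions.\<close>

lemma exposed_eq_iff:
  "exposed E j x y = z \<longleftrightarrow> exposed (E \<inter> {e. e \<inter> fst z \<noteq> {}}) j x y = z"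
proof
  assume z: "exposed E j x y = z"
  have "exposed (E \<inter> {e. e \<inter> fst z \<noteq> {}}) j x y = exposed E j x y"
    by (rule exposed_cong) (simp add: z)
  then show "exposed (E \<inter> {e. e \<inter> fst z \<noteq> {}}) j x y = z" by (simp add: z)
next
  assume z: "exposed (E \<inter> {e. e \<inter> fst z \<noteq> {}}) j x y = z"
  have "exposed E j x y = exposed (E \<inter> {e. e \<inter> fst z \<noteq> {}}) j x y"
    by (rule exposed_cong) (simp add: z)
  then show "exposed E j x y = z" by (simp add: z)
qed

text \<open>Neither \<open>s\<close> nor its partner \<open>u\<close> may lie in \<open>U\<close>,
  so no inspected edge is involved. The triple is arbitrary here; for one that was really exposed,
  \<open>new_distinguished_exposed\<close> recovers the intended set.\<close>

definition new_distinguished ::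
    "nat \<Rightarrow> nat set \<times> nat set \<times> nat set \<Rightarrow> nat set set \<Rightarrow> nat set" where
  "new_distinguished n = (\<lambda>(U, X, Y) E. {s \<in> {1..n} - (X \<union> Y \<union> U).
     (\<exists>u\<in>X - U. {u, s} \<in> E) \<noteq> (\<exists>u\<in>Y - U. {u, s} \<in> E)})"

text \<open>Two exclusive events: \<open>s\<close> misses X but meets Y - X, or misses Y but meets X
  - Y. In each, the edges to be missed and those to be met are disjoint, so the probabilities
  multiply.\<close>

lemma pr_adjacent_to_exactly_one:
  assumes p: "0 \<le> p" "p \<le> 1" and XY: "X \<subseteq> {1..n}" "Y \<subseteq> {1..n}" and s: "s \<in> {1..n} - (X \<union> Y)"
    and a: "card X \<le> a" "card Y \<le> a" and b: "b \<le> card (X - Y)" "b \<le> card (Y - X)"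
  shows "2 * (1 - p) ^ a * (1 - (1 - p) ^ b)
    \<le> pr p (vertex_pairs n) (\<lambda>E. (\<exists>u\<in>X. {u, s} \<in> E) \<noteq> (\<exists>u\<in>Y. {u, s} \<in> E))"
proof -
  let ?F = "vertex_pairs n" and ?st = "\<lambda>S. (\<lambda>u. {u, s}) ` S"
  have card_st: "card (?st S) = card S" if "S \<subseteq> X \<union> Y" for S
    using s that by (intro card_image star_image_inj) auto
  have half: "(1 - p) ^ a * (1 - (1 - p) ^ b) \<le> pr p ?F (\<lambda>E. E \<inter> ?st S = {} \<and> E \<inter> ?st (R - S) \<noteq> {})"
    if "S \<subseteq> X \<union> Y" "R \<subseteq> X \<union> Y" "card S \<le> a" "b \<le> card (R - S)" for S R
  proof -
    have "(1 - p) ^ a * (1 - (1 - p) ^ b) \<le> (1 - p) ^ card S * (1 - (1 - p) ^ card (R - S))"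
      using p that by (intro mult_mono diff_left_mono power_decreasing) (auto simp: power_le_one)
    also have "\<dots> = (1 - p) ^ card (?st S) * (1 - (1 - p) ^ card (?st (R - S)))"
      using that by (subst (1 2) card_st) auto
    also have "\<dots> = pr p ?F (\<lambda>E. E \<inter> ?st S = {} \<and> E \<inter> ?st (R - S) \<noteq> {})"
    proof (rule pr_avoid_hit[symmetric, OF finite_vertex_pairs])
      have "S \<subseteq> {1..n}" "R - S \<subseteq> {1..n}" "s \<in> {1..n}" "s \<notin> S" "s \<notin> R - S"
        using that XY s by blast+
      then show "?st S \<subseteq> ?F" "?st (R - S) \<subseteq> ?F"
        using star_subset by blast+
      show "?st S \<inter> ?st (R - S) = {}"
        using that s by (auto simp: doubleton_eq_iff)
    qed
    finally show ?thesis .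
  qed
  have "2 * (1 - p) ^ a * (1 - (1 - p) ^ b)
      \<le> pr p ?F (\<lambda>E. E \<inter> ?st X = {} \<and> E \<inter> ?st (Y - X) \<noteq> {}) + pr p ?F (\<lambda>E. E \<inter> ?st Y = {} \<and> E \<inter> ?st (X - Y) \<noteq> {})"
    using half[of X Y] half[of Y X] a b by simp
  also have "\<dots> \<le> pr p ?F (\<lambda>E. (\<exists>u\<in>X. {u, s} \<in> E) \<noteq> (\<exists>u\<in>Y. {u, s} \<in> E))"
    unfolding expec_add[symmetric]
  proof (rule expec_mono[OF p])
    fix E
    have "(\<exists>u\<in>X. {u, s} \<in> E) \<noteq> (\<exists>u\<in>Y. {u, s} \<in> E) \<longleftrightarrow> (E \<inter> ?st X = {}) \<noteq> (E \<inter> ?st Y = {})"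
      by blast
    moreover have "E \<inter> ?st Y = {} \<Longrightarrow> E \<inter> ?st (Y - X) = {}" "E \<inter> ?st X = {} \<Longrightarrow> E \<inter> ?st (X - Y) = {}"
      by blast+
    ultimately show "of_bool (E \<inter> ?st X = {} \<and> E \<inter> ?st (Y - X) \<noteq> {}) + of_bool (E \<inter> ?st Y = {} \<and> E \<inter> ?st (X - Y) \<noteq> {})
        \<le> (of_bool ((\<exists>u\<in>X. {u, s} \<in> E) \<noteq> (\<exists>u\<in>Y. {u, s} \<in> E)) :: real)"
      by (cases "E \<inter> ?st X = {}"; cases "E \<inter> ?st Y = {}") simp_all
  qed
  finally show ?thesis .
qed

text \<open>Bounds by numbers \<open>a\<close>, \<open>b\<close>, \<open>w\<close> that do not
  depend on the triple; with them the conditional estimate is uniform, as \<open>pr_stopping\<close>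
  demands.\<close>

definition typical_exposure :: "nat \<Rightarrow> nat \<Rightarrow> nat \<Rightarrow> nat \<Rightarrow> nat set \<times> nat set \<times> nat set \<Rightarrow> bool" where
  "typical_exposure n a b w = (\<lambda>(U, X, Y). U \<subseteq> {1..n} \<and> X \<subseteq> {1..n} \<and> Y \<subseteq> {1..n} \<and> card X \<le> a \<and> card Y \<le> a \<and>
     b \<le> card (X - Y - U) \<and> b \<le> card (Y - X - U) \<and> card (X \<union> Y \<union> U) \<le> w)"

lemma pr_few_new_distinguished:
  fixes p \<epsilon> \<rho> :: real
  assumes p: "0 \<le> p" "p \<le> 1" and e: "0 < \<epsilon>" "\<epsilon> \<le> 1" and w: "w \<le> n"
    and \<rho>: "\<rho> = 2 * (1 - p) ^ a * (1 - (1 - p) ^ b)"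
  shows "pr p (vertex_pairs n) (\<lambda>E. typical_exposure n a b w (exposed E j x y) \<and>
      real (card (new_distinguished n (exposed E j x y) E)) \<le> (1 - \<epsilon>) * (\<rho> * (n - w)))
    \<le> exp (- \<epsilon>\<^sup>2 * (\<rho> * (n - w)) / 2)"
proof (rule pr_stopping[where A = "\<lambda>z. {e. e \<inter> fst z \<noteq> {}}"
      and P = "\<lambda>z E. real (card (new_distinguished n z E)) \<le> (1 - \<epsilon>) * (\<rho> * (n - w))"])
  fix E :: "nat set set" and z :: "nat set \<times> nat set \<times> nat set"
  obtain U X Y where z: "z = (U, X, Y)" by (cases z)
  show "exposed E j x y = z \<longleftrightarrow> exposed (E \<inter> {e. e \<inter> fst z \<noteq> {}}) j x y = z"
    by (rule exposed_eq_iff)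
  have "new_distinguished n z E = new_distinguished n z (E - {e. e \<inter> fst z \<noteq> {}})"
    by (auto simp: new_distinguished_def z)
  then show "(real (card (new_distinguished n z E)) \<le> (1 - \<epsilon>) * (\<rho> * (n - w))) \<longleftrightarrow>
      (real (card (new_distinguished n z (E - {e. e \<inter> fst z \<noteq> {}}))) \<le> (1 - \<epsilon>) * (\<rho> * (n - w)))"
    by simp
next
  fix z :: "nat set \<times> nat set \<times> nat set"
  assume typical: "typical_exposure n a b w z"
  obtain U X Y where z: "z = (U, X, Y)" by (cases z)
  let ?F = "vertex_pairs n" and ?T = "{1..n} - (X \<union> Y \<union> U)" and ?X = "X - U" and ?Y = "Y - U"
  let ?Q = "\<lambda>s E. (\<exists>u\<in>?X. {u, s} \<in> E) \<noteq> (\<exists>u\<in>?Y. {u, s} \<in> E)"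
  let ?m = "\<rho> * real (card ?T)"
  have \<rho>0: "0 \<le> \<rho>" unfolding \<rho> using p by (simp add: power_le_one)
  have XY: "X \<subseteq> {1..n}" "Y \<subseteq> {1..n}" "U \<subseteq> {1..n}" using typical by (simp_all add: typical_exposure_def z)
  then have fin: "finite X" "finite Y" "finite U" using finite_subset by blast+
  have "n - card (X \<union> Y \<union> U) \<le> card ?T"
    using diff_card_le_card_Diff[of "X \<union> Y \<union> U" "{1..n}"] fin by simp
  moreover have "card (X \<union> Y \<union> U) \<le> w" using typical by (simp add: typical_exposure_def z)
  ultimately have "n - w \<le> card ?T" by linarith
  then have m: "\<rho> * (n - w) \<le> ?m" using \<rho>0 by (intro mult_left_mono) auto
  have "pr p ?F (\<lambda>E. real (card (new_distinguished n z E)) \<le> (1 - \<epsilon>) * (\<rho> * (n - w)))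
      \<le> pr p ?F (\<lambda>E. real (card {s \<in> ?T. ?Q s E}) \<le> (1 - \<epsilon>) * ?m)"
  proof (rule pr_mono[OF p])
    fix E assume "real (card (new_distinguished n z E)) \<le> (1 - \<epsilon>) * (\<rho> * (n - w))"
    also have "\<dots> \<le> (1 - \<epsilon>) * ?m" by (rule mult_left_mono[OF m]) (use e in simp)
    finally show "real (card {s \<in> ?T. ?Q s E}) \<le> (1 - \<epsilon>) * ?m"
      by (simp add: new_distinguished_def z)
  qed
  also have "\<dots> \<le> exp (- \<epsilon>\<^sup>2 * ?m / 2)"
  \<comment> \<open>Each remaining vertex has its own star of uninspected edges into the two outer
    layers, and these stars are disjoint.\<close>
  proof (rule chernoff_lower[where K = "\<lambda>s. (\<lambda>u. {u, s}) ` (?X \<union> ?Y)" and b = \<rho>])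
    fix s assume s: "s \<in> ?T"
    show "(\<lambda>u. {u, s}) ` (?X \<union> ?Y) \<subseteq> ?F" using XY s by (intro star_subset) auto
    show "\<rho> \<le> pr p ?F (?Q s)"
      unfolding \<rho>
    proof (rule pr_adjacent_to_exactly_one[OF p])
      have "card ?X \<le> card X" "card ?Y \<le> card Y" using fin by (auto intro: card_mono)
      then show "card ?X \<le> a" "card ?Y \<le> a" using typical by (auto simp: typical_exposure_def z)
      have "?X - ?Y = X - Y - U" "?Y - ?X = Y - X - U" by auto
      then show "b \<le> card (?X - ?Y)" "b \<le> card (?Y - ?X)"
        using typical by (simp_all add: typical_exposure_def z)
    qed (use XY s in auto)
  next
    show "disjoint_family_on (\<lambda>s. (\<lambda>u. {u, s}) ` (?X \<union> ?Y)) ?T" by (rule disjoint_stars) auto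
  qed (use p e \<rho>0 in auto)
  also have "\<dots> \<le> exp (- \<epsilon>\<^sup>2 * (\<rho> * (n - w)) / 2)"
  proof -
    have "\<epsilon>\<^sup>2 * (\<rho> * (n - w)) \<le> \<epsilon>\<^sup>2 * ?m" by (rule mult_left_mono[OF m]) simp
    then show ?thesis by (simp only: exp_le_cancel_iff mult_minus_left)
  qed
  finally show "pr p ?F (\<lambda>E. real (card (new_distinguished n z E)) \<le> (1 - \<epsilon>) * (\<rho> * (n - w)))
      \<le> exp (- \<epsilon>\<^sup>2 * (\<rho> * (n - w)) / 2)" .
qed (use p in auto)

text \<open>The closed neighbourhood of \<open>U\<close> is \<open>X \<union> Y\<close>, so a vertex
  outside \<open>X \<union> Y\<close> has no neighbour in \<open>U\<close>, and leaving
  \<open>U\<close> out does not change which spheres it touches.\<close>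

lemma new_distinguished_exposed:
  assumes "E \<subseteq> vertex_pairs n" "X = nbhd_ball E (Suc j) {x}" "Y = nbhd_ball E (Suc j) {y}"
  shows "new_distinguished n (exposed E j x y) E
    = {s \<in> {1..n} - (X \<union> Y). (s \<in> closed_nbhd E X) \<noteq> (s \<in> closed_nbhd E Y)}"
proof -
  define U where "U = nbhd_ball E j {x, y}"
  have XY: "closed_nbhd E U = X \<union> Y"
    using nbhd_ball_Un[where E = E and j = "Suc j" and S = "{x}" and T = "{y}"] by (simp add: assms(2,3) U_def insert_commute)
  then have "U \<subseteq> X \<union> Y" using subset_closed_nbhd[of U E] by (simp only: XY)
  then have eqU: "X \<union> Y \<union> U = X \<union> Y" by blast
  have no_edge: "{u, s} \<notin> E" if "u \<in> U" "s \<notin> X \<union> Y" for u s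
  proof -
    have "s \<notin> closed_nbhd E U" using that XY by simp
    then show ?thesis using that by (auto simp: closed_nbhd_def)
  qed
  have key: "(\<exists>u\<in>R - U. {u, s} \<in> E) \<longleftrightarrow> s \<in> closed_nbhd E R" if "s \<notin> X \<union> Y" "R = X \<or> R = Y" for R s
  proof -
    have "s \<notin> R" using that by blast
    then have "s \<in> closed_nbhd E R \<longleftrightarrow> (\<exists>u\<in>R. {u, s} \<in> E)" by (simp add: closed_nbhd_def)
    also have "\<dots> \<longleftrightarrow> (\<exists>u\<in>R - U. {u, s} \<in> E)"
      using no_edge that(1) by blast
    finally show ?thesis by simp
  qed
  show ?thesis
    unfolding new_distinguished_def exposed_def prod.case assms(2,3)[symmetric] U_def[symmetric] eqU
  proof (rule Collect_cong)
    fix s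
    show "s \<in> {1..n} - (X \<union> Y) \<and> (\<exists>u\<in>X - U. {u, s} \<in> E) \<noteq> (\<exists>u\<in>Y - U. {u, s} \<in> E) \<longleftrightarrow>
        s \<in> {1..n} - (X \<union> Y) \<and> (s \<in> closed_nbhd E X) \<noteq> (s \<in> closed_nbhd E Y)"
      using key[of s X] key[of s Y] by blast
  qed
qed

lemma localization_number_le_of_regular_expander:
  fixes d \<epsilon> R :: real
  assumes E: "E \<subseteq> vertex_pairs n" and n: "1 \<le> n" and reg: "regular_expander n d \<epsilon> s0 E"
    and d: "1 \<le> d" "\<epsilon> \<le> 1" and R: "0 < R" "R \<le> n"
    and dist: "\<And>x y. x \<in> {1..n} \<Longrightarrow> y \<in> {1..n} \<Longrightarrow> x \<noteq> y \<Longrightarrow>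
      R \<le> real (card {s \<in> {1..n}. graph_dist E s x \<noteq> graph_dist E s y})"
  shows "real (localization_number {1..n} E) \<le> (2 * ln d + 4) * (n / R)"
proof -
  \<comment> \<open>With D = 2 d the requirement becomes 8 d^2 (1 - R/n)^K < 1, and the 3 suffices
    because 8 exp (- 3) is at most 1. Rounding adds 1, at most n/R, which turns the 3 into the 4 of
    the conclusion.\<close>
  define z where "z = (2 * ln d + 3) * (n / R)"
  define K where "K = nat \<lfloor>z\<rfloor> + 1"
  have z0: "0 \<le> z" unfolding z_def using d R by (intro mult_nonneg_nonneg) auto
  then have K: "z < real K" "real K \<le> z + 1" by (simp_all add: K_def) linarith+
  have "localization_number {1..n} E \<le> K"
  proof (rule localization_number_le[where D = "2 * d" and R = R])
    show "\<Union>E \<subseteq> {1..n}" by (rule vertex_pairs_subset[OF E])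
    fix v assume "v \<in> {1..n}"
    then have "real (card (closed_nbhd E {v})) \<le> (1 + \<epsilon>) * d"
      using reg unfolding regular_expander_def by blast
    also have "\<dots> \<le> 2 * d" using d by (intro mult_right_mono) auto
    finally show "real (card (closed_nbhd E {v})) \<le> 2 * d" .
  next
    have "2 * ln d + 3 < R / n * K"
      using K(1) R n unfolding z_def by (simp add: field_simps)
    have "(1 - R / n) ^ K \<le> exp (- (R / n)) ^ K"
      using R n exp_ge_add_one_self[of "- (R / n)"] by (intro power_mono) (auto simp: field_simps)
    also have "\<dots> = exp (- (R / n * K))" by (simp add: exp_of_nat_mult[symmetric] mult.commute)
    also have "\<dots> < exp (- (2 * ln d + 3))" using \<open>2 * ln d + 3 < R / n * K\<close> by simp
    also have "\<dots> = exp (- 3) / exp (2 * ln d)" by (simp add: exp_diff[symmetric])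
    also have "\<dots> = exp (- 3) / d\<^sup>2" using d by (simp add: exp_double)
    finally have "2 * (2 * d)\<^sup>2 * (1 - R / n) ^ K < 2 * (2 * d)\<^sup>2 * (exp (- 3) / d\<^sup>2)"
      using d by (intro mult_strict_left_mono) auto
    also have "\<dots> = 8 * exp (- 3)" using d by (simp add: power2_eq_square)
    also have "\<dots> \<le> 1"
    proof -
      have "2 ^ 3 \<le> (exp 1 :: real) ^ 3" using exp_ge_add_one_self[of 1] by (intro power_mono) auto
      then have "8 \<le> exp (3 :: real)" by (simp add: exp_of_nat_mult[symmetric])
      then show ?thesis by (simp add: exp_minus field_simps)
    qed
    finally show "2 * (2 * d)\<^sup>2 * (1 - R / real (card {1..n})) ^ K < 1" by simp
  qed (use n R dist in auto)
  then have "real (localization_number {1..n} E) \<le> z + 1" using K(2) by linarith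
  also have "\<dots> \<le> z + n / R" using R by simp
  finally show ?thesis by (simp add: z_def algebra_simps add_divide_distrib)
qed

section \<open>Balls around two vertices of a regular expander\<close>

context
  fixes p d \<epsilon> lo hi s0 :: real and n j :: nat
  assumes p: "0 \<le> p" "p \<le> 1" and d: "d = p * n" "1 \<le> d" and e: "0 < \<epsilon>" "\<epsilon> \<le> 1"
    and lo: "lo = ((1 - \<epsilon>) * d) ^ Suc j" and hi: "hi = ((1 + \<epsilon>) * d) ^ Suc j"
    and s0: "s0 = 2 * ((1 + \<epsilon>) * d) ^ j"
begin

lemma D_ge_1: "1 \<le> (1 + \<epsilon>) * d"
  using d e mult_mono[of 1 "1 + \<epsilon>" 1 d] by simp

text \<open>The lower bound on the union is expansion started from \<open>{x, y}\<close>; the factor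
  2 in \<open>s0\<close> and in \<open>2 * lo\<close> is the size of this set.\<close>

lemma ball_sizes:
  assumes E: "E \<subseteq> vertex_pairs n" and reg: "regular_expander n d \<epsilon> s0 E"
    and xy: "x \<in> {1..n}" "y \<in> {1..n}" "x \<noteq> y"
    and X: "X = nbhd_ball E (Suc j) {x}" and Y: "Y = nbhd_ball E (Suc j) {y}" and U: "U = nbhd_ball E j {x, y}"
  shows "U \<subseteq> X \<union> Y" "X \<subseteq> {1..n}" "Y \<subseteq> {1..n}" "card X \<le> hi" "card Y \<le> hi" "card U \<le> s0" "2 * lo \<le> card (X \<union> Y)"
proof -
  have d0: "0 \<le> d" "0 \<le> \<epsilon>" using d e by auto
  note balls = regular_expander_balls[OF E reg d0 e(2)]
  have XY: "X \<union> Y = nbhd_ball E (Suc j) {x, y}"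
    using nbhd_ball_Un[where E = E and j = "Suc j" and S = "{x}" and T = "{y}"]
    by (simp add: X Y insert_commute)
  show "U \<subseteq> X \<union> Y" unfolding XY U by (rule nbhd_ball_mono) simp
  show "X \<subseteq> {1..n}" "Y \<subseteq> {1..n}"
    unfolding X Y using xy by (intro nbhd_ball_subset vertex_pairs_subset[OF E]; simp)+
  show "card X \<le> hi" "card Y \<le> hi"
    using balls(1)[of "{x}" "Suc j"] balls(1)[of "{y}" "Suc j"] xy unfolding X Y hi by simp_all
  show "card U \<le> s0"
    using balls(1)[of "{x, y}" j] xy unfolding U s0 by (simp add: mult.commute)
  show "2 * lo \<le> card (X \<union> Y)"
    using balls(2)[of "{x, y}" j "Suc j"] xy D_ge_1 unfolding XY lo s0 by (simp add: mult.commute)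
qed

lemma distinguished_ge_balls:
  assumes E: "E \<subseteq> vertex_pairs n" and reg: "regular_expander n d \<epsilon> s0 E"
    and xy: "x \<in> {1..n}" "y \<in> {1..n}" "x \<noteq> y"
  shows "4 * lo - 2 * hi + card (new_distinguished n (exposed E j x y) E)
    \<le> card {s \<in> {1..n}. graph_dist E s x \<noteq> graph_dist E s y}"
proof -
  note sizes = ball_sizes[OF E reg xy refl refl refl]
  have "2 * real (card (nbhd_ball E (Suc j) {x} \<union> nbhd_ball E (Suc j) {y}))
      - card (nbhd_ball E (Suc j) {x}) - card (nbhd_ball E (Suc j) {y})
      + card (new_distinguished n (exposed E j x y) E)
    \<le> card {s \<in> {1..n}. graph_dist E s x \<noteq> graph_dist E s y}"
    unfolding new_distinguished_exposed[OF E refl refl]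
    by (rule card_distinguished_ge[OF _ vertex_pairs_subset[OF E] xy(1,2) refl refl]) simp
  then show ?thesis using sizes(4,5,7) by linarith
qed

lemma typical_exposure_of_regular_expander:
  assumes E: "E \<subseteq> vertex_pairs n" and reg: "regular_expander n d \<epsilon> s0 E"
    and xy: "x \<in> {1..n}" "y \<in> {1..n}" "x \<noteq> y"
    and a: "a = nat \<lfloor>hi\<rfloor>" and w: "w = nat \<lfloor>2 * hi\<rfloor>" and b: "b \<le> 2 * lo - hi - s0"
  shows "typical_exposure n a b w (exposed E j x y)"
proof -
  define X Y U where "X = nbhd_ball E (Suc j) {x}" and "Y = nbhd_ball E (Suc j) {y}" and "U = nbhd_ball E j {x, y}"
  note sizes = ball_sizes[OF E reg xy this]
  have fin: "finite X" "finite Y" "finite U" using sizes(1-3) finite_subset by (auto intro: finite_subset)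
  have XY: "X \<union> Y \<union> U = X \<union> Y" using sizes(1) by blast
  \<comment> \<open>So what one ball has beyond the other and beyond \<open>U\<close> numbers at
    least \<open>2 * lo - hi - s0\<close>.\<close>
  have "card (X \<union> Y) \<le> card (X - Y - U) + card Y + card U" "card (X \<union> Y) \<le> card (Y - X - U) + card X + card U"
  proof -
    have "card (X \<union> Y) \<le> card ((X - Y - U) \<union> Y \<union> U)" "card (X \<union> Y) \<le> card ((Y - X - U) \<union> X \<union> U)"
      using fin by (intro card_mono; auto)+
    then show "card (X \<union> Y) \<le> card (X - Y - U) + card Y + card U" "card (X \<union> Y) \<le> card (Y - X - U) + card X + card U"
      using card_Un_le[of "X - Y - U" Y] card_Un_le[of "X - Y - U \<union> Y" U]
        card_Un_le[of "Y - X - U" X] card_Un_le[of "Y - X - U \<union> X" U] by linarith+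
  qed
  then have "real b \<le> card (X - Y - U)" "real b \<le> card (Y - X - U)"
    using sizes(4-7) b by linarith+
  moreover have "card X \<le> a" "card Y \<le> a" "card (X \<union> Y) \<le> w"
    using sizes(4,5) card_Un_le[of X Y] unfolding a w by (simp_all add: le_nat_floor)
  moreover have "U \<subseteq> {1..n}" using sizes by blast
  ultimately show ?thesis
    using sizes(2,3) XY unfolding typical_exposure_def exposed_def X_def[symmetric] Y_def[symmetric] U_def[symmetric]
    by simp
qed

lemma pr_few_distinguished:
  fixes \<eta> \<rho> :: real
  assumes \<eta>: "0 < \<eta>" "\<eta> \<le> 1" and a: "a = nat \<lfloor>hi\<rfloor>" and w: "w = nat \<lfloor>2 * hi\<rfloor>" "w \<le> n"
    and b: "b \<le> 2 * lo - hi - s0" and \<rho>: "\<rho> = 2 * (1 - p) ^ a * (1 - (1 - p) ^ b)"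
  shows "pr p (vertex_pairs n) (\<lambda>E. regular_expander n d \<epsilon> s0 E \<and>
      (\<exists>x\<in>{1..n}. \<exists>y\<in>{1..n}. x \<noteq> y \<and> real (card {s \<in> {1..n}. graph_dist E s x \<noteq> graph_dist E s y})
        < 4 * lo - 2 * hi + (1 - \<eta>) * (\<rho> * real (n - w))))
    \<le> (real n)\<^sup>2 * exp (- \<eta>\<^sup>2 * (\<rho> * real (n - w)) / 2)"
proof -
  let ?F = "vertex_pairs n" and ?V = "{1..n}"
  let ?bad = "\<lambda>(x, y) E. typical_exposure n a b w (exposed E j x y) \<and>
      real (card (new_distinguished n (exposed E j x y) E)) \<le> (1 - \<eta>) * (\<rho> * real (n - w))"
  have "pr p ?F (\<lambda>E. regular_expander n d \<epsilon> s0 E \<and>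
      (\<exists>x\<in>?V. \<exists>y\<in>?V. x \<noteq> y \<and> real (card {s \<in> ?V. graph_dist E s x \<noteq> graph_dist E s y})
        < 4 * lo - 2 * hi + (1 - \<eta>) * (\<rho> * real (n - w))))
      \<le> pr p ?F (\<lambda>E. \<exists>z\<in>?V \<times> ?V. ?bad z E)"
  proof (rule pr_mono[OF p])
    fix E assume E: "E \<subseteq> ?F" and "regular_expander n d \<epsilon> s0 E \<and>
      (\<exists>x\<in>?V. \<exists>y\<in>?V. x \<noteq> y \<and> real (card {s \<in> ?V. graph_dist E s x \<noteq> graph_dist E s y})
        < 4 * lo - 2 * hi + (1 - \<eta>) * (\<rho> * real (n - w)))"
    then obtain x y where reg: "regular_expander n d \<epsilon> s0 E" and xy: "x \<in> ?V" "y \<in> ?V" "x \<noteq> y"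
      and less: "real (card {s \<in> ?V. graph_dist E s x \<noteq> graph_dist E s y})
        < 4 * lo - 2 * hi + (1 - \<eta>) * (\<rho> * real (n - w))" by blast
    have "real (card (new_distinguished n (exposed E j x y) E)) \<le> (1 - \<eta>) * (\<rho> * real (n - w))"
      using distinguished_ge_balls[OF E reg xy] less by linarith
    then have "?bad (x, y) E"
      using typical_exposure_of_regular_expander[OF E reg xy a w(1) b] by (simp only: prod.case)
    then show "\<exists>z\<in>?V \<times> ?V. ?bad z E" using xy by blast
  qed
  also have "\<dots> \<le> (\<Sum>z\<in>?V \<times> ?V. pr p ?F (?bad z))" by (rule pr_union_bound[OF p]) simp
  also have "\<dots> \<le> (\<Sum>z\<in>?V \<times> ?V. exp (- \<eta>\<^sup>2 * (\<rho> * real (n - w)) / 2))"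
  proof (rule sum_mono)
    fix z :: "nat \<times> nat"
    show "pr p ?F (?bad z) \<le> exp (- \<eta>\<^sup>2 * (\<rho> * real (n - w)) / 2)"
      by (cases z) (simp only: prod.case pr_few_new_distinguished[OF p \<eta> w(2) \<rho>])
  qed
  also have "\<dots> = (real n)\<^sup>2 * exp (- \<eta>\<^sup>2 * (\<rho> * real (n - w)) / 2)"
    by (simp add: card_cartesian_product power2_eq_square)
  finally show ?thesis .
qed

end

section \<open>Estimates for a fixed number of vertices\<close>

lemma exp_le_1_plus_double:
  fixes x :: real
  assumes "0 \<le> x" "x \<le> 1"
  shows "exp x \<le> 1 + 2 * x"
proof -
  have "exp x \<le> 1 + x + x\<^sup>2" using assms by (rule exp_bound)
  also have "x\<^sup>2 \<le> x" using assms by (simp add: power2_eq_square mult_left_le)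
  finally show ?thesis by simp
qed

lemma power_1_plus_le:
  fixes \<delta> :: real
  assumes "0 \<le> \<delta>" "real i * \<delta> \<le> 1" "m \<le> i"
  shows "(1 + \<delta>) ^ m \<le> 1 + 2 * (i * \<delta>)"
proof -
  have "(1 + \<delta>) ^ m \<le> (1 + \<delta>) ^ i" using assms by (intro power_increasing) auto
  also have "\<dots> \<le> exp \<delta> ^ i" using assms by (intro power_mono) auto
  also have "\<dots> = exp (i * \<delta>)" by (simp add: exp_of_nat_mult)
  also have "\<dots> \<le> 1 + 2 * (i * \<delta>)" using assms by (intro exp_le_1_plus_double) auto
  finally show ?thesis .
qed

text \<open>Concavity of 1 - exp (- x). It turns a relative error in the number of possible
  neighbours into the same relative error in the probability of being hit, for large
  \<open>c\<close> as well as for bounded \<open>c\<close>.\<close>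

lemma one_minus_exp_ge:
  fixes c \<theta> :: real
  assumes "0 \<le> \<theta>" "\<theta> \<le> 1"
  shows "\<theta> * (1 - exp (- c)) \<le> 1 - exp (- (\<theta> * c))"
proof -
  have "exp ((1 - \<theta>) *\<^sub>R 0 + \<theta> *\<^sub>R (- c)) \<le> (1 - \<theta>) * exp 0 + \<theta> * exp (- c)"
    using assms by (intro convex_onD[OF exp_convex]) auto
  then show ?thesis by (simp add: algebra_simps)
qed

text \<open>Here \<open>\<kappa>\<close> is the single error parameter. The separate losses below
  are all multiples of it and add up to 28 kappa, and the bound 1/56 keeps 1 - 28 kappa at least
  1/2.\<close>

context
  fixes p d \<delta> lo hi s0 c \<kappa> L :: real and n i j :: nat
  assumes p: "0 \<le> p" "p \<le> 1" and n: "0 < n" and dp: "d = p * n" and d: "1 \<le> d"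
    and i: "i = Suc (Suc j)" and c: "c = d ^ i / n" "c \<le> 3 * L"
    and L: "L = ln n" "1 \<le> L" "L / d \<le> \<kappa>"
    and \<kappa>: "0 < \<kappa>" "\<kappa> \<le> 1 / 56"
    and \<delta>: "\<delta> = 8 * sqrt (L / d)" "\<delta> \<le> 1" "i * \<delta> \<le> \<kappa>"
    and lo: "lo = ((1 - \<delta>) * d) ^ Suc j" and hi: "hi = ((1 + \<delta>) * d) ^ Suc j"
    and s0: "s0 = 2 * ((1 + \<delta>) * d) ^ j"
begin

lemma delta_pos: "0 < \<delta>"
  unfolding \<delta>(1) using L d by simp

lemma c_nonneg: "0 \<le> c"
  unfolding c using d by simp

text \<open>So \<open>c\<close> is the expected number of neighbours of a vertex among d^(i-1)
  others, and exp (- c) approximates the probability of having none there.\<close>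

lemma p_mult_power: "p * d ^ Suc j = c"
  using n unfolding c i dp by (simp add: field_simps)

lemma c_div_d_le: "c / d \<le> 3 * \<kappa>"
proof -
  have "c / d \<le> 3 * (L / d)" using c(2) d by (simp add: field_simps)
  then show ?thesis using L by linarith
qed

lemma ball_size_le: "d ^ Suc j \<le> 3 * \<kappa> * n"
proof -
  have "d ^ Suc j = c / d * n" using d n by (simp add: c i)
  also have "\<dots> \<le> 3 * \<kappa> * n" by (rule mult_right_mono[OF c_div_d_le]) simp
  finally show ?thesis .
qed

lemma inverse_d_le: "1 / d \<le> \<kappa>" "1 / d ^ Suc j \<le> \<kappa>"
proof -
  have "1 / d \<le> L / d" using L d by (intro divide_right_mono) auto
  then show "1 / d \<le> \<kappa>" using L by linarith
  moreover have "1 / d ^ Suc j \<le> 1 / d" using d by (intro divide_left_mono) (auto simp: self_le_power)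
  ultimately show "1 / d ^ Suc j \<le> \<kappa>" by linarith
qed

lemma lo_ge: "(1 - \<kappa>) * d ^ Suc j \<le> lo"
proof -
  have "1 - \<kappa> \<le> 1 + real (Suc j) * (- \<delta>)"
  proof -
    have "real (Suc j) * \<delta> \<le> i * \<delta>" using delta_pos i by (intro mult_right_mono) auto
    then show ?thesis using \<delta> by simp
  qed
  also have "\<dots> \<le> (1 + - \<delta>) ^ Suc j" using \<delta> by (intro Bernoulli_inequality) auto
  finally have "(1 - \<kappa>) * d ^ Suc j \<le> (1 + - \<delta>) ^ Suc j * d ^ Suc j" using d by (intro mult_right_mono) auto
  then show ?thesis unfolding lo power_mult_distrib by simp
qed

lemma hi_le: "hi \<le> (1 + 2 * (i * \<delta>)) * d ^ Suc j" "hi \<le> (1 + 2 * \<kappa>) * d ^ Suc j"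
proof -
  have "(1 + \<delta>) ^ Suc j \<le> 1 + 2 * (i * \<delta>)"
    using delta_pos \<delta> \<kappa> i by (intro power_1_plus_le) auto
  then have "(1 + \<delta>) ^ Suc j * d ^ Suc j \<le> (1 + 2 * (i * \<delta>)) * d ^ Suc j"
    using d by (intro mult_right_mono) auto
  then show "hi \<le> (1 + 2 * (i * \<delta>)) * d ^ Suc j" unfolding hi power_mult_distrib .
  also have "\<dots> \<le> (1 + 2 * \<kappa>) * d ^ Suc j" using \<delta> d by (intro mult_right_mono) auto
  finally show "hi \<le> (1 + 2 * \<kappa>) * d ^ Suc j" .
qed

lemma s0_le: "s0 \<le> 4 * (d ^ Suc j / d)"
proof -
  have "(1 + \<delta>) ^ j \<le> 1 + 2 * (i * \<delta>)"
    using delta_pos \<delta> \<kappa> i by (intro power_1_plus_le) auto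
  also have "\<dots> \<le> 2" using \<delta> \<kappa> by simp
  finally have "(1 + \<delta>) ^ j * d ^ j \<le> 2 * d ^ j" using d by (intro mult_right_mono) auto
  then show ?thesis using d by (simp add: s0 power_mult_distrib)
qed

lemma balls_difference_ge: "2 * (1 - 28 * \<kappa>) * d ^ Suc j \<le> 4 * lo - 2 * hi"
proof -
  \<comment> \<open>The bounds on \<open>lo\<close> and \<open>hi\<close> give 2 - 8 kappa; it is
    weakened to the factor that the spheres will need, so that both contributions can be
    added.\<close>
  have "0 \<le> \<kappa> * d ^ Suc j" using \<kappa> d by simp
  then show ?thesis using lo_ge hi_le(2) by (simp add: algebra_simps)
qed

lemma pr_not_regular_expander_le:
  "pr p (vertex_pairs n) (\<lambda>E. \<not> regular_expander n d \<delta> s0 E) \<le> 3 / n ^ 3"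
proof -
  \<comment> \<open>In terms of \<open>x\<close>, the condition on \<open>p * s0\<close> reduces to
    12 x^2 being at most 2 x, which is where x at most 1/6 is used.\<close>
  define x where "x = sqrt (L / d)"
  have x2: "x\<^sup>2 = L / d" using L d by (simp add: x_def)
  have x0: "0 < x" using L d by (simp add: x_def)
  have x6: "x \<le> 1 / 6"
  proof -
    have "x\<^sup>2 \<le> (1 / 6)\<^sup>2" using x2 L \<kappa> by (simp add: power2_eq_square)
    then show ?thesis by (rule power2_le_imp_le) simp
  qed
  have ps0: "p * s0 \<le> \<delta> / 4"
  proof -
    have "p * s0 \<le> p * (4 * (d ^ Suc j / d))" using s0_le p by (intro mult_left_mono) auto
    also have "\<dots> = 4 * (c / d)" unfolding p_mult_power[symmetric] by simp
    also have "\<dots> \<le> 12 * (L / d)" using c(2) d by (simp add: field_simps)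
    also have "\<dots> = 12 * x * x" using x2 by (simp add: power2_eq_square)
    also have "\<dots> \<le> 2 * x" using x6 x0 by (intro mult_right_mono) auto
    finally show ?thesis by (simp add: \<delta>(1) x_def)
  qed
  have s0_nonneg: "0 \<le> s0" using d delta_pos by (simp add: s0)
  have e4: "exp (- \<delta>\<^sup>2 * d / 16) = 1 / real n ^ 4"
  proof -
    have "\<delta>\<^sup>2 * d = 64 * L" using L d unfolding \<delta>(1) by (simp add: power_mult_distrib)
    then have "exp (- \<delta>\<^sup>2 * d / 16) = exp (- (4 * L))" by simp
    also have "\<dots> = 1 / exp (real 4 * L)" by (simp add: exp_minus divide_inverse)
    also have "exp (real 4 * L) = real n ^ 4" unfolding exp_of_nat_mult L using n by simp
    finally show ?thesis .
  qed
  have "pr p (vertex_pairs n) (\<lambda>E. \<not> regular_expander n d \<delta> s0 E) \<le> 3 * (n * (1 / real n ^ 4))"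
  proof (rule pr_not_regular_expander[OF p dp delta_pos \<delta>(2) _ ps0])
    have "2 \<le> 8 * L" using L by simp
    also have "\<dots> = 8 * (x\<^sup>2 * d)" using d by (simp add: x2)
    also have "\<dots> \<le> 8 * (x * d)" using x6 x0 d by (simp add: power2_eq_square)
    finally show "2 \<le> \<delta> * d" by (simp add: \<delta>(1) x_def)
    have "s0 * 1 \<le> s0 * (p * n)" using d[unfolded dp] s0_nonneg by (rule mult_left_mono)
    also have "\<dots> = p * s0 * n" by simp
    also have "\<dots> \<le> \<delta> / 4 * n" by (intro mult_right_mono ps0) simp
    finally show "s0 \<le> \<delta> / 4 * n" by simp
    have "1 \<le> real n ^ 3" using n by (intro one_le_power) auto
    then show "n * (1 / real n ^ 4) \<le> 1" using n by (simp add: field_simps power_numeral_reduce)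
  qed (use e4 in simp)
  also have "\<dots> = 3 / n ^ 3" using n by (simp add: field_simps power_numeral_reduce)
  finally show ?thesis .
qed

text \<open>The losses are 6 kappa for missing a ball (\<open>a\<close>), 9 kappa for meeting the
  difference (\<open>b\<close>), 12 kappa for the vertices already seen (\<open>w\<close>) and kappa
  for the deviation. The last hypothesis makes the failure probability of one pair at most n^(-3),
  against n^2 pairs.\<close>

lemma pr_few_distinguished_le:
  assumes cid: "c * (i * \<delta>) \<le> \<kappa>" and cp: "c * p \<le> \<kappa>" "p \<le> 1 / 2"
    and large: "12 * L / \<kappa>\<^sup>2 \<le> n * (exp (- c) * (1 - exp (- c)))"
  shows "pr p (vertex_pairs n) (\<lambda>E. regular_expander n d \<delta> s0 E \<and>
      (\<exists>x\<in>{1..n}. \<exists>y\<in>{1..n}. x \<noteq> y \<and> real (card {s \<in> {1..n}. graph_dist E s x \<noteq> graph_dist E s y})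
        < 2 * (1 - 28 * \<kappa>) * (d ^ Suc j + n * (exp (- c) * (1 - exp (- c)))))) \<le> 1 / n"
proof -
  let ?q = "exp (- c) * (1 - exp (- c))"
  have q0: "0 \<le> ?q" using c_nonneg by simp
  define a w b where "a = nat \<lfloor>hi\<rfloor>" and "w = nat \<lfloor>2 * hi\<rfloor>" and "b = nat \<lfloor>2 * lo - hi - s0\<rfloor>"
  define \<rho> where "\<rho> = 2 * (1 - p) ^ a * (1 - (1 - p) ^ b)"
  have hi0: "0 \<le> hi" using d delta_pos by (simp add: hi)
  \<comment> \<open>In units of d^(i-1): 2 (1 - kappa) - (1 + 2 kappa) - 4 kappa - kappa, where the
    last term pays for rounding \<open>b\<close> down.\<close>
  have b_ge: "(1 - 9 * \<kappa>) * d ^ Suc j \<le> 2 * lo - hi - s0 - 1"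
  proof -
    have "s0 \<le> 4 * (1 / d * d ^ Suc j)" using s0_le by simp
    also have "1 / d * d ^ Suc j \<le> \<kappa> * d ^ Suc j" using d by (intro mult_right_mono inverse_d_le) auto
    finally have "s0 \<le> 4 * (\<kappa> * d ^ Suc j)" by simp
    moreover have "1 \<le> \<kappa> * d ^ Suc j" using inverse_d_le(2) d by (simp add: field_simps)
    ultimately show ?thesis using lo_ge hi_le(2) by (simp add: algebra_simps)
  qed
  have "0 \<le> (1 - 9 * \<kappa>) * d ^ Suc j" using \<kappa> d by (intro mult_nonneg_nonneg) auto
  then have b: "real b \<le> 2 * lo - hi - s0" "(1 - 9 * \<kappa>) * d ^ Suc j \<le> b"
    using b_ge unfolding b_def by linarith+
  have w: "w \<le> n" "(1 - 12 * \<kappa>) * n \<le> real (n - w)"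
  proof -
    have "real w \<le> 2 * hi" using hi0 by (simp add: w_def)
    also have "\<dots> \<le> 2 * ((1 + 2 * \<kappa>) * d ^ Suc j)" using hi_le(2) by linarith
    also have "\<dots> \<le> 2 * (2 * d ^ Suc j)" using \<kappa> d by (intro mult_left_mono mult_right_mono) auto
    also have "\<dots> \<le> 12 * \<kappa> * n" using ball_size_le by linarith
    finally have w': "real w \<le> 12 * \<kappa> * n" .
    moreover have "12 * \<kappa> * n \<le> 1 * real n" using \<kappa> by (intro mult_right_mono) auto
    ultimately show "w \<le> n" by linarith
    then show "(1 - 12 * \<kappa>) * n \<le> real (n - w)" using w' by (simp add: of_nat_diff algebra_simps)
  qed
  \<comment> \<open>The error is in an exponent, so it must be small absolutely: the uncertain ball
    size contributes 4 kappa through \<open>cid\<close>, and replacing 1 - p by an exponential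
    contributes 2 kappa through \<open>cp\<close>.\<close>
  have a: "(1 - 6 * \<kappa>) * exp (- c) \<le> (1 - p) ^ a"
  proof -
    have "real a \<le> hi" using hi0 by (simp add: a_def)
    then have "p * a \<le> p * ((1 + 2 * (i * \<delta>)) * d ^ Suc j)"
      using hi_le(1) p by (intro mult_left_mono) auto
    also have "\<dots> = (1 + 2 * (i * \<delta>)) * c" by (subst p_mult_power[symmetric]) (simp add: mult_ac)
    finally have "p * a * (1 + 2 * p) \<le> (1 + 2 * (i * \<delta>)) * c * (1 + 2 * p)"
      using p by (intro mult_right_mono) auto
    also have "\<dots> = c + 2 * (c * (i * \<delta>)) * (1 + 2 * p) + 2 * (c * p)" by (simp add: algebra_simps)
    also have "\<dots> \<le> c + 2 * \<kappa> * 2 + 2 * \<kappa>"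
      using cid cp p \<kappa> by (intro add_mono mult_mono order_refl mult_left_mono) auto
    finally have pa: "p * a * (1 + 2 * p) \<le> c + 6 * \<kappa>" by simp
    have "(1 - 6 * \<kappa>) * exp (- c) \<le> exp (- (6 * \<kappa>)) * exp (- c)"
      using exp_ge_add_one_self[of "- (6 * \<kappa>)"] by (intro mult_right_mono) auto
    also have "\<dots> = exp (- (c + 6 * \<kappa>))" by (simp add: mult_exp_exp algebra_simps)
    also have "\<dots> \<le> exp (- (p * a * (1 + 2 * p)))" using pa by simp
    also have "\<dots> \<le> exp (a * ln (1 - p))"
    proof -
      have "- p - 2 * p\<^sup>2 \<le> ln (1 - p)" using p cp by (intro ln_one_minus_pos_lower_bound) auto
      then have "a * (- p - 2 * p\<^sup>2) \<le> a * ln (1 - p)" by (intro mult_left_mono) auto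
      then show ?thesis by (simp add: algebra_simps power2_eq_square)
    qed
    also have "\<dots> = (1 - p) ^ a" using p cp unfolding exp_of_nat_mult by simp
    finally show ?thesis .
  qed
  have b': "(1 - 9 * \<kappa>) * (1 - exp (- c)) \<le> 1 - (1 - p) ^ b"
  proof -
    have "(1 - 9 * \<kappa>) * (1 - exp (- c)) \<le> 1 - exp (- ((1 - 9 * \<kappa>) * c))"
      using \<kappa> by (intro one_minus_exp_ge) auto
    also have "\<dots> \<le> 1 - exp (- (p * b))"
    proof -
      have "p * ((1 - 9 * \<kappa>) * d ^ Suc j) \<le> p * b" using b(2) p by (intro mult_left_mono)
      also have "p * ((1 - 9 * \<kappa>) * d ^ Suc j) = (1 - 9 * \<kappa>) * c"
        by (subst p_mult_power[symmetric]) (simp add: mult_ac)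
      finally show ?thesis by simp
    qed
    also have "\<dots> \<le> 1 - (1 - p) ^ b"
    proof -
      have "(1 - p) ^ b \<le> exp (- p) ^ b" using p exp_ge_add_one_self[of "- p"] by (intro power_mono) auto
      then show ?thesis by (simp add: exp_of_nat_mult[symmetric] mult.commute)
    qed
    finally show ?thesis .
  qed
  have \<rho>n: "2 * (1 - 27 * \<kappa>) * (n * ?q) \<le> \<rho> * real (n - w)"
  proof -
    have "0 \<le> \<kappa> * \<kappa>" by simp
    then have "1 - 15 * \<kappa> \<le> (1 - 6 * \<kappa>) * (1 - 9 * \<kappa>)" by (simp add: algebra_simps)
    then have "(1 - 15 * \<kappa>) * (1 - 12 * \<kappa>) \<le> (1 - 6 * \<kappa>) * (1 - 9 * \<kappa>) * (1 - 12 * \<kappa>)"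
      using \<kappa> by (intro mult_right_mono) auto
    moreover have "1 - 27 * \<kappa> \<le> (1 - 15 * \<kappa>) * (1 - 12 * \<kappa>)"
      using \<open>0 \<le> \<kappa> * \<kappa>\<close> by (simp add: algebra_simps)
    ultimately have "(1 - 27 * \<kappa>) * (2 * (real n * ?q)) \<le> (1 - 6 * \<kappa>) * (1 - 9 * \<kappa>) * (1 - 12 * \<kappa>) * (2 * (real n * ?q))"
      using q0 by (intro mult_right_mono) auto
    also have "\<dots> = 2 * (((1 - 6 * \<kappa>) * exp (- c)) * ((1 - 9 * \<kappa>) * (1 - exp (- c)))) * ((1 - 12 * \<kappa>) * n)"
      by (simp add: algebra_simps)
    also have "\<dots> \<le> 2 * ((1 - p) ^ a * (1 - (1 - p) ^ b)) * real (n - w)"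
      using a b' w(2) p \<kappa> c_nonneg by (intro mult_mono mult_left_mono mult_nonneg_nonneg) (auto simp: power_le_one)
    finally show ?thesis by (simp only: \<rho>_def mult_ac)
  qed
  have nq: "0 \<le> n * ?q" using q0 by simp
  have "pr p (vertex_pairs n) (\<lambda>E. regular_expander n d \<delta> s0 E \<and>
      (\<exists>x\<in>{1..n}. \<exists>y\<in>{1..n}. x \<noteq> y \<and> real (card {s \<in> {1..n}. graph_dist E s x \<noteq> graph_dist E s y})
        < 2 * (1 - 28 * \<kappa>) * (d ^ Suc j + n * ?q)))
    \<le> pr p (vertex_pairs n) (\<lambda>E. regular_expander n d \<delta> s0 E \<and>
      (\<exists>x\<in>{1..n}. \<exists>y\<in>{1..n}. x \<noteq> y \<and> real (card {s \<in> {1..n}. graph_dist E s x \<noteq> graph_dist E s y})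
        < 4 * lo - 2 * hi + (1 - \<kappa>) * (\<rho> * real (n - w))))"
  proof (rule pr_mono[OF p])
    fix E
    have "2 * (1 - 28 * \<kappa>) * (n * ?q) \<le> (1 - \<kappa>) * (2 * (1 - 27 * \<kappa>) * (n * ?q))"
    proof -
      have "1 - 28 * \<kappa> \<le> (1 - \<kappa>) * (1 - 27 * \<kappa>)" by (simp add: algebra_simps)
      then have "(1 - 28 * \<kappa>) * (2 * (n * ?q)) \<le> (1 - \<kappa>) * (1 - 27 * \<kappa>) * (2 * (n * ?q))"
        using nq by (intro mult_right_mono) auto
      then show ?thesis by (simp only: mult_ac)
    qed
    also have "\<dots> \<le> (1 - \<kappa>) * (\<rho> * real (n - w))" using \<rho>n \<kappa> by (intro mult_left_mono) auto
    finally have "2 * (1 - 28 * \<kappa>) * (d ^ Suc j + n * ?q) \<le> 4 * lo - 2 * hi + (1 - \<kappa>) * (\<rho> * real (n - w))"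
      using balls_difference_ge by (simp only: distrib_left)
    then show "regular_expander n d \<delta> s0 E \<and>
      (\<exists>x\<in>{1..n}. \<exists>y\<in>{1..n}. x \<noteq> y \<and> real (card {s \<in> {1..n}. graph_dist E s x \<noteq> graph_dist E s y})
        < 2 * (1 - 28 * \<kappa>) * (d ^ Suc j + n * ?q)) \<Longrightarrow> regular_expander n d \<delta> s0 E \<and>
      (\<exists>x\<in>{1..n}. \<exists>y\<in>{1..n}. x \<noteq> y \<and> real (card {s \<in> {1..n}. graph_dist E s x \<noteq> graph_dist E s y})
        < 4 * lo - 2 * hi + (1 - \<kappa>) * (\<rho> * real (n - w)))"
      by (meson less_le_trans)
  qed
  also have "\<dots> \<le> (real n)\<^sup>2 * exp (- \<kappa>\<^sup>2 * (\<rho> * real (n - w)) / 2)"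
    using \<kappa> by (intro pr_few_distinguished[OF p dp d delta_pos \<delta>(2) lo hi s0 \<kappa>(1) _ a_def w_def w(1) b(1) \<rho>_def]) simp
  also have "\<dots> \<le> (real n)\<^sup>2 * exp (- (3 * L))"
  proof -
    have "6 * L \<le> \<kappa>\<^sup>2 * (n * ?q / 2)" using large \<kappa> by (simp add: field_simps)
    also have "\<dots> \<le> \<kappa>\<^sup>2 * (\<rho> * real (n - w))"
    proof -
      have "1 / 2 * (n * ?q) \<le> 2 * (1 - 27 * \<kappa>) * (n * ?q)" using \<kappa> nq by (intro mult_right_mono) auto
      then show ?thesis using \<rho>n by (intro mult_left_mono) auto
    qed
    finally have "3 * L \<le> \<kappa>\<^sup>2 * (\<rho> * real (n - w)) / 2" by simp
    then show ?thesis by (intro mult_left_mono) auto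
  qed
  also have "\<dots> = 1 / n"
  proof -
    have "exp (- (3 * L)) = 1 / exp (real 3 * L)" by (simp add: exp_minus divide_inverse)
    also have "exp (real 3 * L) = real n ^ 3" unfolding exp_of_nat_mult L using n by simp
    finally show ?thesis using n by (simp add: field_simps power_numeral_reduce)
  qed
  finally show ?thesis .
qed

end

section \<open>Asymptotics\<close>

lemma aasI:
  assumes p: "\<forall>n. 0 \<le> p n \<and> p n \<le> 1"
    and le: "\<forall>\<^sub>F n in sequentially. pr (p n) (vertex_pairs n) (\<lambda>E. \<not> P n E) \<le> g n"
    and g: "g \<longlonglongrightarrow> (0::real)"
  shows "aas p P"
  unfolding aas_def
proof (rule real_tendsto_sandwich[where h = "\<lambda>_. 1"])
  show "\<forall>\<^sub>F n in sequentially. 1 - g n \<le> measure_pmf.prob (binomial_random_graph n (p n)) {E. P n E}"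
    using le
  proof eventually_elim
    case (elim n)
    then show ?case using p by (simp add: prob_binomial_random_graph pr_not)
  qed
  show "(\<lambda>n. 1 - g n) \<longlonglongrightarrow> 1" using tendsto_diff[OF tendsto_const g, of 1] by simp
qed simp_all

lemma aas_mono:
  assumes p: "\<forall>n. 0 \<le> p n \<and> p n \<le> 1" and "aas p P"
    and "\<forall>\<^sub>F n in sequentially. \<forall>E. P n E \<longrightarrow> Q n E"
  shows "aas p Q"
  unfolding aas_def
proof (rule real_tendsto_sandwich[where h = "\<lambda>_. 1"])
  show "(\<lambda>n. measure_pmf.prob (binomial_random_graph n (p n)) {E. P n E}) \<longlonglongrightarrow> 1"
    using assms(2) by (simp add: aas_def)
  show "\<forall>\<^sub>F n in sequentially. measure_pmf.prob (binomial_random_graph n (p n)) {E. P n E}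
      \<le> measure_pmf.prob (binomial_random_graph n (p n)) {E. Q n E}"
    using assms(3) by eventually_elim (auto intro!: measure_pmf.finite_measure_mono)
qed simp_all

lemma aas_at_mostI:
  assumes "\<And>\<eta>. 0 < \<eta> \<Longrightarrow> aas p (\<lambda>n E. X n E \<le> (1 + \<eta>) * f n)"
  shows "aas_at_most p X f"
proof -
  define P where "P \<eta> n = measure_pmf.prob (binomial_random_graph n (p n)) {E. X n E \<le> (1 + \<eta>) * f n}" for \<eta> n
  define e where "e m = 1 / real (Suc m)" for m
  have e_pos: "0 < e m" for m by (simp add: e_def)
  have "\<exists>N. \<forall>n\<ge>N. 1 - e m < P (e m) n" for m
  proof -
    have "P (e m) \<longlonglongrightarrow> 1" using assms[of "e m"] unfolding aas_def P_def by (simp add: e_pos)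
    then have "\<forall>\<^sub>F n in sequentially. 1 - e m < P (e m) n"
      by (rule order_tendstoD) (simp add: e_pos)
    then show ?thesis by (simp add: eventually_sequentially)
  qed
  then obtain N where N: "\<And>m n. N m \<le> n \<Longrightarrow> 1 - e m < P (e m) n" by metis
  \<comment> \<open>Diagonal choice: the smallest slack \<open>e m\<close> whose threshold has been
    passed by \<open>n\<close>. The bound by \<open>n\<close> keeps the set finite, and 0 is a
    default that matters only below \<open>N 0\<close>.\<close>
  define k where "k n = Max (insert 0 {m \<in> {..n}. N m \<le> n})" for n
  have k_in: "k n \<in> insert 0 {m \<in> {..n}. N m \<le> n}" for n
    unfolding k_def by (rule Max_in) auto
  have "filterlim k at_top sequentially"
    unfolding filterlim_at_top
  proof
    fix m
    show "\<forall>\<^sub>F n in sequentially. m \<le> k n"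
      unfolding eventually_sequentially k_def
      by (intro exI[of _ "max m (N m)"] allI impI Max_ge) auto
  qed
  moreover have "e \<longlonglongrightarrow> 0" unfolding e_def by real_asymp
  ultimately have e_k: "(\<lambda>n. e (k n)) \<longlonglongrightarrow> 0" by (rule filterlim_compose[rotated])
  have "(\<lambda>n. P (e (k n)) n) \<longlonglongrightarrow> 1"
  proof (rule real_tendsto_sandwich[where h = "\<lambda>_. 1"])
    show "(\<lambda>n. 1 - e (k n)) \<longlonglongrightarrow> 1" using tendsto_diff[OF tendsto_const e_k, of 1] by simp
    have "1 - e (k n) \<le> P (e (k n)) n" if "N 0 \<le> n" for n
      using k_in[of n] N[of 0 n] N[of "k n" n] that by auto
    then show "\<forall>\<^sub>F n in sequentially. 1 - e (k n) \<le> P (e (k n)) n"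
      unfolding eventually_sequentially by blast
  qed (simp_all add: P_def)
  then show ?thesis
    unfolding aas_at_most_def aas_def P_def using e_k by (intro exI[of _ "\<lambda>n. e (k n)"]) simp
qed

lemma eventually_le_of_tendsto_0:
  fixes f :: "nat \<Rightarrow> real"
  shows "f \<longlonglongrightarrow> 0 \<Longrightarrow> 0 < \<kappa> \<Longrightarrow> \<forall>\<^sub>F n in sequentially. f n \<le> \<kappa>"
  using order_tendstoD(2)[of f 0 sequentially \<kappa>] by (auto elim: eventually_mono)

lemma eventually_le_scaled:
  fixes h g :: "nat \<Rightarrow> real"
  assumes "(\<lambda>n. h n / g n) \<longlonglongrightarrow> 1" "\<forall>\<^sub>F n in sequentially. 0 < g n" "0 < \<eta>"
  shows "\<forall>\<^sub>F n in sequentially. h n \<le> (1 + \<eta>) * g n"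
proof -
  have "\<forall>\<^sub>F n in sequentially. h n / g n < 1 + \<eta>"
    by (rule order_tendstoD(2)[OF assms(1)]) (use assms(3) in simp)
  with assms(2) show ?thesis by eventually_elim (simp add: field_simps)
qed

lemma eventually_ln_cube_le:
  assumes "(\<lambda>n. ln (real n) ^ 3) \<in> o(d)" "\<And>n. 0 \<le> d n"
  shows "\<forall>\<^sub>F n in sequentially. ln (real n) ^ 3 \<le> d n"
  using landau_o.smallD[OF assms(1) zero_less_one]
proof eventually_elim
  case (elim n)
  then have "\<bar>ln (real n) ^ 3\<bar> \<le> d n" using assms(2)[of n] by simp
  then show ?case by linarith
qed

text \<open>What the four cases have in common. The constant \<open>c0\<close> is A/2 in the first
  and 1 in the others.\<close>

locale sparse_regime =
  fixes p d c :: "nat \<Rightarrow> real" and i :: "nat \<Rightarrow> nat" and c0 :: real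
  assumes p_range: "\<forall>n. 0 \<le> p n \<and> p n \<le> 1"
    and d_eq: "\<forall>n. d n = p n * real n"
    and d_lower: "(\<lambda>n. ln (real n) ^ 3) \<in> o(d)"
    and d_upper: "d \<in> o(\<lambda>n. real n)"
    and c_eq: "\<forall>n. c n = d n ^ i n / real n"
    and c0: "0 < c0"
    and c_ge: "\<forall>\<^sub>F n in sequentially. c0 \<le> c n"
    and c_le: "\<forall>\<^sub>F n in sequentially. c n \<le> 3 * ln (real n)"
begin

text \<open>
  The constant makes exp (- \<delta>^2 d / 16) equal to n^(-4), which beats the union bound over vertices,
  and over vertex sets in the form n^(-4 |S|).
\<close>

definition \<delta> :: "nat \<Rightarrow> real" where
  "\<delta> n = 8 * sqrt (ln (real n) / d n)"

lemma ln_cube_div_d: "(\<lambda>n. ln (real n) ^ 3 / d n) \<longlonglongrightarrow> 0"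
  by (rule smalloD_tendsto[OF d_lower])

lemma ln_ge: "\<forall>\<^sub>F n in sequentially. K \<le> ln (real n)"
proof -
  have "filterlim (\<lambda>n. ln (real n)) at_top sequentially" by real_asymp
  then show ?thesis by (simp add: filterlim_at_top)
qed

lemma d_nonneg: "0 \<le> d n"
  using p_range d_eq by simp

lemma d_ge: "\<forall>\<^sub>F n in sequentially. ln (real n) ^ 3 \<le> d n"
  by (rule eventually_ln_cube_le[OF d_lower d_nonneg])

lemma d_at_top: "filterlim d at_top sequentially"
  by (rule filterlim_at_top_mono[OF _ d_ge]) real_asymp

text \<open>The product is 8 sqrt (log^3 n / d). As \<open>i\<close> and \<open>c * i\<close> will
  be at most 2 log n, the errors accumulated over all radii vanish.\<close>

lemma delta_ln: "(\<lambda>n. \<delta> n * ln (real n)) \<longlonglongrightarrow> 0"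
proof -
  have "(\<lambda>n. 8 * sqrt (ln (real n) ^ 3 / d n)) \<longlonglongrightarrow> 0"
    using tendsto_mult[OF tendsto_const tendsto_real_sqrt[OF ln_cube_div_d], of 8] by simp
  then show ?thesis
  proof (rule Lim_transform_eventually)
    show "\<forall>\<^sub>F n in sequentially. 8 * sqrt (ln (real n) ^ 3 / d n) = \<delta> n * ln (real n)"
      using ln_ge[of 0]
    proof eventually_elim
      case (elim n)
      have "ln (real n) ^ 3 / d n = (ln (real n) / d n) * (ln (real n))\<^sup>2"
        by (simp add: power3_eq_cube power2_eq_square)
      then show ?case using elim by (simp only: real_sqrt_mult) (simp add: \<delta>_def)
    qed
  qed
qed

lemma p_tendsto: "p \<longlonglongrightarrow> 0"
proof -
  have "(\<lambda>n. d n / real n) \<longlonglongrightarrow> 0" by (rule smalloD_tendsto[OF d_upper])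
  then show ?thesis
  proof (rule Lim_transform_eventually)
    show "\<forall>\<^sub>F n in sequentially. d n / real n = p n"
      using eventually_gt_at_top[of 0] by eventually_elim (simp add: d_eq)
  qed
qed

lemma i_ge: "\<forall>\<^sub>F n in sequentially. 2 \<le> i n"
proof -
  have "(\<lambda>n. 1 / real n) \<longlonglongrightarrow> 0" by real_asymp
  then have "\<forall>\<^sub>F n in sequentially. 1 / real n < c0" by (rule order_tendstoD(2)) (rule c0)
  moreover have "\<forall>\<^sub>F n in sequentially. p n < c0" by (rule order_tendstoD(2)[OF p_tendsto c0])
  ultimately show ?thesis
    using c_ge eventually_gt_at_top[of 0]
  proof eventually_elim
    case (elim n)
    have "i n \<noteq> 0"
    proof
      assume "i n = 0"
      then have "c n = 1 / real n" using c_eq by simp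
      then show False using elim by linarith
    qed
    moreover have "i n \<noteq> 1"
    proof
      assume "i n = 1"
      then have "c n = p n" using c_eq d_eq elim by simp
      then show False using elim by linarith
    qed
    ultimately show ?case by linarith
  qed
qed

text \<open>From i at least 2: d^2 is at most d^i = c n. So d is at most of order sqrt (n log n),
  which makes c p small and n/d much larger than log n.\<close>

lemma d_square_le: "\<forall>\<^sub>F n in sequentially. (d n)\<^sup>2 \<le> 3 * real n * ln (real n)"
  using i_ge d_ge ln_ge[of 1] c_le eventually_gt_at_top[of 0]
proof eventually_elim
  case (elim n)
  have "1 \<le> ln (real n) ^ 3" using elim by simp
  then have "1 \<le> d n" using elim by linarith
  then have "(d n)\<^sup>2 \<le> d n ^ i n" using elim by (intro power_increasing) auto
  also have "\<dots> = c n * real n" using c_eq elim by simp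
  also have "\<dots> \<le> 3 * ln (real n) * real n" using elim by (intro mult_right_mono) auto
  finally show ?case by (simp add: mult_ac)
qed

lemma d_le: "\<forall>\<^sub>F n in sequentially. d n \<le> sqrt (3 * real n * ln (real n))"
  using d_square_le by eventually_elim (rule real_le_rsqrt)

lemma i_ln_d_le: "\<forall>\<^sub>F n in sequentially. real (i n) * ln (d n) \<le> 2 * ln (real n)"
proof -
  have "\<forall>\<^sub>F n in sequentially. 3 * ln (real n) \<le> real n" by real_asymp
  then show ?thesis
    using d_ge ln_ge[of 1] c_le eventually_gt_at_top[of 0]
  proof eventually_elim
    case (elim n)
    have "1 \<le> ln (real n) ^ 3" using elim by simp
    then have d1: "1 \<le> d n" using elim by linarith
    then have "real (i n) * ln (d n) = ln (d n ^ i n)" by (simp add: ln_realpow)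
    also have "\<dots> = ln (c n * real n)" using c_eq elim by simp
    also have "\<dots> \<le> ln (real n * real n)"
    proof (rule ln_mono)
      show "0 < c n * real n" using c_eq elim d1 by simp
      show "c n * real n \<le> real n * real n" using elim by (intro mult_right_mono) auto
    qed
    also have "\<dots> = 2 * ln (real n)" using elim by (simp add: ln_mult)
    finally show ?case .
  qed
qed

text \<open>The last two conditions are confined to \<open>c n \<le> ln (d n)\<close>: there c i is
  at most i log d, hence at most 2 log n, and exp (- c) is at least 1/d, so that n exp (- c) still
  exceeds any multiple of log n.\<close>

lemma eventually_numeric:
  assumes \<kappa>: "0 < \<kappa>" "\<kappa> \<le> 1 / 56"
  shows "\<forall>\<^sub>F n in sequentially. 1 \<le> ln (real n) \<and> 1 \<le> d n \<and> ln (real n) / d n \<le> \<kappa> \<and>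
    \<delta> n \<le> 1 \<and> real (i n) * \<delta> n \<le> \<kappa> \<and> c n * p n \<le> \<kappa> \<and> p n \<le> 1 / 2 \<and>
    (c n \<le> ln (d n) \<longrightarrow> c n * (real (i n) * \<delta> n) \<le> \<kappa> \<and>
      12 * ln (real n) / \<kappa>\<^sup>2 \<le> real n * (exp (- c n) * (1 - exp (- c n))))"
proof -
  let ?q = "1 - exp (- c0)"
  have q: "0 < ?q" using c0 by simp
  have 1: "\<forall>\<^sub>F n in sequentially. \<delta> n * ln (real n) \<le> \<kappa> / 2"
    using \<kappa> by (intro eventually_le_of_tendsto_0 delta_ln) simp
  have 2: "\<forall>\<^sub>F n in sequentially. ln (real n) ^ 3 / d n \<le> \<kappa>"
    using \<kappa> by (intro eventually_le_of_tendsto_0 ln_cube_div_d)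
  have 3: "\<forall>\<^sub>F n in sequentially. p n \<le> 1 / 2"
    by (intro eventually_le_of_tendsto_0 p_tendsto) simp
  have "(\<lambda>n. 3 * ln (real n) * (sqrt (3 * real n * ln (real n)) / real n)) \<longlonglongrightarrow> 0" by real_asymp
  then have 4: "\<forall>\<^sub>F n in sequentially. 3 * ln (real n) * (sqrt (3 * real n * ln (real n)) / real n) \<le> \<kappa>"
    using \<kappa> by (intro eventually_le_of_tendsto_0)
  have "(\<lambda>n. 12 * ln (real n) * sqrt (3 * real n * ln (real n)) / real n) \<longlonglongrightarrow> 0" by real_asymp
  then have 5: "\<forall>\<^sub>F n in sequentially. 12 * ln (real n) * sqrt (3 * real n * ln (real n)) / real n \<le> ?q * \<kappa>\<^sup>2"
    using \<kappa> q by (intro eventually_le_of_tendsto_0) auto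
  have 6: "\<forall>\<^sub>F n in sequentially. exp 1 \<le> d n"
    using d_at_top by (simp add: filterlim_at_top)
  show ?thesis
    using 1 2 3 4 5 6 ln_ge[of 1] d_le i_ln_d_le c_le c_ge eventually_gt_at_top[of 0]
  proof eventually_elim
    case (elim n)
    define L where "L = ln (real n)"
    have n: "0 < real n" and L: "1 \<le> L" using elim by (simp_all add: L_def)
    have d: "1 \<le> d n" using elim(6) exp_ge_add_one_self[of 1] by linarith
    have lnd: "1 \<le> ln (d n)" using elim(6) d by (simp add: ln_ge_iff)
    have \<delta>0: "0 \<le> \<delta> n" using d L by (simp add: \<delta>_def L_def)
    have "L * 1 \<le> L * L\<^sup>2" using L by (intro mult_left_mono) (auto simp: power_le_one)
    then have "L \<le> L ^ 3" by (simp add: power3_eq_cube power2_eq_square)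
    then have "L / d n \<le> L ^ 3 / d n" using d by (intro divide_right_mono) auto
    then have Ld: "L / d n \<le> \<kappa>" using elim(2) by (simp add: L_def)
    have \<delta>L: "\<delta> n * L \<le> \<kappa> / 2" using elim(1) by (simp add: L_def)
    have "\<delta> n * 1 \<le> \<delta> n * L" using \<delta>0 L by (intro mult_left_mono)
    then have \<delta>1: "\<delta> n \<le> 1" using \<delta>L \<kappa> by simp
    have iL: "real (i n) * ln (d n) \<le> 2 * L" using elim(9) by (simp add: L_def)
    have "real (i n) * 1 \<le> real (i n) * ln (d n)" using lnd by (intro mult_left_mono) auto
    then have "real (i n) \<le> 2 * L" using iL by simp
    then have "real (i n) * \<delta> n \<le> 2 * L * \<delta> n" using \<delta>0 by (rule mult_right_mono)
    then have i\<delta>: "real (i n) * \<delta> n \<le> \<kappa>" using \<delta>L by (simp add: mult_ac)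
    have cL: "0 < c n" "c n \<le> 3 * L" using elim(10,11) c0 by (simp_all add: L_def)
    have pd: "p n = d n / real n" using d_eq n by simp
    have dL: "d n \<le> sqrt (3 * real n * L)" using elim(8) by (simp add: L_def)
    have "p n \<le> sqrt (3 * real n * L) / real n"
      unfolding pd using dL n by (intro divide_right_mono) auto
    then have "c n * p n \<le> 3 * L * (sqrt (3 * real n * L) / real n)"
      using cL p_range by (intro mult_mono) auto
    also have "\<dots> \<le> \<kappa>" using elim(4) by (simp add: L_def)
    finally have cp: "c n * p n \<le> \<kappa>" .
    have "c n * (real (i n) * \<delta> n) \<le> \<kappa> \<and> 12 * L / \<kappa>\<^sup>2 \<le> real n * (exp (- c n) * (1 - exp (- c n)))"
      if c: "c n \<le> ln (d n)"
    proof
      have "c n * real (i n) \<le> ln (d n) * real (i n)" using c by (intro mult_right_mono) auto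
      then have "c n * real (i n) \<le> 2 * L" using iL by (simp add: mult.commute)
      then have "c n * real (i n) * \<delta> n \<le> 2 * L * \<delta> n" using \<delta>0 by (rule mult_right_mono)
      then show "c n * (real (i n) * \<delta> n) \<le> \<kappa>" using \<delta>L by (simp add: mult_ac)
      have "12 * L * d n \<le> 12 * L * sqrt (3 * real n * L)" using dL L by (intro mult_left_mono) auto
      also have "\<dots> \<le> ?q * \<kappa>\<^sup>2 * real n"
        using elim(5) n by (simp add: L_def field_simps)
      finally have "12 * L / \<kappa>\<^sup>2 \<le> real n * (1 / d n * ?q)"
        using d \<kappa> by (simp add: field_simps)
      also have "\<dots> \<le> real n * (exp (- c n) * (1 - exp (- c n)))"
      proof (intro mult_left_mono mult_mono)
        have "exp (- ln (d n)) \<le> exp (- c n)" using c by simp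
        then show "1 / d n \<le> exp (- c n)" using d by (simp add: exp_minus divide_inverse)
        show "?q \<le> 1 - exp (- c n)" using elim(11) by simp
      qed (use q n in auto)
      finally show "12 * L / \<kappa>\<^sup>2 \<le> real n * (exp (- c n) * (1 - exp (- c n)))" .
    qed
    then show ?case using L d Ld \<delta>1 i\<delta> cp elim(3) unfolding L_def by blast
  qed
qed

definition s0 :: "nat \<Rightarrow> real" where
  "s0 n = 2 * ((1 + \<delta> n) * d n) ^ (i n - 2)"

text \<open>Restricted to regular expanders, on which exposures are typical; the other graphs are
  counted once, separately.\<close>

abbreviation distinguished_below :: "nat \<Rightarrow> real \<Rightarrow> nat set set \<Rightarrow> bool" where
  "distinguished_below n R E \<equiv> regular_expander n (d n) (\<delta> n) (s0 n) E \<and>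
    (\<exists>x\<in>{1..n}. \<exists>y\<in>{1..n}. x \<noteq> y \<and> real (card {s \<in> {1..n}. graph_dist E s x \<noteq> graph_dist E s y}) < R)"

text \<open>About half the share of vertices adjacent to exactly one sphere. The missing 2 stands in
  front of the whole count R.\<close>

abbreviation new_fraction :: "nat \<Rightarrow> real" where
  "new_fraction n \<equiv> exp (- c n) * (1 - exp (- c n))"

lemma eventually_estimates:
  assumes \<kappa>: "0 < \<kappa>" "\<kappa> \<le> 1 / 56"
  shows "\<forall>\<^sub>F n in sequentially.
    pr (p n) (vertex_pairs n) (\<lambda>E. \<not> regular_expander n (d n) (\<delta> n) (s0 n) E) \<le> 3 / n ^ 3 \<and>
    d n ^ (i n - 1) \<le> n / 4 \<and>
    pr (p n) (vertex_pairs n) (distinguished_below n (2 * (1 - 28 * \<kappa>) * d n ^ (i n - 1))) \<le> 1 / n \<and>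
    (c n \<le> ln (d n) \<longrightarrow> pr (p n) (vertex_pairs n)
      (distinguished_below n (2 * (1 - 28 * \<kappa>) * (d n ^ (i n - 1) + n * new_fraction n))) \<le> 1 / n)"
  using eventually_numeric[OF \<kappa>] i_ge c_le eventually_gt_at_top[of 0]
proof eventually_elim
  case (elim n)
  obtain j where j: "i n = Suc (Suc j)"
    using elim(2) by (metis Suc_le_D numeral_2_eq_2 Suc_le_mono)
  have ij: "i n - 1 = Suc j" and s0: "s0 n = 2 * ((1 + \<delta> n) * d n) ^ j"
    using j by (simp_all add: s0_def)
  have p: "0 \<le> p n" "p n \<le> 1" and dp: "d n = p n * real n" and c: "c n = d n ^ i n / real n"
    using p_range d_eq c_eq by simp_all
  have d: "1 \<le> d n" and L: "1 \<le> ln (real n)" "ln (real n) / d n \<le> \<kappa>"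
    and \<delta>: "\<delta> n \<le> 1" "real (i n) * \<delta> n \<le> \<kappa>" and cp: "c n * p n \<le> \<kappa>" "p n \<le> 1 / 2"
    using elim(1) by simp_all
  note numeric = p elim(4) dp d j c elim(3) refl L \<kappa> \<delta>_def[of n] \<delta>
  have pos: "0 < \<delta> n" by (rule delta_pos[OF numeric refl refl s0])
  have balls: "2 * (1 - 28 * \<kappa>) * d n ^ Suc j \<le> 4 * ((1 - \<delta> n) * d n) ^ Suc j - 2 * ((1 + \<delta> n) * d n) ^ Suc j"
    by (rule balls_difference_ge[OF numeric refl refl s0])
  \<comment> \<open>For the balls alone nothing random is left: a regular expander never violates
    this bound, and 1/n only gives it the same shape as the sphere estimate.\<close>
  have "pr (p n) (vertex_pairs n) (distinguished_below n (2 * (1 - 28 * \<kappa>) * d n ^ Suc j))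
      \<le> pr (p n) (vertex_pairs n) (\<lambda>E. False)"
  proof (rule pr_mono[OF p])
    fix E assume E: "E \<subseteq> vertex_pairs n" and "distinguished_below n (2 * (1 - 28 * \<kappa>) * d n ^ Suc j) E"
    then obtain x y where reg: "regular_expander n (d n) (\<delta> n) (s0 n) E"
      and xy: "x \<in> {1..n}" "y \<in> {1..n}" "x \<noteq> y"
      and less: "real (card {s \<in> {1..n}. graph_dist E s x \<noteq> graph_dist E s y}) < 2 * (1 - 28 * \<kappa>) * d n ^ Suc j"
      by blast
    have "4 * ((1 - \<delta> n) * d n) ^ Suc j - 2 * ((1 + \<delta> n) * d n) ^ Suc j
        + card (new_distinguished n (exposed E j x y) E)
      \<le> card {s \<in> {1..n}. graph_dist E s x \<noteq> graph_dist E s y}"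
      by (rule distinguished_ge_balls[OF p dp d pos \<delta>(1) refl refl s0 E reg xy])
    then show False using less balls by linarith
  qed
  also have "\<dots> \<le> 1 / n" by simp
  finally have A: "pr (p n) (vertex_pairs n) (distinguished_below n (2 * (1 - 28 * \<kappa>) * d n ^ Suc j)) \<le> 1 / n" .
  have B: "pr (p n) (vertex_pairs n)
      (distinguished_below n (2 * (1 - 28 * \<kappa>) * (d n ^ Suc j + n * new_fraction n))) \<le> 1 / n" if "c n \<le> ln (d n)"
    by (rule pr_few_distinguished_le[OF numeric refl refl s0 _ cp]) (use elim(1) that in simp_all)
  have C: "pr (p n) (vertex_pairs n) (\<lambda>E. \<not> regular_expander n (d n) (\<delta> n) (s0 n) E) \<le> 3 / n ^ 3"
    by (rule pr_not_regular_expander_le[OF numeric refl refl s0])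
  have "d n ^ Suc j \<le> 3 * \<kappa> * n" by (rule ball_size_le[OF numeric refl refl s0])
  also have "\<dots> \<le> 1 / 4 * n" using \<kappa> by (intro mult_right_mono) auto
  finally have D: "d n ^ Suc j \<le> n / 4" by simp
  show ?case unfolding ij using A B C D by blast
qed

section \<open>From the estimates to the asymptotic bounds\<close>

lemma aas_localization_number:
  fixes r :: "nat \<Rightarrow> real"
  assumes r: "\<forall>\<^sub>F n in sequentially. 0 < r n \<and> 2 * r n \<le> n"
    and pr: "\<And>\<kappa>. 0 < \<kappa> \<Longrightarrow> \<kappa> \<le> 1 / 56 \<Longrightarrow> \<forall>\<^sub>F n in sequentially.
      pr (p n) (vertex_pairs n) (distinguished_below n (2 * (1 - 28 * \<kappa>) * r n)) \<le> 1 / n"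
    and \<eta>: "0 < \<eta>"
  shows "aas p (\<lambda>n E. real (localization_number {1..n} E)
    \<le> (1 + \<eta>) * ((ln (d n) + 2 * ln (ln (real n))) * (n / r n)))"
proof -
  \<comment> \<open>Chosen so that 28 kappa (1 + eta) = eta/2, hence (1 + eta) (1 - 28 kappa) = 1 +
    eta/2.\<close>
  define \<kappa> where "\<kappa> = \<eta> / (56 * (1 + \<eta>))"
  have \<kappa>: "0 < \<kappa>" "\<kappa> \<le> 1 / 56" using \<eta> by (simp_all add: \<kappa>_def field_simps)
  have \<kappa>\<eta>: "1 / (1 - 28 * \<kappa>) \<le> 1 + \<eta>"
  proof -
    have "28 * \<kappa> * (1 + \<eta>) = \<eta> / 2" using \<eta> by (simp add: \<kappa>_def field_simps)
    then have "1 \<le> (1 + \<eta>) * (1 - 28 * \<kappa>)" using \<eta> by (simp add: algebra_simps)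
    then show ?thesis using \<kappa> by (simp add: field_simps)
  qed
  have lnln: "\<forall>\<^sub>F n in sequentially. 1 \<le> ln (ln (real n))" by real_asymp
  let ?P = "\<lambda>n E. real (localization_number {1..n} E)
    \<le> (1 + \<eta>) * ((ln (d n) + 2 * ln (ln (real n))) * (n / r n))"
  have "\<forall>\<^sub>F n in sequentially. pr (p n) (vertex_pairs n) (\<lambda>E. \<not> ?P n E) \<le> 3 / n ^ 3 + 1 / n"
    using eventually_estimates[OF \<kappa>] eventually_numeric[OF \<kappa>] r pr[OF \<kappa>] lnln eventually_gt_at_top[of 0]
  proof eventually_elim
    case (elim n)
    define R where "R = 2 * (1 - 28 * \<kappa>) * r n"
    have p: "0 \<le> p n" "p n \<le> 1" using p_range by simp_all
    have R: "0 < R" "R \<le> n"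
    proof -
      show "0 < R" using elim(3) \<kappa> by (simp add: R_def)
      have "R \<le> 2 * 1 * r n" unfolding R_def using elim(3) \<kappa> by (intro mult_right_mono mult_left_mono) auto
      then show "R \<le> n" using elim(3) by simp
    qed
    have d: "1 \<le> d n" and \<delta>1: "\<delta> n \<le> 1" using elim(2) by simp_all
    have bound: "(2 * ln (d n) + 4) * (n / R) \<le> (1 + \<eta>) * ((ln (d n) + 2 * ln (ln (real n))) * (n / r n))"
    proof -
      have nr: "0 \<le> n / r n" using elim(3) by simp
      \<comment> \<open>The 2 in \<open>R\<close> halves the numerator, and the remaining constant 2
        is at most 2 log log n.\<close>
      have "(2 * ln (d n) + 4) * (n / R) = 1 / (1 - 28 * \<kappa>) * ((ln (d n) + 2) * (n / r n))"
        using \<kappa> elim(3) by (simp add: R_def field_simps)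
      also have "\<dots> \<le> (1 + \<eta>) * ((ln (d n) + 2 * ln (ln (real n))) * (n / r n))"
        using d nr elim(5) \<eta> by (intro mult_mono \<kappa>\<eta> mult_nonneg_nonneg order_refl) auto
      finally show ?thesis .
    qed
    have "pr (p n) (vertex_pairs n) (\<lambda>E. \<not> ?P n E)
      \<le> pr (p n) (vertex_pairs n) (\<lambda>E. \<not> regular_expander n (d n) (\<delta> n) (s0 n) E \<or> distinguished_below n R E)"
    proof (rule pr_mono[OF p], rule ccontr)
      fix E assume E: "E \<subseteq> vertex_pairs n" and not_P: "\<not> ?P n E"
        and no: "\<not> (\<not> regular_expander n (d n) (\<delta> n) (s0 n) E \<or> distinguished_below n R E)"
      have "real (localization_number {1..n} E) \<le> (2 * ln (d n) + 4) * (n / R)"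
      proof (rule localization_number_le_of_regular_expander[OF E _ _ d \<delta>1 R])
        show "regular_expander n (d n) (\<delta> n) (s0 n) E" using no by blast
        fix x y assume "x \<in> {1..n}" "y \<in> {1..n}" "x \<noteq> y"
        then show "R \<le> real (card {s \<in> {1..n}. graph_dist E s x \<noteq> graph_dist E s y})"
          using no not_le by blast
      qed (use elim(6) in simp)
      then show False using bound not_P by linarith
    qed
    also have "\<dots> \<le> pr (p n) (vertex_pairs n) (\<lambda>E. \<not> regular_expander n (d n) (\<delta> n) (s0 n) E)
        + pr (p n) (vertex_pairs n) (distinguished_below n R)"
      by (rule pr_disj[OF p])
    also have "\<dots> \<le> 3 / n ^ 3 + 1 / n"
      using elim(1,4) unfolding R_def by (intro add_mono) blast+
    finally show ?case .
  qed
  moreover have "(\<lambda>n. 3 / real n ^ 3 + 1 / real n) \<longlonglongrightarrow> 0" by real_asymp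
  ultimately show ?thesis by (intro aasI[OF p_range, where g = "\<lambda>n. 3 / real n ^ 3 + 1 / real n"]) simp_all
qed

lemma aas_at_most_localization_number:
  fixes r g :: "nat \<Rightarrow> real"
  assumes r: "\<forall>\<^sub>F n in sequentially. 0 < r n \<and> 2 * r n \<le> n"
    and pr: "\<And>\<kappa>. 0 < \<kappa> \<Longrightarrow> \<kappa> \<le> 1 / 56 \<Longrightarrow> \<forall>\<^sub>F n in sequentially.
      pr (p n) (vertex_pairs n) (distinguished_below n (2 * (1 - 28 * \<kappa>) * r n)) \<le> 1 / n"
    and g: "\<And>\<eta>. 0 < \<eta> \<Longrightarrow> \<forall>\<^sub>F n in sequentially. n / r n \<le> (1 + \<eta>) * g n"
  shows "aas_at_most p (\<lambda>n E. real (localization_number {1..n} E))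
    (\<lambda>n. (ln (d n) + 2 * ln (ln (real n))) * g n)"
proof (rule aas_at_mostI)
  fix \<eta> :: real assume \<eta>: "0 < \<eta>"
  \<comment> \<open>The slack is spent twice, on the probabilistic bound and on \<open>g\<close>; (1
    + x)^2 is at most 1 + 3 x for x at most 1.\<close>
  define x where "x = min 1 (\<eta> / 3)"
  have x: "0 < x" "x \<le> 1" "3 * x \<le> \<eta>" using \<eta> by (auto simp: x_def)
  have xx: "(1 + x) * (1 + x) \<le> 1 + \<eta>"
  proof -
    have "x * x \<le> x * 1" using x by (intro mult_left_mono) auto
    then show ?thesis using x(3) by (simp add: algebra_simps)
  qed
  have lnln: "\<forall>\<^sub>F n in sequentially. 1 \<le> ln (ln (real n))" by real_asymp
  have d1: "\<forall>\<^sub>F n in sequentially. 1 \<le> d n" using d_at_top by (simp add: filterlim_at_top)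
  show "aas p (\<lambda>n E. real (localization_number {1..n} E)
    \<le> (1 + \<eta>) * ((ln (d n) + 2 * ln (ln (real n))) * g n))"
  proof (rule aas_mono[OF p_range aas_localization_number[OF r pr x(1)]])
    show "\<forall>\<^sub>F n in sequentially. \<forall>E. real (localization_number {1..n} E)
      \<le> (1 + x) * ((ln (d n) + 2 * ln (ln (real n))) * (n / r n)) \<longrightarrow>
      real (localization_number {1..n} E) \<le> (1 + \<eta>) * ((ln (d n) + 2 * ln (ln (real n))) * g n)"
      using g[OF x(1)] lnln d1 r
    proof eventually_elim
      case (elim n)
      let ?l = "ln (d n) + 2 * ln (ln (real n))"
      have l: "0 \<le> ?l" using elim by simp
      have "0 < (1 + x) * g n \<or> n = 0" using elim by (auto intro: less_le_trans[rotated])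
      then have "0 \<le> (1 + x) * g n" using elim(1,4) by (auto intro: order_trans[rotated])
      then have g0: "0 \<le> g n" using x by (simp add: zero_le_mult_iff)
      have "(1 + x) * (?l * (n / r n)) \<le> (1 + x) * (?l * ((1 + x) * g n))"
        using elim x l by (intro mult_left_mono) auto
      also have "\<dots> = (1 + x) * (1 + x) * (?l * g n)" by (simp add: mult_ac)
      also have "\<dots> \<le> (1 + \<eta>) * (?l * g n)" using l g0 by (intro mult_right_mono xx) auto
      finally show ?case using order_trans by blast
    qed
  qed
qed

lemma localization_number_le_balls:
  assumes "\<And>\<eta>. 0 < \<eta> \<Longrightarrow> \<forall>\<^sub>F n in sequentially. n / d n ^ (i n - 1) \<le> (1 + \<eta>) * g n"
  shows "aas_at_most p (\<lambda>n E. real (localization_number {1..n} E))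
    (\<lambda>n. (ln (d n) + 2 * ln (ln (real n))) * g n)"
proof (rule aas_at_most_localization_number[where r = "\<lambda>n. d n ^ (i n - 1)"])
  have "0 < (1 / 56 :: real)" by simp
  from eventually_estimates[OF this order_refl] eventually_numeric[OF this order_refl]
  show "\<forall>\<^sub>F n in sequentially. 0 < d n ^ (i n - 1) \<and> 2 * d n ^ (i n - 1) \<le> real n"
    by eventually_elim auto
  fix \<kappa> :: real assume "0 < \<kappa>" "\<kappa> \<le> 1 / 56"
  from eventually_estimates[OF this] show "\<forall>\<^sub>F n in sequentially.
      pr (p n) (vertex_pairs n) (distinguished_below n (2 * (1 - 28 * \<kappa>) * d n ^ (i n - 1))) \<le> 1 / n"
    by eventually_elim blast
qed (rule assms)

lemma localization_number_le_spheres: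
  assumes c: "\<forall>\<^sub>F n in sequentially. c n \<le> ln (d n)"
    and "\<And>\<eta>. 0 < \<eta> \<Longrightarrow> \<forall>\<^sub>F n in sequentially.
      n / (d n ^ (i n - 1) + n * new_fraction n) \<le> (1 + \<eta>) * g n"
  shows "aas_at_most p (\<lambda>n E. real (localization_number {1..n} E))
    (\<lambda>n. (ln (d n) + 2 * ln (ln (real n))) * g n)"
proof (rule aas_at_most_localization_number[where r = "\<lambda>n. d n ^ (i n - 1) + n * new_fraction n"])
  have "0 < (1 / 56 :: real)" by simp
  from eventually_estimates[OF this order_refl] eventually_numeric[OF this order_refl] c_ge
  show "\<forall>\<^sub>F n in sequentially. 0 < d n ^ (i n - 1) + n * new_fraction n \<and>
      2 * (d n ^ (i n - 1) + n * new_fraction n) \<le> real n"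
  proof eventually_elim
    case (elim n)
    \<comment> \<open>Completing the square: t (1 - t) is at most 1/4. Balls and spheres then take
      at most a quarter of n each, which gives \<open>2 * r n \<le> n\<close>.\<close>
    have "0 \<le> (1 - 2 * exp (- c n))\<^sup>2" by simp
    then have "new_fraction n \<le> 1 / 4" by (simp add: power2_eq_square algebra_simps)
    define x y where "x = d n ^ (i n - 1)" and "y = n * new_fraction n"
    have y: "y \<le> n * (1 / 4)" unfolding y_def using \<open>new_fraction n \<le> 1 / 4\<close> by (intro mult_left_mono) auto
    have y0: "0 \<le> y" unfolding y_def using elim(3) c0 by simp
    have x0: "0 < x" unfolding x_def using elim(2) by simp
    have x: "x \<le> n / 4" unfolding x_def using elim(1) by blast
    have "0 < x + y" using x0 y0 by linarith
    moreover have "2 * (x + y) \<le> 2 * (n / 4 + n * (1 / 4))"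
      by (intro mult_left_mono add_mono x y) simp
    ultimately show ?case by (simp add: x_def y_def)
  qed
  fix \<kappa> :: real assume "0 < \<kappa>" "\<kappa> \<le> 1 / 56"
  from eventually_estimates[OF this] c show "\<forall>\<^sub>F n in sequentially. pr (p n) (vertex_pairs n)
      (distinguished_below n (2 * (1 - 28 * \<kappa>) * (d n ^ (i n - 1) + n * new_fraction n))) \<le> 1 / n"
    by eventually_elim blast
qed (rule assms)

lemma eventually_spheres_pos: "\<forall>\<^sub>F n in sequentially. 0 < new_fraction n"
  using c_ge by eventually_elim (use c0 in simp)

lemma eventually_n_div_spheres:
  "\<forall>\<^sub>F n in sequentially. n / (d n ^ (i n - 1) + n * new_fraction n) = 1 / (c n / d n + new_fraction n)"
proof -
  have "\<forall>\<^sub>F n in sequentially. 1 \<le> d n" using d_at_top by (simp add: filterlim_at_top)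
  then show ?thesis
    using i_ge eventually_gt_at_top[of 0]
  proof eventually_elim
    case (elim n)
    then obtain j where "i n = Suc j" by (metis Suc_le_D numeral_2_eq_2)
    then have "d n ^ (i n - 1) = n * (c n / d n)" using c_eq elim by simp
    then have "d n ^ (i n - 1) + n * new_fraction n = n * (c n / d n + new_fraction n)"
      by (simp add: distrib_left)
    then show ?case using elim by simp
  qed
qed

text \<open>Drops the contribution c/d of the balls, which suffices when the spheres alone already
  give the desired bound.\<close>

lemma eventually_spheres_le:
  assumes "0 < \<eta>" and lim: "(\<lambda>n. 1 / (new_fraction n * g n)) \<longlonglongrightarrow> 1" and g: "\<forall>\<^sub>F n in sequentially. 0 < g n"
  shows "\<forall>\<^sub>F n in sequentially. n / (d n ^ (i n - 1) + n * new_fraction n) \<le> (1 + \<eta>) * g n"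
proof -
  have d0: "\<forall>\<^sub>F n in sequentially. 1 \<le> d n" using d_at_top by (simp add: filterlim_at_top)
  have "(\<lambda>n. 1 / new_fraction n / g n) \<longlonglongrightarrow> 1" using lim by (simp only: divide_divide_eq_left)
  from eventually_le_scaled[OF this g assms(1)] eventually_spheres_pos eventually_n_div_spheres d0 c_ge
  show ?thesis
  proof eventually_elim
    case (elim n)
    have "0 \<le> c n / d n" using elim c0 by simp
    then have "1 / (c n / d n + new_fraction n) \<le> 1 / new_fraction n"
      by (intro divide_left_mono mult_pos_pos[OF add_nonneg_pos[OF _ elim(2)] elim(2)]) simp_all
    then show ?case using elim(1,3) by linarith
  qed
qed

end

section \<open>The four ranges of c\<close>

theorem theorem6p2:
  fixes p d c :: "nat \<Rightarrow> real" and i :: "nat \<Rightarrow> nat"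
    and \<zeta> :: "nat \<Rightarrow> nat set set \<Rightarrow> real"
  assumes p_range: "\<forall>n. 0 \<le> p n \<and> p n \<le> 1"
    and d_eq: "\<forall>n. d n = p n * real n"
    and d_lower: "(\<lambda>n. ln (real n) ^ 3) \<in> o(d)"
    and d_upper: "d \<in> o(\<lambda>n. real n)"
    and i_eq: "\<forall>n. i n = (GREATEST j. d n ^ j / real n \<le> 3 * ln (real n))"
    and c_eq: "\<forall>n. c n = d n ^ i n / real n"
    and zeta_eq: "\<forall>n E. \<zeta> n E = real (localization_number {1..n} E)"
  shows
    "(\<forall>A>0. c \<longlonglongrightarrow> A \<longrightarrow>
        aas_at_most p \<zeta>
          (\<lambda>n. (ln (d n) + 2 * ln (ln (real n))) * (exp A / (1 - exp (- A))))) \<and>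
     (filterlim c at_top sequentially \<and>
      filterlim (\<lambda>n. c n - (ln (d n) - ln (ln (d n)))) at_bot sequentially \<longrightarrow>
        aas_at_most p \<zeta>
          (\<lambda>n. (ln (d n) + 2 * ln (ln (real n))) * exp (c n))) \<and>
     (\<forall>B. (\<lambda>n. c n - (ln (d n) - ln (ln (d n)))) \<longlonglongrightarrow> B \<longrightarrow>
        aas_at_most p \<zeta>
          (\<lambda>n. (ln (d n) + 2 * ln (ln (real n))) * (exp (c n) / (exp B + 1))) \<and>
        (\<lambda>n. (ln (d n) + 2 * ln (ln (real n))) * (exp (c n) / (exp B + 1)))
          \<sim>[sequentially]
        (\<lambda>n. (ln (d n) + 2 * ln (ln (real n))) * (real n / (d n ^ (i n - 1) * (1 + exp (- B)))))) \<and>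
     (filterlim (\<lambda>n. c n - (ln (d n) - ln (ln (d n)))) at_top sequentially \<and>
      eventually (\<lambda>n. c n \<le> 3 * ln (real n)) sequentially \<longrightarrow>
        aas_at_most p \<zeta>
          (\<lambda>n. (ln (d n) + 2 * ln (ln (real n))) * (real n / d n ^ (i n - 1))))"
proof -
  have \<zeta>: "\<zeta> = (\<lambda>n E. real (localization_number {1..n} E))"
    using zeta_eq by auto
  let ?m = "\<lambda>n. ln (d n) - ln (ln (d n))"
  have d0: "0 \<le> d n" for n using p_range d_eq by simp
  have ln_le_d: "\<forall>\<^sub>F n in sequentially. ln (real n) ^ 3 \<le> d n"
    by (rule eventually_ln_cube_le[OF d_lower d0])
  have d_top: "filterlim d at_top sequentially"
    by (rule filterlim_at_top_mono[OF _ ln_le_d]) real_asymp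
  have ln_d_top: "filterlim (\<lambda>n. ln (d n)) at_top sequentially"
    by (rule filterlim_compose[OF ln_at_top d_top])
  have lnln_d_top: "filterlim (\<lambda>n. ln (ln (d n))) at_top sequentially"
    by (rule filterlim_compose[OF ln_at_top ln_d_top])
  have "filterlim (\<lambda>x::real. ln x - ln (ln x)) at_top at_top" by real_asymp
  then have m_top: "filterlim ?m at_top sequentially" by (rule filterlim_compose[OF _ d_top])
  have d_le_n: "\<forall>\<^sub>F n in sequentially. 3 \<le> d n \<and> d n \<le> n"
  proof -
    have "\<forall>\<^sub>F n in sequentially. 3 \<le> d n" using d_top by (simp add: filterlim_at_top)
    then show ?thesis
    proof eventually_elim
      case (elim n)
      have "p n * n \<le> 1 * real n" using p_range by (intro mult_right_mono) auto
      then show ?case using elim d_eq by simp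
    qed
  qed
  have regime: "sparse_regime p d c i c0"
    if "0 < c0" "\<forall>\<^sub>F n in sequentially. c0 \<le> c n" "\<forall>\<^sub>F n in sequentially. c n \<le> 3 * ln (real n)" for c0
    using that assms(1-4) c_eq by unfold_locales
  have c_le_3ln: "\<forall>\<^sub>F n in sequentially. c n \<le> 3 * ln (real n)"
    if "\<forall>\<^sub>F n in sequentially. c n \<le> ln (d n)"
    using that d_le_n
  proof eventually_elim
    case (elim n)
    have "ln (d n) \<le> ln (real n)" using elim by (intro ln_mono) auto
    moreover have "0 \<le> ln (real n)" using elim by (intro ln_ge_zero) auto
    ultimately show ?case using elim by linarith
  qed
  have i: "aas_at_most p \<zeta> (\<lambda>n. (ln (d n) + 2 * ln (ln (real n))) * (exp A / (1 - exp (- A))))"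
    if A: "0 < A" "c \<longlonglongrightarrow> A" for A
  proof -
    have "\<forall>\<^sub>F n in sequentially. A / 2 < c n" by (rule order_tendstoD(1)[OF A(2)]) (use A in simp)
    then have c_ge: "\<forall>\<^sub>F n in sequentially. A / 2 \<le> c n" by eventually_elim simp
    have "\<forall>\<^sub>F n in sequentially. c n < A + 1" by (rule order_tendstoD(2)[OF A(2)]) simp
    moreover have "\<forall>\<^sub>F n in sequentially. A + 1 \<le> ln (d n)" using ln_d_top by (simp add: filterlim_at_top)
    ultimately have c_le_ln: "\<forall>\<^sub>F n in sequentially. c n \<le> ln (d n)" by eventually_elim simp
    interpret sparse_regime p d c i "A / 2"
      using A by (intro regime c_ge c_le_3ln[OF c_le_ln]) simp
    have q: "0 < exp (- A) * (1 - exp (- A))" using A by simp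
    have g: "exp A / (1 - exp (- A)) = 1 / (exp (- A) * (1 - exp (- A)))" by (simp add: exp_minus field_simps)
    have "(\<lambda>n. new_fraction n) \<longlonglongrightarrow> exp (- A) * (1 - exp (- A))"
      by (intro tendsto_intros A(2))
    then have "(\<lambda>n. 1 / (new_fraction n * (exp A / (1 - exp (- A))))) \<longlonglongrightarrow>
        1 / (exp (- A) * (1 - exp (- A)) * (exp A / (1 - exp (- A))))"
      using q by (intro tendsto_intros A(2)) (auto simp: g)
    then have lim: "(\<lambda>n. 1 / (new_fraction n * (exp A / (1 - exp (- A))))) \<longlonglongrightarrow> 1"
      using q A by (simp add: g)
    show ?thesis
      unfolding \<zeta>
    proof (rule localization_number_le_spheres[OF c_le_ln eventually_spheres_le[OF _ lim]])
      show "\<forall>\<^sub>F n in sequentially. 0 < exp A / (1 - exp (- A))" using A by simp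
    qed
  qed
  have ii: "aas_at_most p \<zeta> (\<lambda>n. (ln (d n) + 2 * ln (ln (real n))) * exp (c n))"
    if c_top: "filterlim c at_top sequentially" and bot: "filterlim (\<lambda>n. c n - ?m n) at_bot sequentially"
  proof -
    have c_ge: "\<forall>\<^sub>F n in sequentially. 1 \<le> c n" using c_top by (simp add: filterlim_at_top)
    have "\<forall>\<^sub>F n in sequentially. c n - ?m n \<le> 0" using bot unfolding filterlim_at_bot by blast
    moreover have "\<forall>\<^sub>F n in sequentially. 0 \<le> ln (ln (d n))" using lnln_d_top by (simp add: filterlim_at_top)
    ultimately have c_le_ln: "\<forall>\<^sub>F n in sequentially. c n \<le> ln (d n)" by eventually_elim simp
    interpret sparse_regime p d c i 1
      by (intro regime c_ge c_le_3ln[OF c_le_ln]) simp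
    have "filterlim (\<lambda>x::real. 1 / (1 - exp (- x))) (nhds 1) at_top" by real_asymp
    from filterlim_compose[OF this c_top] have "(\<lambda>n. 1 / (1 - exp (- c n))) \<longlonglongrightarrow> 1" .
    moreover have "new_fraction n * exp (c n) = 1 - exp (- c n)" for n
      by (simp add: exp_minus)
    ultimately have lim: "(\<lambda>n. 1 / (new_fraction n * exp (c n))) \<longlonglongrightarrow> 1" by (simp only:)
    show ?thesis
      unfolding \<zeta> by (rule localization_number_le_spheres[OF c_le_ln eventually_spheres_le[OF _ lim]]) simp_all
  qed
  have iii: "aas_at_most p \<zeta> (\<lambda>n. (ln (d n) + 2 * ln (ln (real n))) * (exp (c n) / (exp B + 1)))"
    and iii': "(\<lambda>n. (ln (d n) + 2 * ln (ln (real n))) * (exp (c n) / (exp B + 1))) \<sim>[sequentially]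
        (\<lambda>n. (ln (d n) + 2 * ln (ln (real n))) * (real n / (d n ^ (i n - 1) * (1 + exp (- B)))))"
    if B: "(\<lambda>n. c n - ?m n) \<longlonglongrightarrow> B" for B
  proof -
    have "filterlim (\<lambda>n. (c n - ?m n) + ?m n) at_top sequentially"
      by (rule filterlim_tendsto_add_at_top[OF B m_top])
    then have c_top: "filterlim c at_top sequentially" by simp
    then have c_ge: "\<forall>\<^sub>F n in sequentially. 1 \<le> c n" by (simp add: filterlim_at_top)
    have "\<forall>\<^sub>F n in sequentially. c n - ?m n < B + 1" by (rule order_tendstoD(2)[OF B]) simp
    moreover have "\<forall>\<^sub>F n in sequentially. B + 1 \<le> ln (ln (d n))" using lnln_d_top by (simp add: filterlim_at_top)
    ultimately have c_le_ln: "\<forall>\<^sub>F n in sequentially. c n \<le> ln (d n)" by eventually_elim simp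
    interpret sparse_regime p d c i 1
      by (intro regime c_ge c_le_3ln[OF c_le_ln]) simp
    have "filterlim (\<lambda>x::real. (ln x - ln (ln x)) / ln x) (nhds 1) at_top" by real_asymp
    from filterlim_compose[OF this d_top] have m1: "(\<lambda>n. ?m n / ln (d n)) \<longlonglongrightarrow> 1" .
    have "(\<lambda>n. (c n - ?m n) / ln (d n) + ?m n / ln (d n)) \<longlonglongrightarrow> 0 + 1"
      by (intro tendsto_add m1 tendsto_divide_0[OF B] filterlim_at_top_imp_at_infinity ln_d_top)
    \<comment> \<open>Needed because exp (c - m) equals exp c * log d / d, where m = log d - log log
      d; replacing log d by c gives (c/d) exp c, the size of the balls relative to exp (-
      c).\<close>
    then have c_ln: "(\<lambda>n. c n / ln (d n)) \<longlonglongrightarrow> 1" by (simp add: add_divide_distrib[symmetric])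
    have "(\<lambda>n. exp (c n - ?m n) * (c n / ln (d n))) \<longlonglongrightarrow> exp B * 1"
      by (intro tendsto_intros B c_ln)
    moreover have "\<forall>\<^sub>F n in sequentially. exp (c n - ?m n) * (c n / ln (d n)) = c n / d n * exp (c n)"
      using d_le_n
    proof eventually_elim
      case (elim n)
      have "exp 1 \<le> d n" using elim exp_le by linarith
      then have "1 \<le> ln (d n)" using elim by (simp add: ln_ge_iff)
      then have "exp (c n - ?m n) = exp (c n) * ln (d n) / d n"
        using elim by (simp add: exp_diff)
      then show ?case using \<open>1 \<le> ln (d n)\<close> by simp
    qed
    ultimately have ball: "(\<lambda>n. c n / d n * exp (c n)) \<longlonglongrightarrow> exp B"
      by (auto elim: Lim_transform_eventually)
    have "filterlim (\<lambda>x::real. 1 - exp (- x)) (nhds 1) at_top" by real_asymp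
    from filterlim_compose[OF this c_top] have sphere: "(\<lambda>n. 1 - exp (- c n)) \<longlonglongrightarrow> 1" .
    have B1: "0 < exp B + 1" by (simp add: add_pos_pos)
    have "(\<lambda>n. 1 / (c n / d n + new_fraction n) / (exp (c n) / (exp B + 1))) \<longlonglongrightarrow> 1"
    proof -
      \<comment> \<open>The fraction was expanded by exp c: the balls then contribute exp B in the
        limit and the spheres 1.\<close>
      have "(\<lambda>n. (exp B + 1) / (c n / d n * exp (c n) + (1 - exp (- c n)))) \<longlonglongrightarrow> (exp B + 1) / (exp B + 1)"
        using B1 by (intro tendsto_intros ball sphere) auto
      moreover have "1 / (c n / d n + new_fraction n) / (exp (c n) / (exp B + 1))
          = (exp B + 1) / (c n / d n * exp (c n) + (1 - exp (- c n)))" for n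
      proof -
        have "(c n / d n + new_fraction n) * exp (c n) = c n / d n * exp (c n) + (1 - exp (- c n))"
          by (simp add: distrib_right exp_minus)
        then show ?thesis by (simp only: divide_divide_eq_left divide_divide_eq_right times_divide_eq_right) simp
      qed
      ultimately show ?thesis using B1 by simp
    qed
    note le = eventually_le_scaled[OF this]
    show "aas_at_most p \<zeta> (\<lambda>n. (ln (d n) + 2 * ln (ln (real n))) * (exp (c n) / (exp B + 1)))"
      unfolding \<zeta>
    proof (rule localization_number_le_spheres[OF c_le_ln])
      fix \<eta> :: real assume "0 < \<eta>"
      have "\<forall>\<^sub>F n in sequentially. 1 / (c n / d n + new_fraction n) \<le> (1 + \<eta>) * (exp (c n) / (exp B + 1))"
        using B1 \<open>0 < \<eta>\<close> by (intro le) simp_all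
      with eventually_n_div_spheres
      show "\<forall>\<^sub>F n in sequentially. n / (d n ^ (i n - 1) + n * new_fraction n) \<le> (1 + \<eta>) * (exp (c n) / (exp B + 1))"
        by eventually_elim simp
    qed
    \<comment> \<open>With d^(i-1) = n c / d and 1 + exp (- B) = (exp B + 1) exp (- B), the quotient
      is (c/d) exp c * exp (- B).\<close>
    have "(\<lambda>n. (exp (c n) / (exp B + 1)) / (real n / (d n ^ (i n - 1) * (1 + exp (- B))))) \<longlonglongrightarrow> 1"
    proof (rule Lim_transform_eventually)
      have "(\<lambda>n. c n / d n * exp (c n) * exp (- B)) \<longlonglongrightarrow> exp B * exp (- B)"
        by (intro tendsto_intros ball)
      then show "(\<lambda>n. c n / d n * exp (c n) * exp (- B)) \<longlonglongrightarrow> 1" by (simp add: mult_exp_exp)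
      show "\<forall>\<^sub>F n in sequentially. c n / d n * exp (c n) * exp (- B)
          = (exp (c n) / (exp B + 1)) / (real n / (d n ^ (i n - 1) * (1 + exp (- B))))"
        using d_le_n i_ge
      proof eventually_elim
        case (elim n)
        then obtain j where "i n = Suc j" by (metis Suc_le_D numeral_2_eq_2)
        then have pw: "d n ^ (i n - 1) = n * (c n / d n)" using c_eq elim by simp
        have B2: "1 + exp (- B) = (exp B + 1) * exp (- B)" by (simp add: distrib_right mult_exp_exp)
        have cancel: "x * y * z = (y / b) / (m / (m * x * (b * z)))" if "b \<noteq> 0" "m \<noteq> 0" for b m x y z :: real
          using that by simp
        show ?case unfolding pw B2 by (rule cancel) (use elim B1 in auto)
      qed
    qed
    then show "(\<lambda>n. (ln (d n) + 2 * ln (ln (real n))) * (exp (c n) / (exp B + 1))) \<sim>[sequentially]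
        (\<lambda>n. (ln (d n) + 2 * ln (ln (real n))) * (real n / (d n ^ (i n - 1) * (1 + exp (- B)))))"
      by (intro asymp_equiv_intros asymp_equivI')
  qed
  have iv: "aas_at_most p \<zeta> (\<lambda>n. (ln (d n) + 2 * ln (ln (real n))) * (real n / d n ^ (i n - 1)))"
    if top: "filterlim (\<lambda>n. c n - ?m n) at_top sequentially" and c_le: "\<forall>\<^sub>F n in sequentially. c n \<le> 3 * ln (real n)"
  proof -
    have "\<forall>\<^sub>F n in sequentially. 0 \<le> c n - ?m n" using top unfolding filterlim_at_top by blast
    moreover have "\<forall>\<^sub>F n in sequentially. 1 \<le> ?m n" using m_top by (simp add: filterlim_at_top)
    ultimately have c_ge: "\<forall>\<^sub>F n in sequentially. 1 \<le> c n" by eventually_elim simp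
    interpret sparse_regime p d c i 1 by (intro regime c_ge c_le) simp
    have "\<forall>\<^sub>F n in sequentially. real n / d n ^ (i n - 1) \<le> (1 + \<eta>) * (real n / d n ^ (i n - 1))"
      if "0 < \<eta>" for \<eta> :: real
    proof (rule always_eventually, rule allI)
      fix n
      have "1 * (real n / d n ^ (i n - 1)) \<le> (1 + \<eta>) * (real n / d n ^ (i n - 1))"
        using that d0[of n] by (intro mult_right_mono) auto
      then show "real n / d n ^ (i n - 1) \<le> (1 + \<eta>) * (real n / d n ^ (i n - 1))" by simp
    qed
    then show ?thesis unfolding \<zeta> by (rule localization_number_le_balls)
  qed
  show ?thesis using i ii iii iii' iv by blast
qed

end
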